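(* Let $X=\mathbf{R}/\mathbf{Z}$ and let $H$ be a subgroup of $G=\mathrm{PC}_{\mathbf{Aff}}(X)$ such that $(G,H)$ has relative Property FW. Then there exist an affinely modeled curve $X'$ and a piecewise affine isomorphism $\varphi:X\dashrightarrow X'$ such that the induced embedding of $H$ into $\mathrm{PC}_{\mathbf{Aff}}(X')$, $h\mapsto \varphi h\varphi^{-1}$, maps $H$ into $\mathrm{Aut}_{\mathbf{Aff}}(X')$. If in addition $H$ is infinite and contained in $\mathrm{PC}^0_{\mathbf{Aff}}(X)$, then $X'$ and $\varphi$ can be chosen so that, in addition, $\varphi$ is given by a piecewise affine homeomorphism $X\to X'$ (in particular $X'$ is then an affine circle, possibly non-standard, i.e. possibly not affinely isomorphic to $\mathbf{R}/\mathbf{Z}$).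
   Context: An affinely modeled curve is a Hausdorff topological space endowed with an atlas of charts valued in open subsets of the affine line $\mathbf{R}$, with changes of charts locally of the form $x\mapsto ax+b$, $a\ne 0$. The circle $\mathbf{R}/\mathbf{Z}$ carries the affine structure for which local inverses of $\mathbf{R}\to\mathbf{R}/\mathbf{Z}$ are charts. An affine isomorphism is a homeomorphism that is locally affine in charts; $\mathrm{Aut}_{\mathbf{Aff}}(X')$ is the group of affine automorphisms of $X'$. For affinely modeled curves $X,X'$, a piecewise affine isomorphism $X\dashrightarrow X'$ is an affine isomorphism $X\smallsetminus F\to X'\smallsetminus F'$ with $F,F'$ finite, two of these being identified if they agree on a cofinite subset. Piecewise affine isomorphisms from $X$ to itself form the group $\mathrm{PC}_{\mathbf{Aff}}(X)$. $\mathrm{PC}^0_{\mathbf{Aff}}(X)$ is the subgroup of those elements that are represented by a self-homeomorphism of $X$. A piecewise affine homeomorphism $X\to X'$ is a homeomorphism $X\to X'$ that restricts to an affine isomorphism between cofinite subsets. Relative Property FW: given a group $G$ acting on a set $Y$, a subset $M\subset Y$ is commensurated if $M\bigtriangleup gM$ is finite for every $g\in G$. For a subgroup $H\le G$, the pair $(G,H)$ has relative Property FW if for every $G$-set $Y$ and every $G$-commensurated subset $M\subset Y$ there is an $H$-invariant subset $M_0\subset Y$ with $M\bigtriangleup M_0$ finite. (Groups are considered as discrete groups.) *)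

theory Defs
  imports "HOL-Analysis.Analysis" "HOL-Algebra.Group_Action"
begin

section \<open>Affinely modeled curves\<close>

definition locally_affine_on :: "real set \<Rightarrow> (real \<Rightarrow> real) \<Rightarrow> bool" where
  "locally_affine_on S f \<longleftrightarrow>
     (\<forall>x\<in>S. \<exists>a b. a \<noteq> 0 \<and> (\<exists>T. open T \<and> x \<in> T \<and> (\<forall>y\<in>T \<inter> S. f y = a * y + b)))"

text \<open>A chart is a pair \<open>(U, c)\<close>; only the values of \<open>c\<close> on \<open>U\<close> matter.\<close>

record 'a curve =
  ctop :: "'a topology"
  atlas :: "('a set \<times> ('a \<Rightarrow> real)) set"

abbreviation points :: "'a curve \<Rightarrow> 'a set" where
  "points X \<equiv> topspace (ctop X)"

definition is_chart :: "'a topology \<Rightarrow> 'a set \<times> ('a \<Rightarrow> real) \<Rightarrow> bool" where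
  "is_chart T = (\<lambda>(U, c). openin T U \<and> open (c ` U) \<and>
     homeomorphic_map (subtopology T U) (top_of_set (c ` U)) c)"

definition affine_curve :: "'a curve \<Rightarrow> bool" where
  "affine_curve X \<longleftrightarrow>
     Hausdorff_space (ctop X) \<and>
     (\<forall>C\<in>atlas X. is_chart (ctop X) C) \<and>
     (\<Union>(U, c)\<in>atlas X. U) = points X \<and>
     (\<forall>(U, c)\<in>atlas X. \<forall>(V, d)\<in>atlas X.
        locally_affine_on (c ` (U \<inter> V)) (d \<circ> inv_into U c))"

definition affine_iso :: "'a curve \<Rightarrow> 'b curve \<Rightarrow> ('a \<Rightarrow> 'b) \<Rightarrow> bool" where
  "affine_iso X Y f \<longleftrightarrow>
     homeomorphic_map (ctop X) (ctop Y) f \<and>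
     (\<forall>(U, c)\<in>atlas X. \<forall>(V, d)\<in>atlas Y.
        locally_affine_on (c ` {x\<in>U. f x \<in> V}) (d \<circ> f \<circ> inv_into U c))"

definition remove :: "'a set \<Rightarrow> 'a curve \<Rightarrow> 'a curve" where
  "remove F X = \<lparr>ctop = subtopology (ctop X) (points X - F),
                 atlas = (\<lambda>(U, c). (U - F, c)) ` atlas X\<rparr>"

section \<open>Piecewise affine isomorphisms\<close>

text \<open>
  A piecewise affine isomorphism is an equivalence class of functions. The values of a
  representative on the finite set \<open>F\<close> below, and off \<open>points X\<close>, are arbitrary, so that
  a class contains every function that agrees with one of its members on a cofinite subset
  of \<open>X\<close>.
\<close>

definition pw_affine :: "'a curve \<Rightarrow> 'b curve \<Rightarrow> ('a \<Rightarrow> 'b) \<Rightarrow> bool" where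
  "pw_affine X Y f \<longleftrightarrow>
     (\<exists>F F'. finite F \<and> F \<subseteq> points X \<and> finite F' \<and> F' \<subseteq> points Y \<and>
        affine_iso (remove F X) (remove F' Y) f)"

definition pw_eq :: "'a curve \<Rightarrow> ('a \<Rightarrow> 'b) \<Rightarrow> ('a \<Rightarrow> 'b) \<Rightarrow> bool" where
  "pw_eq X f g \<longleftrightarrow> finite {x\<in>points X. f x \<noteq> g x}"

definition pw_class :: "'a curve \<Rightarrow> ('a \<Rightarrow> 'b) \<Rightarrow> ('a \<Rightarrow> 'b) set" where
  "pw_class X f = {g. pw_eq X f g}"

definition pw_iso :: "'a curve \<Rightarrow> 'b curve \<Rightarrow> ('a \<Rightarrow> 'b) set set" where
  "pw_iso X Y = pw_class X ` {f. pw_affine X Y f}"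

text \<open>In \<open>pw_comp X B A\<close>, the class \<open>A\<close> is applied first and \<open>X\<close> is its domain.\<close>

definition pw_comp :: "'a curve \<Rightarrow> ('b \<Rightarrow> 'c) set \<Rightarrow> ('a \<Rightarrow> 'b) set \<Rightarrow> ('a \<Rightarrow> 'c) set" where
  "pw_comp X B A = (\<Union>g\<in>B. \<Union>f\<in>A. pw_class X (g \<circ> f))"

definition pw_inv :: "'a curve \<Rightarrow> 'b curve \<Rightarrow> ('a \<Rightarrow> 'b) set \<Rightarrow> ('b \<Rightarrow> 'a) set" where
  "pw_inv X Y A = {g. \<exists>f\<in>A. pw_eq X (g \<circ> f) id \<and> pw_eq Y (f \<circ> g) id}"

definition pw_conj ::
  "'a curve \<Rightarrow> 'b curve \<Rightarrow> ('a \<Rightarrow> 'b) set \<Rightarrow> ('a \<Rightarrow> 'a) set \<Rightarrow> ('b \<Rightarrow> 'b) set" where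
  "pw_conj X Y \<phi> h = pw_comp Y (pw_comp X \<phi> h) (pw_inv X Y \<phi>)"

definition PC_Aff :: "'a curve \<Rightarrow> ('a \<Rightarrow> 'a) set monoid" where
  "PC_Aff X = \<lparr>carrier = pw_iso X X, mult = pw_comp X, one = pw_class X id\<rparr>"

definition PC0_Aff :: "'a curve \<Rightarrow> ('a \<Rightarrow> 'a) set set" where
  "PC0_Aff X = {A \<in> pw_iso X X. \<exists>f\<in>A. homeomorphic_map (ctop X) (ctop X) f}"

text \<open>
  Affine automorphisms, seen in the group of piecewise affine isomorphisms. No information is
  lost: curves have no isolated point, so an affine automorphism is determined on \<open>points X\<close>
  by its class.
\<close>

definition Aut_Aff :: "'a curve \<Rightarrow> ('a \<Rightarrow> 'a) set set" where
  "Aut_Aff X = pw_class X ` {f. affine_iso X X f}"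

definition pw_affine_homeo :: "'a curve \<Rightarrow> 'b curve \<Rightarrow> ('a \<Rightarrow> 'b) \<Rightarrow> bool" where
  "pw_affine_homeo X Y f \<longleftrightarrow> homeomorphic_map (ctop X) (ctop Y) f \<and> pw_affine X Y f"

section \<open>The standard affine circle\<close>

quotient_type circle = real / "\<lambda>x y. x - y \<in> \<int>"
  morphisms circle_rep circle_proj
proof (rule equivpI)
  show "reflp (\<lambda>x y::real. x - y \<in> \<int>)"
    by (simp add: reflp_def)
  show "symp (\<lambda>x y::real. x - y \<in> \<int>)"
    unfolding symp_def using Ints_minus by fastforce
  show "transp (\<lambda>x y::real. x - y \<in> \<int>)"
    unfolding transp_def using Ints_add by fastforce
qed

instantiation circle :: topological_space
begin

definition open_circle :: "circle set \<Rightarrow> bool" where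
  "open_circle U \<longleftrightarrow> open (circle_proj -` U)"

instance
  by standard (auto simp: open_circle_def vimage_Union intro!: open_Int)

end

text \<open>
  The type \<open>circle\<close> also serves as the type of points of other curves. A curve \<open>X'\<close> with
  a piecewise affine isomorphism from \<open>std_circle\<close> to \<open>X'\<close> has the cardinality of the
  continuum, so up to affine isomorphism all of them occur as some \<open>X' :: circle curve\<close>,
  whose topology need not be that of \<open>circle\<close>.
\<close>

definition std_circle :: "circle curve" where
  "std_circle = \<lparr>ctop = euclidean,
     atlas = {(circle_proj ` I, inv_into I circle_proj) |I. open I \<and> inj_on circle_proj I}\<rparr>"

section \<open>Relative Property FW\<close>

definition commensurated ::
  "('g, 'm) monoid_scheme \<Rightarrow> ('g \<Rightarrow> 'y \<Rightarrow> 'y) \<Rightarrow> 'y set \<Rightarrow> bool" where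
  "commensurated G \<alpha> M \<longleftrightarrow> (\<forall>g\<in>carrier G. finite (sym_diff M (\<alpha> g ` M)))"

text \<open>
  HOL cannot quantify over all types inside a formula, so the \<open>G\<close>-sets below have their points
  in one type, built from the type of the elements of \<open>G\<close>. This is no restriction: see
  \<open>relative_FW_all_types\<close>.
\<close>

definition relative_FW :: "('g, 'm) monoid_scheme \<Rightarrow> 'g set \<Rightarrow> bool" where
  "relative_FW G H \<longleftrightarrow>
     (\<forall>(Y :: ('g \<times> nat) set) \<alpha> M.
        group_action G Y \<alpha> \<and> M \<subseteq> Y \<and> commensurated G \<alpha> M \<longrightarrow>
        (\<exists>M0 \<subseteq> Y. (\<forall>h\<in>H. \<alpha> h ` M0 = M0) \<and> finite (sym_diff M M0)))"

lemma relative_FW_all_types: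
  fixes G :: "('g, 'm) monoid_scheme" (structure) and Y :: "'y set"
  assumes FW: "relative_FW G H" and H: "H \<subseteq> carrier G"
    and act: "group_action G Y \<alpha>" and MY: "M \<subseteq> Y" and comm: "commensurated G \<alpha> M"
  shows "\<exists>M0 \<subseteq> Y. (\<forall>h\<in>H. \<alpha> h ` M0 = M0) \<and> finite (sym_diff M M0)"
proof -
  interpret group_action G Y \<alpha> by (rule act)
  have grp: "group G" using group_hom by (simp add: group_hom_def)
  interpret group G by (rule grp)
  define D where "D g = sym_diff M (\<alpha> g ` M)" for g
  define S where "S = (\<Union>g\<in>carrier G. D g)"
  define Z where "Z = (\<Union>g\<in>carrier G. \<alpha> g ` S)"
  have clY: "\<alpha> g y \<in> Y" if "g \<in> carrier G" "y \<in> Y" for g y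
    using element_image that by blast
  have comp: "\<alpha> (g \<otimes> k) y = \<alpha> g (\<alpha> k y)" if "g \<in> carrier G" "k \<in> carrier G" "y \<in> Y" for g k y
    using composition_rule that by simp
  have one: "\<alpha> \<one> y = y" if "y \<in> Y" for y
    using id_eq_one that by (metis restrict_apply')
  have inv1: "\<alpha> g (\<alpha> (inv g) y) = y" if "g \<in> carrier G" "y \<in> Y" for g y
    using comp[of g "inv g" y] that one by simp
  have inv2: "\<alpha> (inv g) (\<alpha> g y) = y" if "g \<in> carrier G" "y \<in> Y" for g y
    using comp[of "inv g" g y] that one by simp
  have finD: "finite (D g)" if "g \<in> carrier G" for g
    using comm that by (simp add: commensurated_def D_def)
  have SY: "S \<subseteq> Y"
    using MY clY by (auto simp: S_def D_def)
  have ZY: "Z \<subseteq> Y"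
    using SY clY by (auto simp: Z_def)
  have SZ: "S \<subseteq> Z"
  proof
    fix s assume "s \<in> S"
    then have "s = \<alpha> \<one> s" using SY one by auto
    then show "s \<in> Z" using \<open>s \<in> S\<close> unfolding Z_def by blast
  qed
  have clZ: "\<alpha> g z \<in> Z" if "g \<in> carrier G" "z \<in> Z" for g z
  proof -
    obtain k s where "k \<in> carrier G" "s \<in> S" "z = \<alpha> k s" using \<open>z \<in> Z\<close> by (auto simp: Z_def)
    then have "\<alpha> g z = \<alpha> (g \<otimes> k) s" using comp that SY by auto
    then show ?thesis using \<open>k \<in> carrier G\<close> \<open>s \<in> S\<close> that unfolding Z_def by blast
  qed
  have "\<exists>e :: 'y \<Rightarrow> 'g \<times> nat. inj_on e Z"
  proof -
    define p where "p s = (SOME g. g \<in> carrier G \<and> s \<in> D g)" for s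
    have p: "p s \<in> carrier G" "s \<in> D (p s)" if "s \<in> S" for s
    proof -
      have "\<exists>g. g \<in> carrier G \<and> s \<in> D g" using that by (auto simp: S_def)
      from someI_ex[OF this] show "p s \<in> carrier G" "s \<in> D (p s)" by (auto simp: p_def)
    qed
    define i where "i s = (p s, to_nat_on (D (p s)) s)" for s
    have inji: "inj_on i S"
    proof (rule inj_onI)
      fix s t assume st: "s \<in> S" "t \<in> S" "i s = i t"
      then have "countable (D (p s))" "p s = p t"
        using p finD by (auto simp: i_def countable_finite)
      then show "s = t" using st p unfolding i_def
        by (metis inj_onD inj_on_to_nat_on prod.inject)
    qed
    have "\<exists>q. fst q \<in> carrier G \<and> snd q \<in> S \<and> z = \<alpha> (fst q) (snd q)" if "z \<in> Z" for z
      using that by (auto simp: Z_def)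
    then obtain q where q: "\<And>z. z \<in> Z \<Longrightarrow> snd (q z) \<in> S \<and> z = \<alpha> (fst (q z)) (snd (q z))"
      by metis
    define j where "j z = ((fst (q z), 0::nat), i (snd (q z)))" for z
    have injj: "inj_on j Z"
    proof (rule inj_onI)
      fix z w assume zw: "z \<in> Z" "w \<in> Z" "j z = j w"
      then have "fst (q z) = fst (q w)" "snd (q z) = snd (q w)"
        using q inji by (auto simp: j_def inj_on_def)
      then show "z = w" using q zw by metis
    qed
    have "infinite (UNIV :: ('g \<times> nat) set)"
      by (simp add: finite_prod)
    from card_of_Times_same_infinite[OF this]
    obtain b :: "('g \<times> nat) \<times> ('g \<times> nat) \<Rightarrow> 'g \<times> nat" where "bij_betw b UNIV UNIV"
      by (auto simp: card_of_ordIso[symmetric])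
    then have "inj_on (b \<circ> j) Z"
      using injj by (metis bij_betw_imp_inj_on comp_inj_on inj_on_subset subset_UNIV)
    then show ?thesis by blast
  qed
  then obtain e :: "'y \<Rightarrow> 'g \<times> nat" where e: "inj_on e Z" by blast
  define r where "r = inv_into Z e"
  have re: "r (e z) = z" if "z \<in> Z" for z using e that by (simp add: r_def)
  define \<beta> where "\<beta> g = (\<lambda>w\<in>e ` Z. e (\<alpha> g (r w)))" for g
  have \<beta>e: "\<beta> g (e z) = e (\<alpha> g z)" if "z \<in> Z" for g z
    using that by (simp add: \<beta>_def re)
  have \<beta>Bij: "\<beta> g \<in> Bij (e ` Z)" if g: "g \<in> carrier G" for g
  proof -
    have "bij_betw (\<beta> g) (e ` Z) (e ` Z)"
    proof (rule bij_betw_byWitness[where f' = "\<beta> (inv g)"])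
      have zY: "z \<in> Z \<Longrightarrow> z \<in> Y" for z using ZY by blast
      show "\<forall>a\<in>e ` Z. \<beta> (inv g) (\<beta> g a) = a"
        using g by (auto simp: \<beta>e clZ inv2 zY)
      show "\<forall>a\<in>e ` Z. \<beta> g (\<beta> (inv g) a) = a"
        using g by (auto simp: \<beta>e clZ inv1 zY)
      show "\<beta> g ` e ` Z \<subseteq> e ` Z" "\<beta> (inv g) ` e ` Z \<subseteq> e ` Z"
        using g by (auto simp: \<beta>e clZ)
    qed
    then show ?thesis by (simp add: Bij_def \<beta>_def)
  qed
  have "group_action G (e ` Z) \<beta>"
    unfolding group_action_def group_hom_def group_hom_axioms_def
  proof (intro conjI homI)
    show "group G" by (rule grp)
    show "group (BijGroup (e ` Z))" by (rule group_BijGroup)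
    show "\<beta> g \<in> carrier (BijGroup (e ` Z))" if "g \<in> carrier G" for g
      using \<beta>Bij that by (simp add: BijGroup_def)
    show "\<beta> (g \<otimes> k) = \<beta> g \<otimes>\<^bsub>BijGroup (e ` Z)\<^esub> \<beta> k" if "g \<in> carrier G" "k \<in> carrier G" for g k
    proof -
      have "\<beta> (g \<otimes> k) w = compose (e ` Z) (\<beta> g) (\<beta> k) w" for w
      proof (cases "w \<in> e ` Z")
        case True
        then obtain z where z: "z \<in> Z" "w = e z" by blast
        then have "z \<in> Y" using ZY by blast
        then show ?thesis using z that by (simp add: compose_def \<beta>e clZ comp)
      qed (simp add: compose_def \<beta>_def)
      then show ?thesis using \<beta>Bij that by (auto simp: BijGroup_def)
    qed
  qed
  moreover have "e ` (M \<inter> Z) \<subseteq> e ` Z" by blast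
  moreover have "commensurated G \<beta> (e ` (M \<inter> Z))"
    unfolding commensurated_def
  proof
    fix g assume g: "g \<in> carrier G"
    have *: "\<beta> g ` e ` (M \<inter> Z) = e ` (\<alpha> g ` (M \<inter> Z))"
      by (auto simp: image_image \<beta>e)
    have **: "\<alpha> g ` (M \<inter> Z) = \<alpha> g ` M \<inter> Z"
    proof (intro equalityI subsetI)
      fix y assume "y \<in> \<alpha> g ` M \<inter> Z"
      then obtain m where m: "m \<in> M" "y = \<alpha> g m" "y \<in> Z" by blast
      then have "m = \<alpha> (inv g) y" using inv2 g MY by auto
      then have "m \<in> Z" using clZ[of "inv g" y] g m(3) by simp
      then show "y \<in> \<alpha> g ` (M \<inter> Z)" using m by blast
    qed (use clZ g in auto)
    have "sym_diff (e ` (M \<inter> Z)) (e ` (\<alpha> g ` M \<inter> Z)) \<subseteq> e ` D g"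
      by (auto simp: D_def)
    then show "finite (sym_diff (e ` (M \<inter> Z)) (\<beta> g ` e ` (M \<inter> Z)))"
      unfolding * ** using finD[OF g] by (meson finite_imageI finite_subset)
  qed
  ultimately obtain N where N: "N \<subseteq> e ` Z" "\<And>h. h \<in> H \<Longrightarrow> \<beta> h ` N = N"
    "finite (sym_diff (e ` (M \<inter> Z)) N)"
    using FW unfolding relative_FW_def by metis
  obtain L where L: "L \<subseteq> Z" "N = e ` L" using N(1) by (metis subset_imageE)
  have inve: "e x = e y \<longleftrightarrow> x = y" if "x \<in> Z" "y \<in> Z" for x y
    using e that by (auto simp: inj_on_def)
  have Lh: "\<alpha> h ` L = L" if "h \<in> H" for h
  proof -
    have "\<beta> h ` e ` L = e ` \<alpha> h ` L" 
      using L(1) \<beta>e by (auto simp: image_image subset_iff intro!: image_cong)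
    then have "e ` \<alpha> h ` L = e ` L" using N(2)[OF that] L(2) by simp
    moreover have "\<alpha> h ` L \<subseteq> Z" using L clZ H that by blast
    ultimately show ?thesis using L(1) e by (simp add: inj_on_image_eq_iff)
  qed
  have Mh: "\<alpha> h ` (M - Z) = M - Z" if "h \<in> H" for h
  proof -
    have h: "h \<in> carrier G" using H that by blast
    have "x \<in> M \<longleftrightarrow> x \<in> \<alpha> h ` M" if "x \<notin> Z" for x
      using that SZ h by (auto simp: S_def D_def)
    moreover have "\<alpha> h m \<in> Z \<longleftrightarrow> m \<in> Z" if "m \<in> M" for m
      using that MY h clZ inv2 by (metis inv_closed subsetD)
    ultimately show ?thesis by blast
  qed
  have "finite (sym_diff (M \<inter> Z) L)"
  proof -
    have "sym_diff (e ` (M \<inter> Z)) N = e ` sym_diff (M \<inter> Z) L"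
      using L inve by auto
    moreover have "inj_on e (sym_diff (M \<inter> Z) L)"
      using e L(1) by (auto simp: inj_on_def)
    ultimately show ?thesis using N(3) by (simp add: finite_image_iff)
  qed
  moreover have "sym_diff M ((M - Z) \<union> L) \<subseteq> sym_diff (M \<inter> Z) L" using L(1) by auto
  ultimately have "finite (sym_diff M ((M - Z) \<union> L))" by (meson finite_subset)
  moreover have "(M - Z) \<union> L \<subseteq> Y" using MY ZY L by blast
  moreover have "\<forall>h\<in>H. \<alpha> h ` ((M - Z) \<union> L) = (M - Z) \<union> L"
    using Mh Lh by (simp add: image_Un)
  ultimately show ?thesis by blast
qed

section \<open>The standard circle is a curve\<close>

lemma proj_eq: "circle_proj x = circle_proj y \<longleftrightarrow> x - y \<in> \<int>"
  by (simp add: circle.abs_eq_iff)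

lemma proj_surj: "\<exists>x. p = circle_proj x"
  by (metis Quotient3_abs_rep Quotient3_circle)

lemma open_proj: assumes "open I" shows "open (circle_proj ` I)"
proof -
  have "circle_proj -` circle_proj ` I = (\<Union>n::int. (\<lambda>x. x + of_int n) ` I)"
  proof (intro equalityI subsetI)
    fix y assume "y \<in> circle_proj -` circle_proj ` I"
    then obtain x n where "x \<in> I" "y - x = of_int n" by (auto simp: proj_eq elim!: Ints_cases)
    then have "y = x + of_int n" by simp
    then show "y \<in> (\<Union>n::int. (\<lambda>x. x + of_int n) ` I)" using \<open>x \<in> I\<close> by blast
  next
    fix y assume "y \<in> (\<Union>n::int. (\<lambda>x. x + of_int n) ` I)"
    then obtain x n where x: "x \<in> I" "y = x + of_int n" by blast
    then have "circle_proj y = circle_proj x" by (simp add: proj_eq)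
    then show "y \<in> circle_proj -` circle_proj ` I" using x by simp
  qed
  moreover have "open ((\<lambda>x. x + of_int n) ` I)" for n :: int
    using open_translation[OF assms, of "of_int n"] by (simp add: add.commute)
  ultimately show ?thesis by (auto simp: open_circle_def)
qed

lemma circle_chart:
  assumes I: "open I" "inj_on circle_proj I"
  shows "is_chart euclidean (circle_proj ` I, inv_into I circle_proj)"
proof -
  let ?c = "inv_into I circle_proj"
  have im: "?c ` circle_proj ` I = I" using I by (simp add: inv_into_image_cancel)
  have "homeomorphic_maps (top_of_set I) (top_of_set (circle_proj ` I)) circle_proj ?c"
    unfolding homeomorphic_maps_def
  proof (intro conjI ballI)
    have "continuous_on UNIV circle_proj"
      by (simp add: continuous_on_open_vimage open_circle_def[symmetric])
    then show "continuous_map (top_of_set I) (top_of_set (circle_proj ` I)) circle_proj"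
      using continuous_on_subset by auto
    have "continuous_on (circle_proj ` I) ?c"
      unfolding continuous_on_open_vimage[OF open_proj[OF I(1)]]
    proof (intro allI impI)
      fix B :: "real set" assume "open B"
      have "?c -` B \<inter> circle_proj ` I = circle_proj ` (B \<inter> I)" using I by auto
      then show "open (?c -` B \<inter> circle_proj ` I)" using open_proj[OF open_Int[OF \<open>open B\<close> I(1)]] by simp
    qed
    then show "continuous_map (top_of_set (circle_proj ` I)) (top_of_set I) ?c" using im by auto
  qed (use I in auto)
  then have "homeomorphic_map (top_of_set (circle_proj ` I)) (top_of_set I) ?c"
    using homeomorphic_maps_sym homeomorphic_maps_map by blast
  then show ?thesis using I im open_proj by (simp add: is_chart_def)
qed

lemma affine_curve_std_circle: "affine_curve std_circle"
  unfolding affine_curve_def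
proof (intro conjI)
  have inj: "inj_on circle_proj {x - 1/2 <..< x + 1/2}" for x
  proof (rule inj_onI)
    fix y z assume "y \<in> {x - 1/2 <..< x + 1/2}" "z \<in> {x - 1/2 <..< x + 1/2}" "circle_proj y = circle_proj z"
    then obtain n :: int where "y - z = of_int n" "\<bar>y - z\<bar> < 1"
      by (auto simp: proj_eq abs_less_iff elim!: Ints_cases)
    then have "n = 0" by linarith
    then show "y = z" using \<open>y - z = of_int n\<close> by simp
  qed
  show "\<forall>C\<in>atlas std_circle. is_chart (ctop std_circle) C"
    using circle_chart by (auto simp: std_circle_def)
  show "(\<Union>(U, c)\<in>atlas std_circle. U) = points std_circle"
  proof -
    have "\<exists>I. p \<in> circle_proj ` I \<and> open I \<and> inj_on circle_proj I" for p
    proof -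
      obtain x where "p = circle_proj x" using proj_surj by blast
      then have "p \<in> circle_proj ` {x - 1/2 <..< x + 1/2}" by auto
      then show ?thesis using inj open_greaterThanLessThan by blast
    qed
    then have "p \<in> (\<Union>(U, c)\<in>atlas std_circle. U)" for p
      by (simp add: std_circle_def) blast
    then show ?thesis by (auto simp: std_circle_def)
  qed
  have "Hausdorff_space (euclidean :: circle topology)"
    unfolding Hausdorff_space_def
  proof (intro allI impI)
    fix p q :: circle assume pq: "p \<in> topspace euclidean \<and> q \<in> topspace euclidean \<and> p \<noteq> q"
    obtain x y where xy: "p = circle_proj x" "q = circle_proj y" using proj_surj by meson
    define t where "t = frac (x - y)"
    have t: "0 < t" "t < 1" using pq xy by (auto simp: t_def proj_eq frac_lt_1)
    define e where "e = min t (1 - t) / 2"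
    have e: "0 < e" "2*e \<le> t" "2*e \<le> 1 - t" using t by (auto simp: e_def)
    have "disjnt (circle_proj ` {x - e <..< x + e}) (circle_proj ` {y - e <..< y + e})"
    proof (rule ccontr)
      assume "\<not> ?thesis"
      then obtain u v where uv: "u \<in> {x - e <..< x + e}" "v \<in> {y - e <..< y + e}" "u - v \<in> \<int>"
        by (auto simp: disjnt_iff proj_eq)
      then obtain n :: int where n: "u - v = of_int n" by (auto elim: Ints_cases)
      have "x - y = of_int \<lfloor>x - y\<rfloor> + t" by (simp add: t_def frac_def)
      then have "of_int n < (of_int (\<lfloor>x - y\<rfloor> + 1) :: real)" "of_int \<lfloor>x - y\<rfloor> < (of_int n :: real)"
        using uv n e by auto
      then have "n < \<lfloor>x - y\<rfloor> + 1" "\<lfloor>x - y\<rfloor> < n" by (simp_all only: of_int_less_iff)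
      then show False by linarith
    qed
    moreover have "p \<in> circle_proj ` {x - e <..< x + e}" "q \<in> circle_proj ` {y - e <..< y + e}"
      using xy e by auto
    ultimately show "\<exists>U V. openin euclidean U \<and> openin euclidean V \<and> p \<in> U \<and> q \<in> V \<and> disjnt U V"
      using open_proj by (metis open_openin open_greaterThanLessThan)
  qed
  then show "Hausdorff_space (ctop std_circle)" by (simp add: std_circle_def)
  show "\<forall>(U, c)\<in>atlas std_circle. \<forall>(V, d)\<in>atlas std_circle. locally_affine_on (c ` (U \<inter> V)) (d \<circ> inv_into U c)"
  proof clarify
    fix U c V d assume "(U, c) \<in> atlas std_circle" "(V, d) \<in> atlas std_circle"
    then obtain I J where I: "open I" "inj_on circle_proj I" "U = circle_proj ` I" "c = inv_into I circle_proj"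
      and J: "open J" "inj_on circle_proj J" "V = circle_proj ` J" "d = inv_into J circle_proj"
      by (auto simp: std_circle_def)
    have injc: "inj_on c U" using I by (simp add: inj_on_inv_into)
    show "locally_affine_on (c ` (U \<inter> V)) (d \<circ> inv_into U c)"
      unfolding locally_affine_on_def
    proof
      fix x assume "x \<in> c ` (U \<inter> V)"
      then obtain i j where ij: "i \<in> I" "j \<in> J" "circle_proj i = circle_proj j" "x = c (circle_proj i)"
        using I J by auto
      then have "x = i" using inv_into_f_f[OF I(2) ij(1)] I(4) by metis
      let ?b = "j - i"
      have b: "?b \<in> \<int>" using ij by (metis proj_eq)
      let ?T = "I \<inter> (\<lambda>y. y + ?b) -` J"
      have "open ?T" using I J by (intro open_Int open_vimage continuous_intros) auto
      moreover have "x \<in> ?T" using ij \<open>x = i\<close> by auto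
      moreover have "(d \<circ> inv_into U c) y = 1 * y + ?b" if "y \<in> ?T" for y
      proof -
        have "inv_into U c y = circle_proj y"
          using that I injc by (metis IntD1 image_eqI inv_into_f_f)
        moreover have "circle_proj y = circle_proj (y + ?b)"
          using b by (simp add: proj_eq) (metis Ints_minus minus_diff_eq)
        ultimately show ?thesis using that J by simp
      qed
      ultimately show "\<exists>a b. a \<noteq> 0 \<and> (\<exists>T. open T \<and> x \<in> T \<and> (\<forall>y\<in>T \<inter> c ` (U \<inter> V). (d \<circ> inv_into U c) y = a * y + b))"
        by (metis IntD1 zero_neq_one)
    qed
  qed
qed

section \<open>Piecewise affine isomorphisms form a group\<close>

text \<open>Local affinity read on the curve itself instead of in the image of a chart.\<close>

lemma la_chart:
  assumes C: "is_chart T (U, c)" and S: "S \<subseteq> U"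
  shows "locally_affine_on (c ` S) (k \<circ> inv_into U c) \<longleftrightarrow>
    (\<forall>p\<in>S. \<exists>a b. a \<noteq> 0 \<and> (\<exists>W. openin T W \<and> p \<in> W \<and> W \<subseteq> U \<and> (\<forall>q\<in>W \<inter> S. k q = a * c q + b)))"
proof -
  have U: "openin T U" "open (c ` U)" and h: "homeomorphic_map (subtopology T U) (top_of_set (c ` U)) c"
    using C by (auto simp: is_chart_def)
  have tU: "topspace (subtopology T U) = U" using openin_subset[OF U(1)] by auto
  have inj: "inj_on c U" using h tU by (metis homeomorphic_imp_injective_map)
  have ic: "inv_into U c (c q) = q" if "q \<in> U" for q using inj that by simp
  have op1: "openin T {q\<in>U. c q \<in> V}" if "open V" for V
  proof -
    have "openin (top_of_set (c ` U)) (c ` U \<inter> V)"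
      using that by (simp add: openin_open_Int)
    then have "openin (subtopology T U) {q \<in> topspace (subtopology T U). c q \<in> c ` U \<inter> V}"
      using h homeomorphic_imp_continuous_map openin_continuous_map_preimage by blast
    moreover have "{q \<in> topspace (subtopology T U). c q \<in> c ` U \<inter> V} = {q\<in>U. c q \<in> V}"
      using tU by auto
    ultimately show ?thesis using U(1) by (simp add: openin_open_subtopology)
  qed
  have op2: "open (c ` W)" if "openin T W" "W \<subseteq> U" for W
  proof -
    have "openin (subtopology T U) W" using that U by (simp add: openin_open_subtopology)
    then have "openin (top_of_set (c ` U)) (c ` W)"
      using h homeomorphic_imp_open_map unfolding open_map_def by blast
    then show ?thesis using U(2) openin_open_trans by blast
  qed
  show ?thesis (is "?L \<longleftrightarrow> ?R")
  proof
    assume L: ?L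
    show ?R
    proof
      fix p assume p: "p \<in> S"
      then obtain a b V where V: "a \<noteq> 0" "open V" "c p \<in> V"
        "\<And>y. y \<in> V \<inter> c ` S \<Longrightarrow> (k \<circ> inv_into U c) y = a * y + b"
        using L unfolding locally_affine_on_def by (meson imageI)
      have "k q = a * c q + b" if "q \<in> {q\<in>U. c q \<in> V} \<inter> S" for q
        using V(4)[of "c q"] that ic by auto
      then show "\<exists>a b. a \<noteq> 0 \<and> (\<exists>W. openin T W \<and> p \<in> W \<and> W \<subseteq> U \<and> (\<forall>q\<in>W \<inter> S. k q = a * c q + b))"
        using V op1[OF V(2)] p S
        by (intro exI[of _ a] exI[of _ b] conjI exI[of _ "{q\<in>U. c q \<in> V}"]) auto
    qed
  next
    assume R: ?R
    show ?L
      unfolding locally_affine_on_def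
    proof
      fix x assume "x \<in> c ` S"
      then obtain p where p: "p \<in> S" "x = c p" by blast
      then obtain a b W where W: "a \<noteq> 0" "openin T W" "p \<in> W" "W \<subseteq> U"
        "\<And>q. q \<in> W \<inter> S \<Longrightarrow> k q = a * c q + b"
        using R by metis
      have "(k \<circ> inv_into U c) y = a * y + b" if y: "y \<in> c ` W \<inter> c ` S" for y
      proof -
        obtain q r where "y = c q" "q \<in> W" "y = c r" "r \<in> S" using y by blast
        then have "q = r" using inj W(4) S by (metis inj_onD subsetD)
        then show ?thesis using W(5)[of q] \<open>y = c q\<close> \<open>q \<in> W\<close> \<open>r \<in> S\<close> ic W(4) by auto
      qed
      then show "\<exists>a b. a \<noteq> 0 \<and> (\<exists>T. open T \<and> x \<in> T \<and> (\<forall>y\<in>T \<inter> c ` S. (k \<circ> inv_into U c) y = a * y + b))"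
        using W(1) op2[OF W(2,4)] W(3) p(2) by (meson imageI)
    qed
  qed
qed

definition aff_at ::
  "'a curve \<Rightarrow> 'b curve \<Rightarrow> ('a \<Rightarrow> 'b) \<Rightarrow> 'a set \<Rightarrow> ('a \<Rightarrow> real) \<Rightarrow> 'b set \<Rightarrow> ('b \<Rightarrow> real) \<Rightarrow> 'a \<Rightarrow> bool" where
  "aff_at X Y f U c V d p \<longleftrightarrow> (\<exists>a b. a \<noteq> 0 \<and> (\<exists>W. openin (ctop X) W \<and> p \<in> W \<and> W \<subseteq> U \<and>
      (\<forall>q\<in>W. f q \<in> V \<longrightarrow> d (f q) = a * c q + b)))"

definition wf_curve :: "'a curve \<Rightarrow> bool" where
  "wf_curve X \<longleftrightarrow> (\<forall>C\<in>atlas X. is_chart (ctop X) C) \<and> (\<Union>(U, c)\<in>atlas X. U) = points X"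

lemma affine_iso_iff:
  assumes "wf_curve X"
  shows "affine_iso X Y f \<longleftrightarrow> homeomorphic_map (ctop X) (ctop Y) f \<and>
    (\<forall>U c V d. (U, c) \<in> atlas X \<longrightarrow> (V, d) \<in> atlas Y \<longrightarrow> (\<forall>p\<in>U. f p \<in> V \<longrightarrow> aff_at X Y f U c V d p))"
proof -
  have key: "locally_affine_on (c ` {x \<in> U. f x \<in> V}) (d \<circ> f \<circ> inv_into U c) \<longleftrightarrow>
        (\<forall>p\<in>U. f p \<in> V \<longrightarrow> aff_at X Y f U c V d p)" if "(U, c) \<in> atlas X" for U c V d
  proof -
    have "is_chart (ctop X) (U, c)" using that assms unfolding wf_curve_def by blast
    moreover have "{x \<in> U. f x \<in> V} \<subseteq> U" by blast
    ultimately have "locally_affine_on (c ` {x \<in> U. f x \<in> V}) (d \<circ> f \<circ> inv_into U c) \<longleftrightarrow>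
      (\<forall>p\<in>{x \<in> U. f x \<in> V}. \<exists>a b. a \<noteq> 0 \<and> (\<exists>W. openin (ctop X) W \<and> p \<in> W \<and> W \<subseteq> U \<and>
         (\<forall>q\<in>W \<inter> {x \<in> U. f x \<in> V}. (d \<circ> f) q = a * c q + b)))"
      by (rule la_chart)
    also have "\<dots> \<longleftrightarrow> (\<forall>p\<in>{x \<in> U. f x \<in> V}. aff_at X Y f U c V d p)"
    proof (rule ball_cong[OF refl])
      fix p
      have "(\<forall>q\<in>W \<inter> {x \<in> U. f x \<in> V}. (d \<circ> f) q = a * c q + b) \<longleftrightarrow>
            (\<forall>q\<in>W. f q \<in> V \<longrightarrow> d (f q) = a * c q + b)" if "W \<subseteq> U" for W a b
        using that by auto
      then show "(\<exists>a b. a \<noteq> 0 \<and> (\<exists>W. openin (ctop X) W \<and> p \<in> W \<and> W \<subseteq> U \<and>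
         (\<forall>q\<in>W \<inter> {x \<in> U. f x \<in> V}. (d \<circ> f) q = a * c q + b))) \<longleftrightarrow> aff_at X Y f U c V d p"
        unfolding aff_at_def by (simp cong: conj_cong)
    qed
    finally show ?thesis by blast
  qed
  have A: "affine_iso X Y f \<longleftrightarrow> homeomorphic_map (ctop X) (ctop Y) f \<and>
    (\<forall>U c V d. (U, c) \<in> atlas X \<longrightarrow> (V, d) \<in> atlas Y \<longrightarrow>
       locally_affine_on (c ` {x \<in> U. f x \<in> V}) (d \<circ> f \<circ> inv_into U c))"
    unfolding affine_iso_def by (rule arg_cong2[where f = "(\<and>)"]) (rule refl, blast)
  show ?thesis
    unfolding A by (simp add: key cong: imp_cong)
qed

lemma chartD: "wf_curve X \<Longrightarrow> (U, c) \<in> atlas X \<Longrightarrow> openin (ctop X) U"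
  unfolding wf_curve_def is_chart_def by fastforce

lemma chart_ex: "wf_curve X \<Longrightarrow> p \<in> points X \<Longrightarrow> \<exists>U c. (U, c) \<in> atlas X \<and> p \<in> U"
  unfolding wf_curve_def by blast

lemma affine_iso_comp:
  assumes wf: "wf_curve X" "wf_curve Y" and f: "affine_iso X Y f" and g: "affine_iso Y Z g"
  shows "affine_iso X Z (g \<circ> f)"
  unfolding affine_iso_iff[OF wf(1)]
proof (intro conjI allI impI ballI)
  note f' = f[unfolded affine_iso_iff[OF wf(1)]] and g' = g[unfolded affine_iso_iff[OF wf(2)]]
  show "homeomorphic_map (ctop X) (ctop Z) (g \<circ> f)"
    using f' g' by (meson homeomorphic_map_compose)
  fix U c V d p assume *: "(U, c) \<in> atlas X" "(V, d) \<in> atlas Z" "p \<in> U" "(g \<circ> f) p \<in> V"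
  have cf: "continuous_map (ctop X) (ctop Y) f" using conjunct1[OF f'] by (rule homeomorphic_imp_continuous_map)
  have "p \<in> points X" using * chartD[OF wf(1)] openin_subset by blast
  then have "f p \<in> points Y" using cf by (simp add: continuous_map_def Pi_iff)
  then obtain Q w where Q: "(Q, w) \<in> atlas Y" "f p \<in> Q" using chart_ex[OF wf(2)] by metis
  then have "aff_at X Y f U c Q w p" "aff_at Y Z g Q w V d (f p)" using f' g' * by auto
  then obtain a b W a' b' W' where W: "a \<noteq> 0" "openin (ctop X) W" "p \<in> W" "W \<subseteq> U"
       "\<And>q. q \<in> W \<Longrightarrow> f q \<in> Q \<Longrightarrow> w (f q) = a * c q + b"
     and W': "a' \<noteq> 0" "openin (ctop Y) W'" "f p \<in> W'" "W' \<subseteq> Q"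
       "\<And>q. q \<in> W' \<Longrightarrow> g q \<in> V \<Longrightarrow> d (g q) = a' * w q + b'"
    unfolding aff_at_def by metis
  let ?W = "W \<inter> {x \<in> points X. f x \<in> W'}"
  have "openin (ctop X) ?W" using W(2) W'(2) cf openin_continuous_map_preimage by blast
  moreover have "d ((g \<circ> f) q) = (a' * a) * c q + (a' * b + b')" if "q \<in> ?W" "(g \<circ> f) q \<in> V" for q
  proof -
    have "f q \<in> Q" using that W' by auto
    then show ?thesis using that W(5)[of q] W'(5)[of "f q"] by (simp add: algebra_simps)
  qed
  ultimately show "aff_at X Z (g \<circ> f) U c V d p"
    unfolding aff_at_def using W W' \<open>p \<in> points X\<close>
    by (intro exI[of _ "a' * a"] exI[of _ "a' * b + b'"] conjI exI[of _ ?W]) auto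
qed

lemma affine_iso_inv:
  assumes wf: "wf_curve X" "wf_curve Y" and f: "affine_iso X Y f"
    and g: "homeomorphic_maps (ctop X) (ctop Y) f g"
  shows "affine_iso Y X g"
  unfolding affine_iso_iff[OF wf(2)]
proof (intro conjI allI impI ballI)
  note f' = f[unfolded affine_iso_iff[OF wf(1)]]
  show "homeomorphic_map (ctop Y) (ctop X) g"
    using g homeomorphic_maps_map by blast
  fix V d U c y assume *: "(V, d) \<in> atlas Y" "(U, c) \<in> atlas X" "y \<in> V" "g y \<in> U"
  have cg: "continuous_map (ctop Y) (ctop X) g" and fg: "\<And>z. z \<in> points Y \<Longrightarrow> f (g z) = z"
    using g by (auto simp: homeomorphic_maps_def)
  have opV: "openin (ctop Y) V" using * chartD wf by blast
  then have VY: "V \<subseteq> points Y" using openin_subset by blast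
  then have "aff_at X Y f U c V d (g y)" using f' * fg by auto
  then obtain a b W where W: "a \<noteq> 0" "openin (ctop X) W" "g y \<in> W" "W \<subseteq> U"
       "\<And>q. q \<in> W \<Longrightarrow> f q \<in> V \<Longrightarrow> d (f q) = a * c q + b"
    unfolding aff_at_def by metis
  let ?W = "{z \<in> points Y. g z \<in> W} \<inter> V"
  have "openin (ctop Y) ?W" using W(2) opV cg openin_continuous_map_preimage by blast
  moreover have "c (g z) = inverse a * d z + (- b / a)" if "z \<in> ?W" for z
    using that W(5)[of "g z"] fg[of z] W(1) by (simp add: field_simps)
  ultimately show "aff_at Y X g V d U c y"
    unfolding aff_at_def using W * VY
    by (intro exI[of _ "inverse a"] exI[of _ "- b / a"] conjI exI[of _ ?W]) auto
qed

lemma points_remove [simp]: "points (remove F X) = points X - F"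
  by (auto simp: remove_def)

lemma remove_remove: "remove D (remove F X) = remove (F \<union> D) X"
proof -
  have "points X \<inter> (points X - F) \<inter> (points X - F - D) = points X - (F \<union> D)" by blast
  moreover have "(points X - F) \<inter> (points X - F - D) = points X - (F \<union> D)" by blast
  moreover have "points X \<inter> (points X - F) = points X - F" by blast
  ultimately show ?thesis
  unfolding remove_def by (auto simp: subtopology_subtopology image_image case_prod_beta Diff_eq ac_simps)
qed

lemma wf_remove:
  assumes "wf_curve X" "finite F"
  shows "wf_curve (remove F X)"
  unfolding wf_curve_def
proof (intro conjI ballI)
  fix C assume "C \<in> atlas (remove F X)"
  then obtain U c where C: "C = (U - F, c)" "(U, c) \<in> atlas X"
    by (auto simp: remove_def)
  then have U: "openin (ctop X) U" "open (c ` U)"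
      "homeomorphic_map (subtopology (ctop X) U) (top_of_set (c ` U)) c"
    using assms by (auto simp: wf_curve_def is_chart_def)
  have tU: "U \<subseteq> points X" using openin_subset[OF U(1)] by auto
  then have tU': "topspace (subtopology (ctop X) U) = U" by auto
  have inj: "inj_on c U" using U(3) tU' by (metis homeomorphic_imp_injective_map)
  have "U - F = U \<inter> (points X - F)" using tU by blast
  then have 1: "openin (ctop (remove F X)) (U - F)"
    using U(1) by (auto simp: remove_def openin_subtopology)
  have cU: "c ` (U - F) = c ` U - c ` (F \<inter> U)"
    using inj by (auto simp: inj_on_def)
  then have 2: "open (c ` (U - F))"
    using U(2) assms(2) by (simp add: finite_imp_closed open_Diff)
  have "homeomorphic_map (subtopology (subtopology (ctop X) U) (U - F))
          (subtopology (top_of_set (c ` U)) (c ` (U - F))) c"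
    by (rule homeomorphic_map_subtopologies[OF U(3)]) (use tU cU inj in \<open>auto simp: inj_on_def\<close>)
  moreover have "subtopology (subtopology (ctop X) U) (U - F) = subtopology (ctop (remove F X)) (U - F)"
    using tU by (simp add: remove_def subtopology_subtopology) (rule arg_cong[where f="subtopology (ctop X)"], blast)
  moreover have "subtopology (top_of_set (c ` U)) (c ` (U - F)) = top_of_set (c ` (U - F))"
    by (simp add: subtopology_subtopology) (rule arg_cong[where f="subtopology euclidean"], blast)
  ultimately show "is_chart (ctop (remove F X)) C"
    using 1 2 C by (simp add: is_chart_def)
next
  show "(\<Union>(U, c)\<in>atlas (remove F X). U) = points (remove F X)"
  proof -
    have "(\<Union>(U, c)\<in>atlas (remove F X). U) = (\<Union>(U, c)\<in>atlas X. U) - F"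
      by (auto simp: remove_def)
    then show ?thesis using assms(1) by (simp add: wf_curve_def)
  qed
qed

lemma affine_iso_remove:
  assumes wf: "wf_curve X" and D: "finite D" "D \<subseteq> points X" and f: "affine_iso X Y f"
  shows "affine_iso (remove D X) (remove (f ` D) Y) f"
  unfolding affine_iso_iff[OF wf_remove[OF wf D(1)]]
proof (intro conjI allI impI ballI)
  note f' = f[unfolded affine_iso_iff[OF wf]]
  have inj: "inj_on f (points X)" and sur: "f ` points X = points Y"
    using f' by (meson homeomorphic_imp_injective_map homeomorphic_imp_surjective_map)+
  have im: "f ` (points X \<inter> (points X - D)) = points Y \<inter> (points Y - f ` D)"
  proof -
    have "f ` (points X - D) = f ` points X - f ` D"
      using inj D(2) by (simp add: inj_on_image_set_diff)
    moreover have "points X \<inter> (points X - D) = points X - D"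
      "points Y \<inter> (points Y - f ` D) = points Y - f ` D" by blast+
    ultimately show ?thesis using sur by simp
  qed
  show "homeomorphic_map (ctop (remove D X)) (ctop (remove (f ` D) Y)) f"
    unfolding remove_def curve.simps
    by (rule homeomorphic_map_subtopologies) (use conjunct1[OF f'] D inj im in auto)
  fix U c V d p
  assume *: "(U, c) \<in> atlas (remove D X)" "(V, d) \<in> atlas (remove (f ` D) Y)" "p \<in> U" "f p \<in> V"
  then obtain U' V' where U': "U = U' - D" "(U', c) \<in> atlas X" "V = V' - f ` D" "(V', d) \<in> atlas Y"
    by (auto simp: remove_def)
  then have "aff_at X Y f U' c V' d p" using f' * by auto
  then obtain a b W where W: "a \<noteq> 0" "openin (ctop X) W" "p \<in> W" "W \<subseteq> U'"
       "\<And>q. q \<in> W \<Longrightarrow> f q \<in> V' \<Longrightarrow> d (f q) = a * c q + b"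
    unfolding aff_at_def by metis
  have "W - D = W \<inter> (points X - D)" using openin_subset[OF W(2)] by blast
  then have "openin (ctop (remove D X)) (W - D)"
    using W(2) by (auto simp: remove_def openin_subtopology)
  then show "aff_at (remove D X) (remove (f ` D) Y) f U c V d p"
    unfolding aff_at_def using W * U'
    by (intro exI[of _ a] exI[of _ b] conjI exI[of _ "W - D"]) auto
qed

lemma affine_iso_cong:
  assumes wf: "wf_curve X" and f: "affine_iso X Y f" and eq: "\<And>x. x \<in> points X \<Longrightarrow> f x = g x"
  shows "affine_iso X Y g"
  unfolding affine_iso_iff[OF wf]
proof (intro conjI allI impI ballI)
  note f' = f[unfolded affine_iso_iff[OF wf]]
  show "homeomorphic_map (ctop X) (ctop Y) g" using homeomorphic_map_eq[OF conjunct1[OF f'] eq] .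
  fix U c V d p
  assume *: "(U, c) \<in> atlas X" "(V, d) \<in> atlas Y" "p \<in> U" "g p \<in> V"
  then have U: "U \<subseteq> points X" using chartD wf openin_subset by blast
  then have "aff_at X Y f U c V d p" using f' * eq by auto
  then show "aff_at X Y g U c V d p" unfolding aff_at_def using eq U by (metis subsetD)
qed

lemma affine_iso_id:
  assumes "affine_curve X" shows "affine_iso X X id"
proof -
  have "locally_affine_on (c ` {x \<in> U. id x \<in> V}) (d \<circ> id \<circ> inv_into U c)"
    if "(U, c) \<in> atlas X" "(V, d) \<in> atlas X" for U c V d
  proof -
    have "{x \<in> U. id x \<in> V} = U \<inter> V" by auto
    then show ?thesis using that assms unfolding affine_curve_def by fastforce
  qed
  then show ?thesis unfolding affine_iso_def by auto
qed

lemma wfI: "affine_curve X \<Longrightarrow> wf_curve X"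
  by (simp add: affine_curve_def wf_curve_def)

lemma pw_affine_grow:
  assumes wf: "wf_curve X" and F: "finite F" "finite D" "D \<subseteq> points X - F"
    and f: "affine_iso (remove F X) (remove F' Y) f"
  shows "affine_iso (remove (F \<union> D) X) (remove (F' \<union> f ` D) Y) f"
  using affine_iso_remove[OF wf_remove[OF wf F(1)] F(2) _ f] F(3) by (simp add: remove_remove)

lemma iso_bij: "affine_iso X Y f \<Longrightarrow> bij_betw f (points X) (points Y)"
  unfolding affine_iso_def bij_betw_def
  using homeomorphic_imp_injective_map homeomorphic_imp_surjective_map by blast

lemma pw_affine_eq:
  assumes wf: "wf_curve X" and f: "pw_affine X Y f" and eq: "pw_eq X f g"
  shows "pw_affine X Y g"
proof -
  obtain F F' where F: "finite F" "F \<subseteq> points X" "finite F'" "F' \<subseteq> points Y"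
      "affine_iso (remove F X) (remove F' Y) f"
    using f unfolding pw_affine_def by blast
  let ?D = "{x\<in>points X. f x \<noteq> g x} - F"
  have D: "finite ?D" using eq by (simp add: pw_eq_def)
  have i: "affine_iso (remove (F \<union> ?D) X) (remove (F' \<union> f ` ?D) Y) f"
    using pw_affine_grow[OF wf F(1) D _ F(5)] by blast
  have "finite (F \<union> ?D)" using F D by blast
  then have "affine_iso (remove (F \<union> ?D) X) (remove (F' \<union> f ` ?D) Y) g"
    by (rule affine_iso_cong[OF wf_remove[OF wf] i]) auto
  moreover have "f ` ?D \<subseteq> points Y" using iso_bij[OF F(5)] unfolding bij_betw_def by auto
  ultimately show ?thesis unfolding pw_affine_def using F D
    by (intro exI[of _ "F \<union> ?D"] exI[of _ "F' \<union> f ` ?D"]) auto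
qed

lemma pw_affine_comp:
  assumes wf: "wf_curve X" "wf_curve Y" and f: "pw_affine X Y f" and g: "pw_affine Y Z g"
  shows "pw_affine X Z (g \<circ> f)"
proof -
  obtain F F' where F: "finite F" "F \<subseteq> points X" "finite F'" "F' \<subseteq> points Y"
      "affine_iso (remove F X) (remove F' Y) f"
    using f unfolding pw_affine_def by blast
  obtain G G' where G: "finite G" "G \<subseteq> points Y" "finite G'" "G' \<subseteq> points Z"
      "affine_iso (remove G Y) (remove G' Z) g"
    using g unfolding pw_affine_def by blast
  have bf: "bij_betw f (points X - F) (points Y - F')" using iso_bij[OF F(5)] by simp
  have bg: "bij_betw g (points Y - G) (points Z - G')" using iso_bij[OF G(5)] by simp
  let ?D = "{x \<in> points X - F. f x \<in> G - F'}"
  have fD: "f ` ?D = G - F'" using bf G(2) unfolding bij_betw_def by auto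
  have D: "finite ?D"
  proof (rule finite_imageD)
    show "finite (f ` ?D)" using fD G by simp
    show "inj_on f ?D" using bf unfolding bij_betw_def by (auto simp: inj_on_def)
  qed
  have i: "affine_iso (remove (F \<union> ?D) X) (remove (F' \<union> G) Y) f"
    using pw_affine_grow[OF wf(1) F(1) D _ F(5)] fD by auto
  have "affine_iso (remove (G \<union> (F' - G)) Y) (remove (G' \<union> g ` (F' - G)) Z) g"
    by (rule pw_affine_grow[OF wf(2) G(1) _ _ G(5)]) (use F in auto)
  then have j: "affine_iso (remove (F' \<union> G) Y) (remove (G' \<union> g ` (F' - G)) Z) g"
    by (simp add: Un_commute)
  have "finite (F \<union> ?D)" "finite (F' \<union> G)" using F D G by auto
  then have "affine_iso (remove (F \<union> ?D) X) (remove (G' \<union> g ` (F' - G)) Z) (g \<circ> f)"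
    using affine_iso_comp[OF wf_remove[OF wf(1)] wf_remove[OF wf(2)] i j] by simp
  moreover have "g ` (F' - G) \<subseteq> points Z" using bg F unfolding bij_betw_def by auto
  ultimately show ?thesis unfolding pw_affine_def using F D G
    by (intro exI[of _ "F \<union> ?D"] exI[of _ "G' \<union> g ` (F' - G)"]) auto
qed

lemma pw_affine_inverse:
  assumes wf: "wf_curve X" "wf_curve Y" and f: "pw_affine X Y f"
  obtains g where "pw_affine Y X g" "pw_eq X (g \<circ> f) id" "pw_eq Y (f \<circ> g) id"
proof -
  obtain F F' where F: "finite F" "F \<subseteq> points X" "finite F'" "F' \<subseteq> points Y"
      "affine_iso (remove F X) (remove F' Y) f"
    using f unfolding pw_affine_def by blast
  obtain g where g: "homeomorphic_maps (ctop (remove F X)) (ctop (remove F' Y)) f g"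
    using F(5) unfolding affine_iso_def homeomorphic_map_maps by blast
  then have "affine_iso (remove F' Y) (remove F X) g"
    using affine_iso_inv[OF wf_remove[OF wf(1) F(1)] wf_remove[OF wf(2) F(3)] F(5)] by blast
  then have 1: "pw_affine Y X g" unfolding pw_affine_def using F by blast
  have "\<forall>x\<in>points X - F. g (f x) = x" "\<forall>x\<in>points Y - F'. f (g x) = x"
    using g unfolding homeomorphic_maps_def by auto
  then have "{x \<in> points X. g (f x) \<noteq> x} \<subseteq> F" "{x \<in> points Y. f (g x) \<noteq> x} \<subseteq> F'" by auto
  then have "pw_eq X (g \<circ> f) id" "pw_eq Y (f \<circ> g) id"
    using F finite_subset unfolding pw_eq_def by auto
  then show thesis using 1 that by blast
qed

lemma pw_eq_refl: "pw_eq X f f" by (simp add: pw_eq_def)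
lemma pw_eq_sym: "pw_eq X f g \<Longrightarrow> pw_eq X g f"
  by (simp add: pw_eq_def eq_commute)
lemma pw_eq_trans: "pw_eq X f g \<Longrightarrow> pw_eq X g h \<Longrightarrow> pw_eq X f h"
  unfolding pw_eq_def
  by (rule finite_subset[of _ "{x \<in> points X. f x \<noteq> g x} \<union> {x \<in> points X. g x \<noteq> h x}"]) auto

lemma pw_eq_comp:
  assumes f: "pw_affine X Y f" and "pw_eq X f f'" "pw_eq Y g g'"
  shows "pw_eq X (g \<circ> f) (g' \<circ> f')"
proof -
  obtain F F' where F: "finite F" "F \<subseteq> points X" "finite F'" "F' \<subseteq> points Y"
      "affine_iso (remove F X) (remove F' Y) f"
    using f unfolding pw_affine_def by blast
  have bf: "bij_betw f (points X - F) (points Y - F')" using iso_bij[OF F(5)] by simp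
  let ?E = "{y \<in> points Y. g y \<noteq> g' y}" and ?D = "{x \<in> points X. f x \<noteq> f' x}"
  let ?P = "{x \<in> points X - F. f x \<in> ?E}"
  have "finite ?P"
  proof (rule finite_imageD)
    have "f ` ?P \<subseteq> ?E" by auto
    then show "finite (f ` ?P)" using assms finite_subset unfolding pw_eq_def by blast
    show "inj_on f ?P" using bf unfolding bij_betw_def by (auto simp: inj_on_def)
  qed
  moreover have "{x \<in> points X. (g \<circ> f) x \<noteq> (g' \<circ> f') x} \<subseteq> F \<union> ?D \<union> ?P"
  proof
    fix x assume x: "x \<in> {x \<in> points X. (g \<circ> f) x \<noteq> (g' \<circ> f') x}"
    show "x \<in> F \<union> ?D \<union> ?P"
    proof (rule ccontr)
      assume n: "x \<notin> F \<union> ?D \<union> ?P"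
      then have "f x = f' x" "x \<in> points X - F" using x by auto
      moreover have "f x \<in> points Y" using bf \<open>x \<in> points X - F\<close> unfolding bij_betw_def by auto
      ultimately show False using x n by auto
    qed
  qed
  moreover have "finite (F \<union> ?D \<union> ?P)" using assms F \<open>finite ?P\<close> unfolding pw_eq_def by simp
  ultimately show ?thesis unfolding pw_eq_def by (meson finite_subset)
qed

lemma pw_class_eq: "pw_class X f = pw_class X g \<longleftrightarrow> pw_eq X f g"
  unfolding pw_class_def using pw_eq_refl pw_eq_sym pw_eq_trans by blast

lemma pw_comp_class:
  assumes f: "wf_curve X" "pw_affine X Y f"
  shows "pw_comp X (pw_class Y g) (pw_class X f) = pw_class X (g \<circ> f)"
proof -
  have "pw_class X (g' \<circ> f') = pw_class X (g \<circ> f)" if "f' \<in> pw_class X f" "g' \<in> pw_class Y g" for f' g'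
    using that pw_eq_comp[OF f(2), of f' g g'] unfolding pw_class_eq by (simp add: pw_class_def pw_eq_sym)
  moreover have "f \<in> pw_class X f" "g \<in> pw_class Y g" by (auto simp: pw_class_def pw_eq_refl)
  ultimately show ?thesis unfolding pw_comp_def by blast
qed

lemma group_PC_Aff:
  assumes "affine_curve X" shows "group (PC_Aff X)"
proof (rule groupI)
  have wf: "wf_curve X" using assms by (rule wfI)
  have id: "pw_affine X X id"
  proof -
    have "affine_iso (remove {} X) (remove ({} \<union> id ` {}) X) id"
      using affine_iso_remove[OF wf _ _ affine_iso_id[OF assms], of "{}"] by simp
    then show ?thesis unfolding pw_affine_def by (intro exI[of _ "{}"]) auto
  qed
  note simps = PC_Aff_def pw_iso_def
  show "\<one>\<^bsub>PC_Aff X\<^esub> \<in> carrier (PC_Aff X)" using id by (auto simp: simps)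
  fix x assume "x \<in> carrier (PC_Aff X)"
  then obtain f where f: "x = pw_class X f" "pw_affine X X f" by (auto simp: simps)
  show "\<one>\<^bsub>PC_Aff X\<^esub> \<otimes>\<^bsub>PC_Aff X\<^esub> x = x" using f pw_comp_class[OF wf f(2), of id] by (simp add: simps)
  obtain k where k: "pw_affine X X k" "pw_eq X (k \<circ> f) id" using pw_affine_inverse[OF wf wf f(2)] by blast
  have "pw_comp X (pw_class X k) x = pw_class X id"
    using f k pw_comp_class[OF wf f(2), of k] by (simp add: pw_class_eq)
  then show "\<exists>y\<in>carrier (PC_Aff X). y \<otimes>\<^bsub>PC_Aff X\<^esub> x = \<one>\<^bsub>PC_Aff X\<^esub>"
    using k by (auto simp: simps)
  fix y assume "y \<in> carrier (PC_Aff X)"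
  then obtain g where g: "y = pw_class X g" "pw_affine X X g" by (auto simp: simps)
  show "x \<otimes>\<^bsub>PC_Aff X\<^esub> y \<in> carrier (PC_Aff X)"
    using f g pw_comp_class[OF wf g(2), of f] pw_affine_comp[OF wf wf g(2) f(2)] by (auto simp: simps)
  fix z assume "z \<in> carrier (PC_Aff X)"
  then obtain h where h: "z = pw_class X h" "pw_affine X X h" by (auto simp: simps)
  show "x \<otimes>\<^bsub>PC_Aff X\<^esub> y \<otimes>\<^bsub>PC_Aff X\<^esub> z = x \<otimes>\<^bsub>PC_Aff X\<^esub> (y \<otimes>\<^bsub>PC_Aff X\<^esub> z)"
    using f g h pw_comp_class[OF wf g(2), of f] pw_comp_class[OF wf h(2), of g]
      pw_comp_class[OF wf h(2), of "f \<circ> g"]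
      pw_comp_class[OF wf pw_affine_comp[OF wf wf h(2) g(2)], of f]
    by (simp add: simps comp_assoc)
qed

lemma pw_inv_class:
  assumes wf: "wf_curve X" "wf_curve Y" and f: "pw_affine X Y f"
    and g: "pw_affine Y X g" "pw_eq X (g \<circ> f) id" "pw_eq Y (f \<circ> g) id"
  shows "pw_inv X Y (pw_class X f) = pw_class Y g"
proof (intro equalityI subsetI)
  fix k assume "k \<in> pw_inv X Y (pw_class X f)"
  then obtain f' where f': "pw_eq X f f'" "pw_eq X (k \<circ> f') id"
    by (auto simp: pw_inv_def pw_class_def)
  have "pw_eq X (k \<circ> f) id" using pw_eq_comp[OF f f'(1) pw_eq_refl] f'(2) pw_eq_trans by blast
  then have "pw_eq Y (k \<circ> f \<circ> g) (id \<circ> g)" by (rule pw_eq_comp[OF g(1) pw_eq_refl])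
  moreover have "pw_eq Y (k \<circ> (f \<circ> g)) (k \<circ> id)"
  proof -
    have "{x \<in> points Y. (k \<circ> (f \<circ> g)) x \<noteq> (k \<circ> id) x} \<subseteq> {x \<in> points Y. (f \<circ> g) x \<noteq> id x}" by auto
    then show ?thesis using g(3) finite_subset unfolding pw_eq_def by blast
  qed
  ultimately have "pw_eq Y k g" using pw_eq_sym pw_eq_trans by (metis comp_assoc comp_id id_comp)
  then show "k \<in> pw_class Y g" by (simp add: pw_class_def pw_eq_sym)
next
  fix k assume "k \<in> pw_class Y g"
  then have k: "pw_eq Y g k" by (simp add: pw_class_def)
  have "pw_eq X (k \<circ> f) id" using pw_eq_comp[OF f pw_eq_refl k] g pw_eq_sym pw_eq_trans by blast
  moreover have "pw_eq Y (f \<circ> k) id"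
    using pw_eq_comp[OF g(1) k pw_eq_refl, of f] g(3) pw_eq_sym pw_eq_trans by blast
  ultimately show "k \<in> pw_inv X Y (pw_class X f)"
    using pw_eq_refl unfolding pw_inv_def pw_class_def by blast
qed

end

theory Submission
  imports Defs
begin

text \<open>
  The group of piecewise affine isomorphisms of the circle permutes its half-points and therefore
  acts on the set of all ways to glue two half-points affinely, that is on triples \<open>(u, v, l)\<close> with a
  scale \<open>l > 0\<close>. The gluings \<open>(x\<^sup>-, x\<^sup>+, 1)\<close> that make up the standard circle form a commensurated
  subset, so relative Property FW yields an \<open>H\<close>-invariant set of gluings at finite distance from it.
  After discarding the finitely many gluings that share a half-point with another one, the remaining
  ones are the points of a curve on which \<open>H\<close> acts by affine automorphisms.

  If \<open>H\<close> acts by homeomorphisms, only gluings of the two sides of a point are kept; this leaves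
  finitely many points missing. Parametrise each arc between consecutive missing points affinely by
  \<open>[0, 1]\<close>. Elements of \<open>H\<close> map arcs to arcs and hence preserve these parameters up to direction, so
  the ratio of the two speeds at a missing point is an \<open>H\<close>-invariant scale with which to glue it back.
\<close>

section \<open>Affine parametrisations\<close>

text \<open>A class in \<open>PC_Aff\<close> has no value at an individual point, but its one-sided
  germs exist at every half-point and depend only on the class. Half-points therefore carry a
  genuine action of the whole group, and slopes multiply along it. Transporting a scale by the
  quotient of the two slopes turns the standard gluing at x into another standard gluing whenever
  the map is affine across x, that is for all but finitely many x; this is where commensuration
  comes from. The invariant set of gluings need not be the graph of an involution, but the rule for
  discarding gluings is equivariant and costs only finitely many half-points.

  The resulting curve may join sides of different points and so need not be a circle. The parameter
  of an arc is preserved because the image of one unit parametrisation and a rescaling of the other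
  agree near the start, hence until one of them reaches a missing point, and missing points go to
  missing points.\<close>

definition aparam :: "'a curve \<Rightarrow> (real \<Rightarrow> 'a) \<Rightarrow> bool" where
  "aparam X g \<longleftrightarrow> (\<exists>U c a \<delta>. (U, c) \<in> atlas X \<and> a \<noteq> 0 \<and> \<delta> > 0 \<and>
     (\<forall>t. \<bar>t\<bar> < \<delta> \<longrightarrow> g t \<in> U \<and> c (g t) = c (g 0) + a * t))"

lemma is_chart_preimage:
  assumes C: "is_chart T (U, c)" and V: "open V"
  shows "openin T {q\<in>U. c q \<in> V}"
proof -
  have U: "openin T U" and h: "homeomorphic_map (subtopology T U) (top_of_set (c ` U)) c"
    using C by (auto simp: is_chart_def)
  have tU: "topspace (subtopology T U) = U" using openin_subset[OF U] by auto
  have "openin (top_of_set (c ` U)) (c ` U \<inter> V)"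
    using V by (simp add: openin_open_Int)
  then have "openin (subtopology T U) {q \<in> topspace (subtopology T U). c q \<in> c ` U \<inter> V}"
    using h homeomorphic_imp_continuous_map openin_continuous_map_preimage by blast
  moreover have "{q \<in> topspace (subtopology T U). c q \<in> c ` U \<inter> V} = {q\<in>U. c q \<in> V}"
    using tU by auto
  ultimately show ?thesis using U by (simp add: openin_open_subtopology)
qed

lemma is_chart_image:
  assumes C: "is_chart T (U, c)" and W: "openin T W" "W \<subseteq> U"
  shows "open (c ` W)"
proof -
  have U: "openin T U" "open (c ` U)" and h: "homeomorphic_map (subtopology T U) (top_of_set (c ` U)) c"
    using C by (auto simp: is_chart_def)
  have "openin (subtopology T U) W" using W U by (simp add: openin_open_subtopology)
  then have "openin (top_of_set (c ` U)) (c ` W)"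
    using h homeomorphic_imp_open_map unfolding open_map_def by blast
  then show ?thesis using U(2) openin_open_trans by blast
qed

lemma is_chart_inj:
  assumes C: "is_chart T (U, c)" shows "inj_on c U"
proof -
  have U: "openin T U" and h: "homeomorphic_map (subtopology T U) (top_of_set (c ` U)) c"
    using C by (auto simp: is_chart_def)
  have "topspace (subtopology T U) = U" using openin_subset[OF U] by auto
  then show ?thesis using h by (metis homeomorphic_imp_injective_map)
qed

lemma atlas_chart: "wf_curve X \<Longrightarrow> (U, c) \<in> atlas X \<Longrightarrow> is_chart (ctop X) (U, c)"
  by (auto simp: wf_curve_def)

text \<open>The image of \<open>W\<close> in the chart is open, so it contains all values close to
  \<open>c (g 0)\<close>; injectivity of the chart brings them back into \<open>W\<close>. This
  takes the place of continuity of \<open>g\<close>, which is constrained only near 0.\<close>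

lemma aparam_eventually_in:
  assumes wf: "wf_curve X" and g: "aparam X g" and W: "openin (ctop X) W" "g 0 \<in> W"
  obtains \<delta> where "\<delta> > 0" "\<And>t. \<bar>t\<bar> < \<delta> \<Longrightarrow> g t \<in> W"
proof -
  obtain U c a \<delta> where c: "(U, c) \<in> atlas X" "a \<noteq> 0" "\<delta> > 0"
    and ct: "\<And>t. \<bar>t\<bar> < \<delta> \<Longrightarrow> g t \<in> U \<and> c (g t) = c (g 0) + a * t"
    using g unfolding aparam_def by metis
  note C = atlas_chart[OF wf c(1)]
  have "openin (ctop X) (W \<inter> U)" using W chartD[OF wf c(1)] by blast
  then have "open (c ` (W \<inter> U))" by (rule is_chart_image[OF C]) blast
  moreover have "c (g 0) \<in> c ` (W \<inter> U)" using W ct[of 0] c by auto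
  ultimately obtain r where r: "r > 0" "\<And>y. dist y (c (g 0)) < r \<Longrightarrow> y \<in> c ` (W \<inter> U)"
    unfolding open_dist by metis
  have "g t \<in> W" if "\<bar>t\<bar> < min \<delta> (r / \<bar>a\<bar>)" for t
  proof -
    have t: "\<bar>t\<bar> < \<delta>" "\<bar>a * t\<bar> < r" using that c(2) by (auto simp: abs_mult field_simps)
    then have "dist (c (g t)) (c (g 0)) < r" using ct[of t] by (simp add: dist_real_def)
    then obtain q where "q \<in> W \<inter> U" "c q = c (g t)" using r(2) by (metis imageE)
    then show ?thesis using is_chart_inj[OF C] ct t(1) by (metis IntE inj_onD)
  qed
  then show thesis using that[of "min \<delta> (r / \<bar>a\<bar>)"] c r by simp
qed

text \<open>Near 0 the path inverts an affine function of the chart, so small intervals go to chart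
  preimages of intervals.\<close>

lemma aparam_image_open:
  assumes wf: "wf_curve X" and g: "aparam X g"
  obtains \<delta> where "\<delta> > 0" "\<And>e. e \<le> \<delta> \<Longrightarrow> openin (ctop X) (g ` {-e<..<e})"
proof -
  obtain U c a \<delta> where c: "(U, c) \<in> atlas X" "a \<noteq> 0" "\<delta> > 0"
    and ct: "\<And>t. \<bar>t\<bar> < \<delta> \<Longrightarrow> g t \<in> U \<and> c (g t) = c (g 0) + a * t"
    using g unfolding aparam_def by metis
  note C = atlas_chart[OF wf c(1)]
  have "openin (ctop X) (g ` {-e<..<e})" if e: "e \<le> \<delta>" for e
  proof -
    let ?V = "{y. \<bar>(y - c (g 0)) / a\<bar> < e}"
    have "open ?V" using c(2) by (intro open_Collect_less continuous_intros) auto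
    then have "openin (ctop X) {q\<in>U. c q \<in> ?V}" by (rule is_chart_preimage[OF C])
    moreover have "{q\<in>U. c q \<in> ?V} = g ` {-e<..<e}"
    proof (intro equalityI subsetI)
      fix q assume q: "q \<in> {q\<in>U. c q \<in> ?V}"
      define t where "t = (c q - c (g 0)) / a"
      have t: "\<bar>t\<bar> < e" "\<bar>t\<bar> < \<delta>" using q e by (auto simp: t_def)
      have "c (g t) = c q" using ct[OF t(2)] c(2) by (simp add: t_def)
      then have "q = g t" using q ct[OF t(2)] is_chart_inj[OF C] by (auto dest: inj_onD)
      then show "q \<in> g ` {-e<..<e}" using t by (intro image_eqI[of _ _ t]) auto
    next
      fix q assume "q \<in> g ` {-e<..<e}"
      then obtain t where "q = g t" "t \<in> {-e<..<e}" by blast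
      then have t: "q = g t" "\<bar>t\<bar> < e" by auto
      then show "q \<in> {q\<in>U. c q \<in> ?V}" using ct[of t] e c(2) by (auto simp: abs_mult)
    qed
    ultimately show ?thesis by simp
  qed
  then show thesis using that c(3) by blast
qed

text \<open>The definition of \<open>aparam\<close> names one chart only; compatibility of the
  charts, in the form that \<open>id\<close> is an affine isomorphism, transfers affinity to every
  chart around \<open>g 0\<close>.\<close>

lemma aparam_in_chart:
  assumes X: "affine_curve X" and g: "aparam X g" and V: "(V, d) \<in> atlas X" "g 0 \<in> V"
  obtains a \<delta> where "a \<noteq> 0" "\<delta> > 0" "\<And>t. \<bar>t\<bar> < \<delta> \<Longrightarrow> g t \<in> V \<and> d (g t) = d (g 0) + a * t"
proof -
  note wf = wfI[OF X]
  obtain U c a \<delta> where c: "(U, c) \<in> atlas X" "a \<noteq> 0" "\<delta> > 0"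
    and ct: "\<And>t. \<bar>t\<bar> < \<delta> \<Longrightarrow> g t \<in> U \<and> c (g t) = c (g 0) + a * t"
    using g unfolding aparam_def by metis
  have "aff_at X X id U c V d (g 0)"
    using affine_iso_id[OF X] V c ct[of 0] unfolding affine_iso_iff[OF wf] by auto
  then obtain a' b W where W: "a' \<noteq> 0" "openin (ctop X) W" "g 0 \<in> W" "W \<subseteq> U"
      "\<And>q. q \<in> W \<Longrightarrow> q \<in> V \<Longrightarrow> d q = a' * c q + b"
    unfolding aff_at_def by auto
  have "openin (ctop X) (W \<inter> V)" using W chartD[OF wf V(1)] by blast
  then obtain e where e: "e > 0" "\<And>t. \<bar>t\<bar> < e \<Longrightarrow> g t \<in> W \<inter> V"
    using aparam_eventually_in[OF wf g] W V by blast
  have "g t \<in> V \<and> d (g t) = d (g 0) + (a' * a) * t" if "\<bar>t\<bar> < min \<delta> e" for t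
    using that e(2)[of t] e(2)[of 0] W(5)[of "g t"] W(5)[of "g 0"] e(1) ct[of t] by (auto simp: algebra_simps)
  then show thesis using that[of "a' * a" "min \<delta> e"] W c e by auto
qed

lemma openin_remove:
  assumes X: "affine_curve X" and F: "finite F"
  shows "openin (ctop (remove F X)) W \<longleftrightarrow> openin (ctop X) W \<and> W \<subseteq> points X - F"
    and "openin (ctop X) (points X - F)"
proof -
  have "closedin (ctop X) (points X \<inter> F)"
    using X F by (auto simp: affine_curve_def intro: closedin_Hausdorff_finite)
  then have "openin (ctop X) (points X - points X \<inter> F)" by blast
  then show *: "openin (ctop X) (points X - F)" by (simp add: Diff_Int_distrib Diff_Int)
  then show "openin (ctop (remove F X)) W \<longleftrightarrow> openin (ctop X) W \<and> W \<subseteq> points X - F"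
    by (simp add: remove_def openin_open_subtopology)
qed

text \<open>One path through each point suffices: it sweeps out neighbourhoods in source and target,
  which gives continuity and openness, and if it has speeds \<open>a\<close> and \<open>b\<close> in
  the two charts, then \<open>f\<close> reads there as an affine map of slope
  \<open>b / a\<close>.\<close>

lemma affine_iso_aparamI:
  assumes X: "affine_curve X" and Y: "affine_curve Y" and F: "finite F" "finite F'"
    and bij: "bij_betw f (points X - F) (points Y - F')"
    and ap: "\<And>p. p \<in> points X - F \<Longrightarrow> \<exists>g. aparam X g \<and> g 0 = p \<and> aparam Y (f \<circ> g)"
  shows "affine_iso (remove F X) (remove F' Y) f"
  unfolding affine_iso_iff[OF wf_remove[OF wfI[OF X] F(1)]]
proof (intro conjI allI impI ballI)
  note wX = wfI[OF X] and wY = wfI[OF Y]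
  note oX = openin_remove[OF X F(1)] and oY = openin_remove[OF Y F(2)]
  show "homeomorphic_map (ctop (remove F X)) (ctop (remove F' Y)) f"
  proof (rule bijective_open_imp_homeomorphic_map)
    show "f ` points (remove F X) = points (remove F' Y)" "inj_on f (points (remove F X))"
      using bij by (auto simp: bij_betw_def)
    show "continuous_map (ctop (remove F X)) (ctop (remove F' Y)) f"
      unfolding continuous_map
    proof (intro conjI allI impI)
      show "f ` points (remove F X) \<subseteq> points (remove F' Y)" using bij by (auto simp: bij_betw_def)
      fix W assume "openin (ctop (remove F' Y)) W"
      then have W: "openin (ctop Y) W" "W \<subseteq> points Y - F'" using oY by auto
      have "\<exists>T. openin (ctop X) T \<and> p \<in> T \<and> T \<subseteq> {x \<in> points X - F. f x \<in> W}"
        if p: "p \<in> points X - F" "f p \<in> W" for p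
      proof -
        obtain g where g: "aparam X g" "g 0 = p" "aparam Y (f \<circ> g)" using ap p by blast
        obtain e1 where e1: "e1 > 0" "\<And>t. \<bar>t\<bar> < e1 \<Longrightarrow> g t \<in> points X - F"
          using aparam_eventually_in[OF wX g(1) oX(2)] g p by blast
        obtain e2 where e2: "e2 > 0" "\<And>t. \<bar>t\<bar> < e2 \<Longrightarrow> (f \<circ> g) t \<in> W"
          using aparam_eventually_in[OF wY g(3) W(1)] g p by auto
        obtain e3 where e3: "e3 > 0" "\<And>e. e \<le> e3 \<Longrightarrow> openin (ctop X) (g ` {-e<..<e})"
          using aparam_image_open[OF wX g(1)] by blast
        define e where "e = min e1 (min e2 e3)"
        have e: "e > 0" using e1 e2 e3 by (simp add: e_def)
        show ?thesis
          using e e1(2) e2(2) e3(2)[of e] g(2)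
          by (intro exI[of _ "g ` {-e<..<e}"]) (auto simp: e_def intro: image_eqI[of _ _ 0])
      qed
      then have "openin (ctop X) {x \<in> points X - F. f x \<in> W}"
        by (subst openin_subopen) blast
      then show "openin (ctop (remove F X)) {x \<in> points (remove F X). f x \<in> W}"
        by (subst oX(1)) auto
    qed
    show "open_map (ctop (remove F X)) (ctop (remove F' Y)) f"
      unfolding open_map_def
    proof (intro allI impI)
      fix W assume "openin (ctop (remove F X)) W"
      then have W: "openin (ctop X) W" "W \<subseteq> points X - F" using oX by auto
      have "\<exists>T. openin (ctop Y) T \<and> f p \<in> T \<and> T \<subseteq> f ` W" if p: "p \<in> W" for p
      proof -
        obtain g where g: "aparam X g" "g 0 = p" "aparam Y (f \<circ> g)" using ap p W by blast
        obtain e1 where e1: "e1 > 0" "\<And>t. \<bar>t\<bar> < e1 \<Longrightarrow> g t \<in> W"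
          using aparam_eventually_in[OF wX g(1) W(1)] g p by blast
        obtain e3 where e3: "e3 > 0" "\<And>e. e \<le> e3 \<Longrightarrow> openin (ctop Y) ((f \<circ> g) ` {-e<..<e})"
          using aparam_image_open[OF wY g(3)] by blast
        define e where "e = min e1 e3"
        have e: "e > 0" using e1 e3 by (simp add: e_def)
        show ?thesis
          using e e1(2) e3(2)[of e] g(2)
          by (intro exI[of _ "(f \<circ> g) ` {-e<..<e}"]) (auto simp: e_def intro: image_eqI[of _ _ 0])
      qed
      then have "openin (ctop Y) (f ` W)"
        by (subst openin_subopen) blast
      moreover have "f ` W \<subseteq> points Y - F'" using bij W(2) by (auto simp: bij_betw_def)
      ultimately show "openin (ctop (remove F' Y)) (f ` W)" by (simp add: oY)
    qed
  qed
  fix U c V d p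
  assume *: "(U, c) \<in> atlas (remove F X)" "(V, d) \<in> atlas (remove F' Y)" "p \<in> U" "f p \<in> V"
  then obtain U' V' where U': "U = U' - F" "(U', c) \<in> atlas X" "V = V' - F'" "(V', d) \<in> atlas Y"
    by (auto simp: remove_def)
  have UX: "U' \<subseteq> points X" using chartD[OF wX U'(2)] openin_subset by blast
  then obtain g where g: "aparam X g" "g 0 = p" "aparam Y (f \<circ> g)" using ap[of p] * U' by blast
  obtain a e1 where a: "a \<noteq> 0" "e1 > 0" "\<And>t. \<bar>t\<bar> < e1 \<Longrightarrow> g t \<in> U' \<and> c (g t) = c (g 0) + a * t"
    using aparam_in_chart[OF X g(1) U'(2)] * U' g by blast
  obtain b e2 where b: "b \<noteq> 0" "e2 > 0"
      "\<And>t. \<bar>t\<bar> < e2 \<Longrightarrow> (f \<circ> g) t \<in> V' \<and> d ((f \<circ> g) t) = d ((f \<circ> g) 0) + b * t"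
    using aparam_in_chart[OF Y g(3) U'(4)] * U' g by auto
  obtain e3 where e3: "e3 > 0" "\<And>e. e \<le> e3 \<Longrightarrow> openin (ctop X) (g ` {-e<..<e})"
    using aparam_image_open[OF wX g(1)] by blast
  obtain e4 where e4: "e4 > 0" "\<And>t. \<bar>t\<bar> < e4 \<Longrightarrow> g t \<in> points X - F"
    using aparam_eventually_in[OF wX g(1) oX(2)] g * U' UX by blast
  define e where "e = min (min e1 e4) (min e2 e3)"
  have e: "e > 0" "e \<le> e1" "e \<le> e2" "e \<le> e3" "e \<le> e4" using a b e3 e4 by (auto simp: e_def)
  let ?W = "g ` {-e<..<e}"
  have "openin (ctop (remove F X)) ?W" using e e3(2) e4(2) by (auto simp: oX)
  moreover have "p \<in> ?W" using g(2) e by (intro image_eqI[of _ _ 0]) auto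
  moreover have "?W \<subseteq> U"
  proof
    fix q assume "q \<in> ?W"
    then obtain t where t: "q = g t" "t \<in> {-e<..<e}" by blast
    then have "\<bar>t\<bar> < e1" "\<bar>t\<bar> < e4" using e by auto
    then show "q \<in> U" using t U' a(3)[of t] e4(2)[of t] e by auto
  qed
  moreover have "d (f q) = b / a * c q + (d (f p) - b / a * c p)" if q: "q \<in> ?W" for q
  proof -
    obtain t where "q = g t" "t \<in> {-e<..<e}" using q by blast
    then have t: "q = g t" "\<bar>t\<bar> < e" by auto
    then have "d (f q) = d (f p) + b * t" "c q = c p + a * t"
      using a(3)[of t] b(3)[of t] e g(2) by auto
    then show ?thesis using a(1) by (simp add: field_simps)
  qed
  moreover have "b / a \<noteq> 0" using a b by simp
  ultimately show "aff_at (remove F X) (remove F' Y) f U c V d p"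
    unfolding aff_at_def by blast
qed

lemma affine_iso_aparamD:
  assumes X: "affine_curve X" and Y: "affine_curve Y" and F: "finite F" "finite F'"
    and f: "affine_iso (remove F X) (remove F' Y) f"
    and g: "aparam X g" "g 0 \<in> points X - F"
  shows "aparam Y (f \<circ> g)"
proof -
  note wX = wfI[OF X] and wY = wfI[OF Y]
  note oX = openin_remove[OF X F(1)] and oY = openin_remove[OF Y F(2)]
  note f' = f[unfolded affine_iso_iff[OF wf_remove[OF wX F(1)]]]
  obtain U c a \<delta> where c: "(U, c) \<in> atlas X" "a \<noteq> 0" "\<delta> > 0"
    and ct: "\<And>t. \<bar>t\<bar> < \<delta> \<Longrightarrow> g t \<in> U \<and> c (g t) = c (g 0) + a * t"
    using g(1) unfolding aparam_def by metis
  have fp: "f (g 0) \<in> points Y - F'" using iso_bij[OF f] g(2) by (auto simp: bij_betw_def)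
  then obtain V d where V: "(V, d) \<in> atlas Y" "f (g 0) \<in> V" using chart_ex[OF wY] by blast
  have "(U - F, c) \<in> atlas (remove F X)" "(V - F', d) \<in> atlas (remove F' Y)"
    using c V by (auto simp: remove_def)
  then have "aff_at (remove F X) (remove F' Y) f (U - F) c (V - F') d (g 0)"
    using conjunct2[OF f', rule_format, of "U - F" c "V - F'" d "g 0"] ct[of 0] c g fp V by simp
  then obtain a' b W where W: "a' \<noteq> 0" "openin (ctop (remove F X)) W" "g 0 \<in> W" "W \<subseteq> U - F"
      "\<And>q. q \<in> W \<Longrightarrow> f q \<in> V - F' \<Longrightarrow> d (f q) = a' * c q + b"
    unfolding aff_at_def by metis
  have "openin (ctop (remove F' Y)) (V - F')"
    unfolding oY
  proof
    have "V - F' = V \<inter> (points Y - F')" using chartD[OF wY V(1)] openin_subset by blast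
    then show "openin (ctop Y) (V - F')" using chartD[OF wY V(1)] oY(2) by auto
    show "V - F' \<subseteq> points Y - F'" using chartD[OF wY V(1)] openin_subset by blast
  qed
  then have "openin (ctop (remove F X)) {x \<in> points (remove F X). f x \<in> V - F'}"
    by (rule openin_continuous_map_preimage[OF homeomorphic_imp_continuous_map[OF conjunct1[OF f']]])
  then have "openin (ctop X) (W \<inter> {x \<in> points (remove F X). f x \<in> V - F'})"
    using W(2) unfolding oX by blast
  moreover have "g 0 \<in> W \<inter> {x \<in> points (remove F X). f x \<in> V - F'}" using g W V fp by auto
  ultimately obtain e where e: "e > 0"
      "\<And>t. \<bar>t\<bar> < e \<Longrightarrow> g t \<in> W \<inter> {x \<in> points (remove F X). f x \<in> V - F'}"
    using aparam_eventually_in[OF wX g(1)] by blast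
  have "(f \<circ> g) t \<in> V \<and> d ((f \<circ> g) t) = d ((f \<circ> g) 0) + a' * a * t" if "\<bar>t\<bar> < min e \<delta>" for t
    using that e(2)[of t] e(2)[of 0] e(1) W(5)[of "g t"] W(5)[of "g 0"] ct[of t] by (auto simp: algebra_simps)
  moreover have "a' * a \<noteq> 0" "min e \<delta> > 0" using c W e by auto
  ultimately show ?thesis
    unfolding aparam_def using V(1) by blast
qed

lemma remove_empty: "remove {} X = X"
proof -
  have "(\<lambda>(U, c). (U - {}, c)) ` atlas X = atlas X" by force
  then show ?thesis by (simp add: remove_def)
qed

section \<open>Curves given by parametrisations\<close>

text \<open>Each \<open>g i\<close> is the inverse of a future chart centred at
  \<open>g i 0\<close>. \<open>cover\<close> makes every point that occurs a centre, so two charts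
  can be compared through a third path centred at the common point, to which \<open>shift\<close>
  applies; \<open>sep\<close> provides the Hausdorff property.\<close>

locale param_curve =
  fixes I :: "'i set" and g :: "'i \<Rightarrow> real \<Rightarrow> 'a" and eps :: "'i \<Rightarrow> real"
  assumes eps_pos: "i \<in> I \<Longrightarrow> eps i > 0"
    and inj: "i \<in> I \<Longrightarrow> inj_on (g i) {-eps i<..<eps i}"
    and cover: "i \<in> I \<Longrightarrow> \<bar>s\<bar> < eps i \<Longrightarrow> \<exists>j\<in>I. g j 0 = g i s"
    and shift: "i \<in> I \<Longrightarrow> j \<in> I \<Longrightarrow> \<bar>s\<bar> < eps i \<Longrightarrow> g j 0 = g i s \<Longrightarrow>
      \<exists>a \<delta>. a \<noteq> 0 \<and> \<delta> > 0 \<and> (\<forall>t. \<bar>t\<bar> < \<delta> \<longrightarrow> g j t = g i (s + a * t))"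
    and sep: "i \<in> I \<Longrightarrow> j \<in> I \<Longrightarrow> g i 0 \<noteq> g j 0 \<Longrightarrow>
      \<exists>\<delta>>0. \<forall>s t. \<bar>s\<bar> < \<delta> \<longrightarrow> \<bar>t\<bar> < \<delta> \<longrightarrow> g i s \<noteq> g j t"
begin

definition "P = (\<lambda>i. g i 0) ` I"

text \<open>The topology is read off along the paths alone, so that the points may be mere
  labels.\<close>

definition "is_open U \<longleftrightarrow> U \<subseteq> P \<and>
  (\<forall>i\<in>I. g i 0 \<in> U \<longrightarrow> (\<exists>\<delta>>0. \<forall>t. \<bar>t\<bar> < \<delta> \<longrightarrow> g i t \<in> U))"

definition "J i = {-eps i<..<eps i}"

definition "X = \<lparr>ctop = topology is_open, atlas = (\<lambda>i. (g i ` J i, inv_into (J i) (g i))) ` I\<rparr>"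

lemma J_iff: "s \<in> J i \<longleftrightarrow> \<bar>s\<bar> < eps i"
  by (auto simp: J_def)

lemma open_J: "open (J i)"
  by (simp add: J_def)

lemma inj_J: "i \<in> I \<Longrightarrow> inj_on (g i) (J i)"
  using inj by (simp add: J_def)

lemma openin_X: "openin (ctop X) U \<longleftrightarrow> is_open U"
proof -
  have "istopology is_open"
    unfolding istopology_def
  proof (intro conjI allI impI)
    fix S T assume "is_open S" "is_open T"
    then have S: "S \<subseteq> P" "\<And>i. i \<in> I \<Longrightarrow> g i 0 \<in> S \<Longrightarrow> \<exists>\<delta>>0. \<forall>t. \<bar>t\<bar> < \<delta> \<longrightarrow> g i t \<in> S"
      and T: "\<And>i. i \<in> I \<Longrightarrow> g i 0 \<in> T \<Longrightarrow> \<exists>\<delta>>0. \<forall>t. \<bar>t\<bar> < \<delta> \<longrightarrow> g i t \<in> T"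
      by (auto simp: is_open_def)
    have "\<exists>\<delta>>0. \<forall>t. \<bar>t\<bar> < \<delta> \<longrightarrow> g i t \<in> S \<inter> T" if i: "i \<in> I" "g i 0 \<in> S \<inter> T" for i
    proof -
      obtain d e where "d > 0" "\<forall>t. \<bar>t\<bar> < d \<longrightarrow> g i t \<in> S" "e > 0" "\<forall>t. \<bar>t\<bar> < e \<longrightarrow> g i t \<in> T"
        using S(2)[of i] T[of i] i by blast
      then show ?thesis by (intro exI[of _ "min d e"]) auto
    qed
    then show "is_open (S \<inter> T)" using S(1) by (auto simp: is_open_def)
  next
    fix K assume K: "\<forall>S\<in>K. is_open S"
    have "\<exists>\<delta>>0. \<forall>t. \<bar>t\<bar> < \<delta> \<longrightarrow> g i t \<in> \<Union>K" if i: "i \<in> I" "g i 0 \<in> \<Union>K" for i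
    proof -
      obtain S where "S \<in> K" "g i 0 \<in> S" using i by blast
      then show ?thesis using K i(1) unfolding is_open_def by (meson UnionI)
    qed
    then show "is_open (\<Union>K)" using K unfolding is_open_def by blast
  qed
  then show ?thesis by (simp add: X_def topology_inverse')
qed

lemma is_open_image:
  assumes i: "i \<in> I" and S: "open S" "S \<subseteq> J i"
  shows "is_open (g i ` S)"
  unfolding is_open_def
proof (intro conjI ballI impI)
  show "g i ` S \<subseteq> P"
  proof
    fix x assume "x \<in> g i ` S"
    then obtain s where "s \<in> S" "x = g i s" by blast
    then obtain j where "j \<in> I" "g j 0 = x" using cover[OF i, of s] S(2) J_iff by blast
    then show "x \<in> P" by (auto simp: P_def)
  qed
  fix j assume j: "j \<in> I" "g j 0 \<in> g i ` S"
  then obtain s where s: "s \<in> S" "g j 0 = g i s" by blast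
  then obtain a d where a: "a \<noteq> 0" "d > 0" "\<And>t. \<bar>t\<bar> < d \<Longrightarrow> g j t = g i (s + a * t)"
    using shift[OF i j(1)] S(2) J_iff by (metis subsetD)
  obtain r where r: "r > 0" "\<And>y. dist y s < r \<Longrightarrow> y \<in> S"
    using S(1) s(1) unfolding open_dist by metis
  have "g j t \<in> g i ` S" if t: "\<bar>t\<bar> < min d (r / \<bar>a\<bar>)" for t
  proof -
    have "\<bar>a * t\<bar> < r" using t a(1) by (simp add: abs_mult field_simps)
    then have "s + a * t \<in> S" by (intro r(2)) (simp add: dist_real_def)
    then show ?thesis using a(3)[of t] t by auto
  qed
  then show "\<exists>\<delta>>0. \<forall>t. \<bar>t\<bar> < \<delta> \<longrightarrow> g j t \<in> g i ` S"
    using a r by (intro exI[of _ "min d (r / \<bar>a\<bar>)"]) auto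
qed

lemma zero_J: "i \<in> I \<Longrightarrow> 0 \<in> J i"
  using eps_pos by (simp add: J_iff)

lemma points_X: "points X = P"
proof -
  have "is_open P"
    unfolding is_open_def
  proof (intro conjI ballI impI)
    fix i assume i: "i \<in> I"
    have "g i t \<in> P" if "\<bar>t\<bar> < eps i" for t
      using is_open_image[OF i open_J subset_refl] that J_iff unfolding is_open_def by blast
    then show "\<exists>\<delta>>0. \<forall>t. \<bar>t\<bar> < \<delta> \<longrightarrow> g i t \<in> P" using eps_pos[OF i] by blast
  qed simp
  then have "P \<subseteq> points X" using openin_X openin_subset by blast
  moreover have "points X \<subseteq> P"
    using openin_X[of "points X"] by (simp add: is_open_def)
  ultimately show ?thesis by simp
qed

lemma chart_J:
  assumes i: "i \<in> I"
  shows "is_chart (ctop X) (g i ` J i, inv_into (J i) (g i))"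
proof -
  let ?c = "inv_into (J i) (g i)"
  have im: "?c ` g i ` J i = J i" using inj_J[OF i] by (simp add: inv_into_image_cancel)
  have op: "openin (ctop X) (g i ` J i)"
    using is_open_image[OF i open_J] openin_X by simp
  have "homeomorphic_maps (top_of_set (J i)) (subtopology (ctop X) (g i ` J i)) (g i) ?c"
    unfolding homeomorphic_maps_def
  proof (intro conjI ballI)
    show "continuous_map (top_of_set (J i)) (subtopology (ctop X) (g i ` J i)) (g i)"
      unfolding continuous_map_in_subtopology unfolding continuous_map
    proof (intro conjI allI impI)
      show "g i ` topspace (top_of_set (J i)) \<subseteq> points X"
        using openin_subset[OF op] by simp
      show "g i \<in> topspace (top_of_set (J i)) \<rightarrow> g i ` J i" by auto
      fix W assume "openin (ctop X) W"
      then have W: "\<And>j. j \<in> I \<Longrightarrow> g j 0 \<in> W \<Longrightarrow> \<exists>\<delta>>0. \<forall>t. \<bar>t\<bar> < \<delta> \<longrightarrow> g j t \<in> W"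
        by (auto simp: openin_X is_open_def)
      have "open {s \<in> J i. g i s \<in> W}"
        unfolding open_dist
      proof
        fix s assume "s \<in> {s \<in> J i. g i s \<in> W}"
        then have s: "s \<in> J i" "g i s \<in> W" by auto
        then obtain j where j: "j \<in> I" "g j 0 = g i s" using cover[OF i] J_iff by metis
        then obtain a d where a: "a \<noteq> 0" "d > 0" "\<And>t. \<bar>t\<bar> < d \<Longrightarrow> g j t = g i (s + a * t)"
          using shift[OF i j(1)] s J_iff by metis
        obtain e where e: "e > 0" "\<And>t. \<bar>t\<bar> < e \<Longrightarrow> g j t \<in> W"
          using W[OF j(1)] j s by metis
        obtain r where r: "r > 0" "\<And>y. dist y s < r \<Longrightarrow> y \<in> J i"
          using open_J s(1) unfolding open_dist by metis
        have "y \<in> {s \<in> J i. g i s \<in> W}" if y: "dist y s < min r (min (\<bar>a\<bar> * d) (\<bar>a\<bar> * e))" for y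
        proof -
          define t where "t = (y - s) / a"
          have "\<bar>t\<bar> < d" "\<bar>t\<bar> < e" using y a(1) by (auto simp: t_def dist_real_def field_simps)
          moreover have "s + a * t = y" using a(1) by (simp add: t_def)
          ultimately have "g i y \<in> W" using a(3)[of t] e(2)[of t] by simp
          then show ?thesis using r(2) y by auto
        qed
        then show "\<exists>e>0. \<forall>y. dist y s < e \<longrightarrow> y \<in> {s \<in> J i. g i s \<in> W}"
          using a r e by (intro exI[of _ "min r (min (\<bar>a\<bar> * d) (\<bar>a\<bar> * e))"]) auto
      qed
      then show "openin (top_of_set (J i)) {x \<in> topspace (top_of_set (J i)). g i x \<in> W}"
        by (auto simp: openin_open_eq[OF open_J])
    qed
    show "continuous_map (subtopology (ctop X) (g i ` J i)) (top_of_set (J i)) ?c"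
      unfolding continuous_map_in_subtopology unfolding continuous_map
    proof (intro conjI allI impI)
      show "?c \<in> topspace (subtopology (ctop X) (g i ` J i)) \<rightarrow> J i" using im by auto
      fix W :: "real set" assume "openin euclidean W"
      then have "open W" by (rule open_openin[THEN iffD2])
      then have "open (J i \<inter> W)" by (intro open_Int open_J)
      moreover have "{x \<in> topspace (subtopology (ctop X) (g i ` J i)). ?c x \<in> W} = g i ` (J i \<inter> W)"
        using openin_subset[OF op] inj_J[OF i] by (auto simp: inj_on_image_Int)
      ultimately show "openin (subtopology (ctop X) (g i ` J i))
          {x \<in> topspace (subtopology (ctop X) (g i ` J i)). ?c x \<in> W}"
        using is_open_image[OF i, of "J i \<inter> W"] openin_X op by (auto simp: openin_open_subtopology)
    qed simp
  qed (use inj_J[OF i] openin_subset[OF op] in auto)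
  then have "homeomorphic_map (subtopology (ctop X) (g i ` J i)) (top_of_set (J i)) ?c"
    using homeomorphic_maps_sym homeomorphic_maps_map by blast
  then show ?thesis using op im open_J by (simp add: is_chart_def)
qed

lemma affine_curve_X: "affine_curve X"
  unfolding affine_curve_def
proof (intro conjI)
  show "\<forall>C\<in>atlas X. is_chart (ctop X) C"
    using chart_J by (auto simp: X_def)
  show "(\<Union>(U, c)\<in>atlas X. U) = points X"
  proof
    show "(\<Union>(U, c)\<in>atlas X. U) \<subseteq> points X"
      using is_open_image[OF _ open_J subset_refl] unfolding points_X by (auto simp: X_def is_open_def)
    show "points X \<subseteq> (\<Union>(U, c)\<in>atlas X. U)"
      using zero_J unfolding points_X by (auto simp: X_def P_def)
  qed
  show "Hausdorff_space (ctop X)"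
    unfolding Hausdorff_space_def
  proof (intro allI impI)
    fix x y assume "x \<in> points X \<and> y \<in> points X \<and> x \<noteq> y"
    then obtain i j where ij: "i \<in> I" "j \<in> I" "x = g i 0" "y = g j 0" "x \<noteq> y"
      by (auto simp: points_X P_def)
    then obtain d where d: "d > 0" "\<And>s t. \<bar>s\<bar> < d \<Longrightarrow> \<bar>t\<bar> < d \<Longrightarrow> g i s \<noteq> g j t"
      using sep by metis
    define T where "T k = J k \<inter> {-d<..<d}" for k
    have "openin (ctop X) (g i ` T i)" "openin (ctop X) (g j ` T j)"
      using is_open_image[OF ij(1), of "T i"] is_open_image[OF ij(2), of "T j"] open_J openin_X
      by (auto simp: T_def open_Int)
    moreover have "x \<in> g i ` T i" "y \<in> g j ` T j" using ij zero_J d by (auto simp: T_def)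
    moreover have "disjnt (g i ` T i) (g j ` T j)"
      using d(2) by (auto simp: disjnt_iff T_def abs_less_iff)
    ultimately show "\<exists>U V. openin (ctop X) U \<and> openin (ctop X) V \<and> x \<in> U \<and> y \<in> V \<and> disjnt U V"
      by blast
  qed
  show "\<forall>(U, c)\<in>atlas X. \<forall>(V, d)\<in>atlas X. locally_affine_on (c ` (U \<inter> V)) (d \<circ> inv_into U c)"
  proof clarify
    fix U c V d assume "(U, c) \<in> atlas X" "(V, d) \<in> atlas X"
    then obtain i j where i: "i \<in> I" "U = g i ` J i" "c = inv_into (J i) (g i)"
      and j: "j \<in> I" "V = g j ` J j" "d = inv_into (J j) (g j)"
      by (auto simp: X_def)
    have cg: "c (g i s) = s" if "s \<in> J i" for s using that inj_J[OF i(1)] i(3) by simp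
    have dg: "d (g j s) = s" if "s \<in> J j" for s using that inj_J[OF j(1)] j(3) by simp
    have injc: "inj_on c U" using i by (simp add: inj_on_inv_into)
    have ic: "inv_into U c s = g i s" if "s \<in> J i" for s
      using inv_into_f_f[OF injc, of "g i s"] that cg i(2) by simp
    show "locally_affine_on (c ` (U \<inter> V)) (d \<circ> inv_into U c)"
      unfolding locally_affine_on_def
    proof
      fix x assume "x \<in> c ` (U \<inter> V)"
      then obtain s s' where s: "s \<in> J i" "s' \<in> J j" "g i s = g j s'" "x = c (g i s)"
        using i j by auto
      then have x: "x = s" using cg[OF s(1)] by simp
      \<comment> \<open>The path centred at the common point expresses both charts affinely near it;
        eliminating its parameter gives the slope \<open>b / a\<close>.\<close>
      obtain k where k: "k \<in> I" "g k 0 = g i s" using cover[OF i(1)] s J_iff by metis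
      obtain a e where a: "a \<noteq> 0" "e > 0" "\<And>t. \<bar>t\<bar> < e \<Longrightarrow> g k t = g i (s + a * t)"
        using shift[OF i(1) k(1)] s k J_iff by metis
      obtain b e' where b: "b \<noteq> 0" "e' > 0" "\<And>t. \<bar>t\<bar> < e' \<Longrightarrow> g k t = g j (s' + b * t)"
        using shift[OF j(1) k(1)] s k J_iff by metis
      define T where "T = J i \<inter> {y. \<bar>(y - s) / a\<bar> < e \<and> \<bar>(y - s) / a\<bar> < e'} \<inter> {y. s' + b / a * (y - s) \<in> J j}"
      have "open T"
        unfolding T_def J_def greaterThanLessThan_iff using a(1)
        by (intro open_Int open_Collect_less open_Collect_conj open_greaterThanLessThan continuous_intros) auto
      moreover have "x \<in> T" using s x a b by (simp add: T_def)
      moreover have "(d \<circ> inv_into U c) y = b / a * y + (s' - b / a * s)" if y: "y \<in> T" for y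
      proof -
        define t where "t = (y - s) / a"
        have t: "\<bar>t\<bar> < e" "\<bar>t\<bar> < e'" "s + a * t = y" "s' + b * t \<in> J j" "y \<in> J i"
          using y a(1) by (auto simp: t_def T_def)
        then have "g i y = g j (s' + b * t)" using a(3)[of t] b(3)[of t] by simp
        then have "(d \<circ> inv_into U c) y = s' + b * t" using ic t dg by simp
        then show ?thesis using a(1) by (simp add: t_def field_simps)
      qed
      moreover have "b / a \<noteq> 0" using a b by simp
      ultimately show "\<exists>a b. a \<noteq> 0 \<and> (\<exists>T. open T \<and> x \<in> T \<and> (\<forall>y\<in>T \<inter> c ` (U \<inter> V). (d \<circ> inv_into U c) y = a * y + b))"
        by blast
    qed
  qed
qed

lemma aparam_X:
  assumes i: "i \<in> I" shows "aparam X (g i)"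
proof -
  have "(g i ` J i, inv_into (J i) (g i)) \<in> atlas X" using i by (auto simp: X_def)
  moreover have "g i t \<in> g i ` J i \<and> inv_into (J i) (g i) (g i t) = inv_into (J i) (g i) (g i 0) + 1 * t"
    if "\<bar>t\<bar> < eps i" for t
    using that inj_J[OF i] zero_J[OF i] J_iff by simp
  ultimately show ?thesis unfolding aparam_def using eps_pos[OF i] one_neq_zero by blast
qed

end

lemma aparam_rescale:
  assumes "aparam X g" "a \<noteq> 0" "\<delta> > 0" "\<And>t. \<bar>t\<bar> < \<delta> \<Longrightarrow> h t = g (a * t)"
  shows "aparam X h"
proof -
  obtain U c b e where c: "(U, c) \<in> atlas X" "b \<noteq> 0" "e > 0"
    and ct: "\<And>t. \<bar>t\<bar> < e \<Longrightarrow> g t \<in> U \<and> c (g t) = c (g 0) + b * t"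
    using assms(1) unfolding aparam_def by metis
  have h0: "h 0 = g 0" using assms(4)[of 0] assms(3) by simp
  have "h t \<in> U \<and> c (h t) = c (h 0) + (b * a) * t" if t: "\<bar>t\<bar> < min \<delta> (e / \<bar>a\<bar>)" for t
  proof -
    have "\<bar>a * t\<bar> < e" using t assms(2) by (simp add: abs_mult field_simps)
    then show ?thesis using ct[of "a * t"] assms(4)[of t] t h0 by simp
  qed
  moreover have "b * a \<noteq> 0" "min \<delta> (e / \<bar>a\<bar>) > 0" using assms c by auto
  ultimately show ?thesis unfolding aparam_def using c(1) by blast
qed

section \<open>Germs of piecewise affine maps at half-points\<close>

text \<open>A half-point \<open>(x, b)\<close> is a point of the circle with one of its two sides: the right one if
  \<open>b\<close>, the left one otherwise.\<close>

type_synonym half = "circle \<times> bool"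

definition sg :: "bool \<Rightarrow> real" where "sg b = (if b then 1 else -1)"

definition ray :: "half \<Rightarrow> real \<Rightarrow> circle" where
  "ray u t = circle_proj (circle_rep (fst u) + sg (snd u) * t)"

definition opp :: "half \<Rightarrow> half" where "opp u = (fst u, \<not> snd u)"

text \<open>The value of \<open>f\<close> at \<open>fst u\<close> itself does not enter, so germs
  survive changes of \<open>f\<close> on finite sets.\<close>

definition germ :: "(circle \<Rightarrow> circle) \<Rightarrow> half \<Rightarrow> half \<Rightarrow> real \<Rightarrow> bool" where
  "germ f u v a \<longleftrightarrow> a > 0 \<and> (\<exists>e>0. \<forall>t. 0 < t \<and> t < e \<longrightarrow> f (ray u t) = ray v (a * t))"

lemma sg_simps [simp]: "sg True = 1" "sg False = -1" "sg (\<not> b) = - sg b" "sg b * sg b = 1"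
  "sg b * (sg b * x) = x" "\<bar>sg b\<bar> = 1" "sg b \<noteq> 0"
  by (auto simp: sg_def)

lemma opp_simps [simp]: "fst (opp u) = fst u" "snd (opp u) = (\<not> snd u)" "opp (opp u) = u" "opp u \<noteq> u"
  "u \<noteq> opp u" "opp (x, b) = (x, \<not> b)"
  by (auto simp: opp_def prod_eq_iff)

lemma proj_rep [simp]: "circle_proj (circle_rep x) = x"
  by (rule Quotient3_abs_rep[OF Quotient3_circle])

lemma ray_proj: "ray (circle_proj x, b) t = circle_proj (x + sg b * t)"
proof -
  have "circle_rep (circle_proj x) - x \<in> \<int>" using proj_rep[of "circle_proj x"] by (simp only: proj_eq)
  then show ?thesis by (simp add: ray_def proj_eq)
qed

lemma half_cases: obtains x b where "u = (circle_proj x, b)"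
  by (metis proj_rep surj_pair)

lemma ray_0 [simp]: "ray u 0 = fst u"
  by (simp add: ray_def)

text \<open>Origin of the bound 1 in the search for the next missing point: the circle has length 1,
  so a ray is back at its base point at time 1.\<close>

lemma ray_1 [simp]: "ray u 1 = fst u"
  by (cases u rule: half_cases) (simp add: ray_proj proj_eq sg_def)

lemma ray_ray: "ray (ray u t, snd u) s = ray u (t + s)"
  by (cases u rule: half_cases) (simp add: ray_proj algebra_simps)

lemma ray_back: "ray (ray u t, \<not> snd u) s = ray u (t - s)"
  by (cases u rule: half_cases) (simp add: ray_proj algebra_simps)

lemma ray_opp: "ray (opp u) t = ray u (- t)"
  by (cases u rule: half_cases) (simp add: ray_proj)

lemma ray_eq: "ray u s = ray u t \<longleftrightarrow> s - t \<in> \<int>"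
proof (cases u rule: half_cases)
  case (1 x b)
  have "sg b * s - sg b * t \<in> \<int> \<longleftrightarrow> s - t \<in> \<int>"
    using Ints_minus[of "s - t"] Ints_minus[of "t - s"] by (cases b) auto
  then show ?thesis using 1 by (simp add: ray_proj proj_eq)
qed

lemma ray_neq:
  assumes "s \<noteq> t" "\<bar>s - t\<bar> < 1" shows "ray u s \<noteq> ray u t"
  using assms Ints_nonzero_abs_less1[of "s - t"] by (auto simp: ray_eq)

text \<open>Two integers at distance less than 1 coincide, so the slope is 0. Affine paths in the
  circle are equal when their lifts differ by integers, and this converts such an equality into
  equality of speeds.\<close>

lemma affine_in_Ints:
  fixes p q :: real
  assumes e: "e > 0" and h: "\<And>t. 0 < t \<Longrightarrow> t < e \<Longrightarrow> p + q * t \<in> \<int>"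
  shows "q = 0 \<and> p \<in> \<int>"
proof -
  have "q = 0"
  proof (rule ccontr)
    assume q: "q \<noteq> 0"
    \<comment> \<open>Short enough to stay below \<open>e\<close> and to keep the variation
      \<open>q * d / 2\<close> below 1.\<close>
    define d where "d = min (e / 2) (1 / (2 * \<bar>q\<bar>))"
    have d: "0 < d" "d < e" "\<bar>q * d\<bar> \<le> 1 / 2"
      using e q by (auto simp: d_def abs_mult min_def field_simps)
    have "(p + q * d) - (p + q * (d / 2)) \<in> \<int>" using h[of d] h[of "d / 2"] d by (intro Ints_diff) auto
    moreover have "(p + q * d) - (p + q * (d / 2)) = q * d / 2" by simp
    ultimately have "q * d / 2 \<in> \<int>" by metis
    moreover have "\<bar>q * d / 2\<bar> < 1" using d(3) by simp
    ultimately have "q * d / 2 = 0" by (rule Ints_nonzero_abs_less1)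
    then show False using d q by simp
  qed
  then show ?thesis using h[of "e / 2"] e by simp
qed

text \<open>Lifted to the line, the two rays differ by an affine function with integer values. Hence
  the signed speeds agree, and since \<open>a\<close> and \<open>b\<close> are positive, so do the
  sides.\<close>

lemma ray_germ_unique:
  assumes e: "e > 0" and ab: "a > 0" "b > 0"
    and h: "\<And>t. 0 < t \<Longrightarrow> t < e \<Longrightarrow> ray u (a * t) = ray v (b * t)"
  shows "u = v \<and> a = b"
proof -
  obtain x c where u: "u = (circle_proj x, c)" by (rule half_cases)
  obtain y d where v: "v = (circle_proj y, d)" by (rule half_cases)
  have "(x - y) + (sg c * a - sg d * b) * t \<in> \<int>" if "0 < t" "t < e" for t
    using h[OF that] unfolding u v ray_proj proj_eq by (simp add: algebra_simps)
  from affine_in_Ints[OF e this] have *: "sg c * a = sg d * b" "x - y \<in> \<int>" by auto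
  then have "c = d" "a = b" using ab by (auto simp: sg_def split: if_splits)
  then show ?thesis using * by (simp add: u v proj_eq)
qed

lemma germ_unique:
  assumes "germ f u v a" "germ f u w b" shows "v = w \<and> a = b"
proof -
  obtain e e' where e: "a > 0" "e > 0" "\<And>t. 0 < t \<Longrightarrow> t < e \<Longrightarrow> f (ray u t) = ray v (a * t)"
    "b > 0" "e' > 0" "\<And>t. 0 < t \<Longrightarrow> t < e' \<Longrightarrow> f (ray u t) = ray w (b * t)"
    using assms unfolding germ_def by metis
  show ?thesis
    by (rule ray_germ_unique[of "min e e'"]) (use e in \<open>auto simp flip: e(3) e(6)\<close>)
qed

lemma germ_comp:
  assumes "germ f u v a" "germ g v w b" shows "germ (g \<circ> f) u w (a * b)"
proof -
  obtain e e' where e: "a > 0" "e > 0" "\<And>t. 0 < t \<Longrightarrow> t < e \<Longrightarrow> f (ray u t) = ray v (a * t)"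
    "b > 0" "e' > 0" "\<And>t. 0 < t \<Longrightarrow> t < e' \<Longrightarrow> g (ray v t) = ray w (b * t)"
    using assms unfolding germ_def by metis
  have "(g \<circ> f) (ray u t) = ray w (a * b * t)" if "0 < t" "t < min e (e' / a)" for t
    using that e(3)[of t] e(6)[of "a * t"] e(1) by (simp add: field_simps)
  moreover have "min e (e' / a) > 0" using e by simp
  ultimately show ?thesis using e unfolding germ_def by (metis mult_pos_pos)
qed

lemma ray_avoids:
  assumes "finite F" obtains e where "e > 0" "\<And>t. 0 < t \<Longrightarrow> t < e \<Longrightarrow> ray u t \<notin> F"
proof -
  have "\<exists>e>0. \<forall>t. 0 < t \<and> t < e \<longrightarrow> ray u t \<notin> F"
    using assms
  proof (induction F)
    case empty then show ?case by (auto intro: exI[of _ 1])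
  next
    case (insert y F)
    then obtain e where e: "e > 0" "\<And>t. 0 < t \<Longrightarrow> t < e \<Longrightarrow> ray u t \<notin> F" by blast
    show ?case
    proof (cases "\<exists>t. 0 < t \<and> t < 1 \<and> ray u t = y")
      case True
      then obtain s where s: "0 < s" "s < 1" "ray u s = y" by blast
      then have "ray u t \<noteq> y" if "0 < t" "t < s" for t using ray_neq[of t s u] that by auto
      then show ?thesis using e s by (intro exI[of _ "min e s"]) auto
    next
      case False
      then show ?thesis using e by (intro exI[of _ "min e 1"]) auto
    qed
  qed
  then show thesis using that by blast
qed

lemma germ_cong:
  assumes "germ f u v a" "finite {x. f x \<noteq> g x}" shows "germ g u v a"
proof -
  obtain e where e: "a > 0" "e > 0" "\<And>t. 0 < t \<Longrightarrow> t < e \<Longrightarrow> f (ray u t) = ray v (a * t)"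
    using assms unfolding germ_def by metis
  obtain e' where e': "e' > 0" "\<And>t. 0 < t \<Longrightarrow> t < e' \<Longrightarrow> ray u t \<notin> {x. f x \<noteq> g x}"
    using ray_avoids[OF assms(2)] by blast
  have "g (ray u t) = ray v (a * t)" if "0 < t" "t < min e e'" for t
    using e(3)[of t] e'(2)[of t] that by auto
  then show ?thesis using e e' unfolding germ_def by (intro conjI exI[of _ "min e e'"]) auto
qed

text \<open>Agreement of affine maps to the circle on a small interval propagates along an interval.\<close>

lemma interval_locally_affine:
  fixes h :: "real \<Rightarrow> circle"
  assumes loc: "\<forall>t. l < t \<and> t < r \<longrightarrow>
      (\<exists>y c d. c \<noteq> 0 \<and> d > 0 \<and> (\<forall>s. \<bar>s\<bar> < d \<longrightarrow> h (t + s) = circle_proj (y + c * s)))"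
    and lr: "l < r"
  shows "\<exists>y c. c \<noteq> 0 \<and> (\<forall>t. l < t \<and> t < r \<longrightarrow> h t = circle_proj (y + c * t))"
proof -
  obtain y0 c d0 where c: "c \<noteq> 0" "d0 > 0"
    and y0: "\<And>s. \<bar>s\<bar> < d0 \<Longrightarrow> h ((l + r) / 2 + s) = circle_proj (y0 + c * s)"
    using loc[rule_format, of "(l + r) / 2"] lr by auto
  define y where "y = y0 - c * ((l + r) / 2)"
  define S where "S = {t. l < t \<and> t < r \<and> (\<exists>d>0. \<forall>s. \<bar>s\<bar> < d \<longrightarrow> h (t + s) = circle_proj (y + c * (t + s)))}"
  \<comment> \<open>If the formula holds near one point of this neighbourhood, it differs there from
    the local formula by an affine function with integer values, hence by a constant integer, and so
    holds throughout. Thus \<open>S\<close> and its complement in the interval are both open, and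
    connectedness concludes.\<close>
  have key: "\<exists>d>0. {t-d<..<t+d} \<subseteq> S \<or> {t-d<..<t+d} \<inter> S = {}" if t: "l < t" "t < r" for t
  proof -
    obtain y' c' d where d: "d > 0" "\<And>s. \<bar>s\<bar> < d \<Longrightarrow> h (t + s) = circle_proj (y' + c' * s)"
      using loc[rule_format, OF conjI[OF t]] by blast
    define d' where "d' = min d (min (t - l) (r - t))"
    have d': "d' > 0" "d' \<le> d" "d' \<le> t - l" "d' \<le> r - t" using d t by (auto simp: d'_def)
    have "{t-d'<..<t+d'} \<subseteq> S" if t1: "t1 \<in> {t-d'<..<t+d'}" "t1 \<in> S" for t1
    proof -
      obtain e where e: "e > 0" "\<And>s. \<bar>s\<bar> < e \<Longrightarrow> h (t1 + s) = circle_proj (y + c * (t1 + s))"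
        using t1(2) by (auto simp: S_def)
      define e' where "e' = min e (t + d' - t1)"
      have e'0: "e' > 0" using e t1(1) by (simp add: e'_def)
      have "(y + c * t1 - y' - c' * (t1 - t)) + (c - c') * s \<in> \<int>" if s: "0 < s" "s < e'" for s
      proof -
        have "circle_proj (y + c * (t1 + s)) = h (t1 + s)" using s e by (simp add: e'_def)
        also have "\<dots> = circle_proj (y' + c' * (t1 + s - t))"
        proof -
          have "\<bar>t1 + s - t\<bar> < d" using s t1(1) d' by (simp add: e'_def abs_less_iff)
          from d(2)[OF this] show ?thesis by simp
        qed
        finally show ?thesis by (simp add: proj_eq algebra_simps)
      qed
      then have "c - c' = 0 \<and> y + c * t1 - y' - c' * (t1 - t) \<in> \<int>"
        using affine_in_Ints[OF e'0] by blast
      then have cc: "c = c'" "y + c * t1 - y' - c' * (t1 - t) \<in> \<int>" by (auto simp only: right_minus_eq)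
      have "h z = circle_proj (y + c * z)" if z: "z \<in> {t-d'<..<t+d'}" for z
      proof -
        have "h z = circle_proj (y' + c' * (z - t))"
          using d(2)[of "z - t"] z d' by (auto simp: abs_less_iff)
        moreover have "y' + c' * (z - t) - (y + c * z) = - (y + c * t1 - y' - c' * (t1 - t))"
          using cc(1) by (simp add: algebra_simps)
        ultimately show ?thesis using cc(2) Ints_minus by (metis proj_eq)
      qed
      note hz = this
      show ?thesis
      proof
        fix z assume z: "z \<in> {t-d'<..<t+d'}"
        have "h (z + s) = circle_proj (y + c * (z + s))" if "\<bar>s\<bar> < min (z - (t - d')) (t + d' - z)" for s
          using that by (intro hz) auto
        then show "z \<in> S" using z d' unfolding S_def
          by (auto intro!: exI[of _ "min (z - (t - d')) (t + d' - z)"])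
      qed
    qed
    then show ?thesis using d'(1) by blast
  qed
  have "open S"
    unfolding open_dist
  proof
    fix t assume t: "t \<in> S"
    then obtain d where d: "d > 0" "{t-d<..<t+d} \<subseteq> S \<or> {t-d<..<t+d} \<inter> S = {}"
      using key[of t] by (auto simp: S_def)
    moreover have "t \<in> {t-d<..<t+d}" using d by simp
    ultimately have "{t-d<..<t+d} \<subseteq> S" using t by blast
    moreover have "y \<in> {t-d<..<t+d}" if "dist y t < d" for y
      using that by (simp add: dist_real_def abs_less_iff)
    ultimately show "\<exists>e>0. \<forall>y. dist y t < e \<longrightarrow> y \<in> S" using d(1) by blast
  qed
  moreover have "open ({l<..<r} - S)"
    unfolding open_dist
  proof
    fix t assume t: "t \<in> {l<..<r} - S"
    then obtain d where d: "d > 0" "{t-d<..<t+d} \<subseteq> S \<or> {t-d<..<t+d} \<inter> S = {}"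
      using key[of t] by auto
    moreover have "t \<in> {t-d<..<t+d}" using d by simp
    ultimately have dS: "{t-d<..<t+d} \<inter> S = {}" using t by blast
    have "y \<in> {l<..<r} - S" if "dist y t < min d (min (t - l) (r - t))" for y
    proof -
      have "\<bar>y - t\<bar> < d" "\<bar>y - t\<bar> < t - l" "\<bar>y - t\<bar> < r - t" using that by (auto simp: dist_real_def)
      then have "y \<in> {t-d<..<t+d}" "y \<in> {l<..<r}" by auto
      then show ?thesis using dS by blast
    qed
    moreover have "min d (min (t - l) (r - t)) > 0" using d(1) t by simp
    ultimately show "\<exists>e>0. \<forall>y. dist y t < e \<longrightarrow> y \<in> {l<..<r} - S" by blast
  qed
  moreover have "(l + r) / 2 \<in> S"
    using y0 c(2) lr unfolding S_def y_def by (auto simp: algebra_simps intro!: exI[of _ d0])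
  moreover have "connected {l<..<r}" by simp
  moreover have "(l + r) / 2 \<in> {l<..<r}" using lr by simp
  ultimately have "({l<..<r} - S) \<inter> {l<..<r} = {}"
    using connectedD[of "{l<..<r}" S "{l<..<r} - S"] by blast
  then have "t \<in> S" if "l < t" "t < r" for t using that by auto
  then have "h t = circle_proj (y + c * t)" if "l < t" "t < r" for t
  proof -
    have "t \<in> S" using \<open>\<And>t. l < t \<Longrightarrow> t < r \<Longrightarrow> t \<in> S\<close> that by blast
    then obtain d where "d > 0" "\<And>s. \<bar>s\<bar> < d \<Longrightarrow> h (t + s) = circle_proj (y + c * (t + s))"
      by (auto simp: S_def)
    from this(2)[of 0] this(1) show ?thesis by simp
  qed
  then show ?thesis using c(1) by blast
qed

lemma inj_on_proj: "inj_on circle_proj {x - 1/2 <..< x + 1/2}"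
proof (rule inj_onI)
  fix y z assume "y \<in> {x - 1/2 <..< x + 1/2}" "z \<in> {x - 1/2 <..< x + 1/2}" "circle_proj y = circle_proj z"
  then have "y - z \<in> \<int>" "\<bar>y - z\<bar> < 1" by (auto simp: proj_eq abs_less_iff)
  then show "y = z" using Ints_nonzero_abs_less1 by fastforce
qed

lemma proj_path_aparam:
  assumes "a \<noteq> 0" shows "aparam std_circle (\<lambda>t. circle_proj (x + a * t))"
proof -
  let ?I = "{x - 1/2 <..< x + 1/2}"
  have "(circle_proj ` ?I, inv_into ?I circle_proj) \<in> atlas std_circle"
    using inj_on_proj by (auto simp: std_circle_def)
  moreover have "inv_into ?I circle_proj (circle_proj y) = y" if "y \<in> ?I" for y
    using inj_on_proj that by simp
  moreover have "x + a * t \<in> ?I" if "\<bar>t\<bar> < 1 / (2 * \<bar>a\<bar>)" for t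
  proof -
    have "\<bar>a * t\<bar> < 1 / 2" using that assms by (simp add: abs_mult field_simps)
    then show ?thesis by auto
  qed
  ultimately show ?thesis
    unfolding aparam_def using assms
    by (intro exI[of _ "circle_proj ` ?I"] exI[of _ "inv_into ?I circle_proj"] exI[of _ a]
        exI[of _ "1 / (2 * \<bar>a\<bar>)"]) auto
qed

lemma aparam_std_circleD:
  assumes "aparam std_circle g"
  obtains x a d where "a \<noteq> 0" "d > 0" "\<And>t. \<bar>t\<bar> < d \<Longrightarrow> g t = circle_proj (x + a * t)"
proof -
  obtain U c a \<delta> where c: "(U, c) \<in> atlas std_circle" "a \<noteq> 0" "\<delta> > 0"
    and ct: "\<And>t. \<bar>t\<bar> < \<delta> \<Longrightarrow> g t \<in> U \<and> c (g t) = c (g 0) + a * t"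
    using assms unfolding aparam_def by metis
  obtain I where I: "U = circle_proj ` I" "c = inv_into I circle_proj"
    using c(1) by (auto simp: std_circle_def)
  have "g t = circle_proj (c (g 0) + a * t)" if "\<bar>t\<bar> < \<delta>" for t
    using ct[OF that] I f_inv_into_f by metis
  then show thesis using that c by blast
qed

lemma points_std_circle [simp]: "points std_circle = UNIV"
  by (simp add: std_circle_def)

section \<open>One-sided germs of piecewise affine maps of the circle\<close>

abbreviation PA :: "(circle \<Rightarrow> circle) \<Rightarrow> bool" where "PA \<equiv> pw_affine std_circle std_circle"

lemma PA_local:
  assumes "PA f"
  obtains F where "finite F" "inj_on f (- F)"
    "\<And>x. circle_proj x \<notin> F \<Longrightarrow> \<exists>y c d. c \<noteq> 0 \<and> d > 0 \<and> (\<forall>t. \<bar>t\<bar> < d \<longrightarrow> f (circle_proj (x + t)) = circle_proj (y + c * t))"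
proof -
  obtain F F' where F: "finite F" "finite F'" "affine_iso (remove F std_circle) (remove F' std_circle) f"
    using assms unfolding pw_affine_def by blast
  have "inj_on f (- F)" using iso_bij[OF F(3)] by (simp add: bij_betw_def Compl_eq_Diff_UNIV)
  moreover have "\<exists>y c d. c \<noteq> 0 \<and> d > 0 \<and> (\<forall>t. \<bar>t\<bar> < d \<longrightarrow> f (circle_proj (x + t)) = circle_proj (y + c * t))"
    if "circle_proj x \<notin> F" for x
  proof -
    have ap: "aparam std_circle (f \<circ> (\<lambda>t. circle_proj (x + 1 * t)))"
      by (rule affine_iso_aparamD[OF affine_curve_std_circle affine_curve_std_circle F])
         (use that proj_path_aparam[of 1 x] in auto)
    obtain y a d where
      d: "a \<noteq> 0" "d > 0" "\<And>t. \<bar>t\<bar> < d \<Longrightarrow> (f \<circ> (\<lambda>t. circle_proj (x + 1 * t))) t = circle_proj (y + a * t)"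
      by (rule aparam_std_circleD[OF ap], rule that)
    have "\<forall>t. \<bar>t\<bar> < d \<longrightarrow> f (circle_proj (x + t)) = circle_proj (y + a * t)" using d(3) by simp
    then show ?thesis using d(1,2) by blast
  qed
  ultimately show thesis using that F(1) by blast
qed

lemma proj_path_ray: "c \<noteq> 0 \<Longrightarrow> circle_proj (y + c * t) = ray (circle_proj y, c > 0) (\<bar>c\<bar> * t)"
  by (simp add: ray_proj sg_def)

text \<open>A short enough ray avoids the finite exceptional set. Local affinity along it merges
  into one affine formula, whose slope gives the speed by its absolute value and the side by its
  sign.\<close>

lemma germ_exists:
  assumes f: "PA f" shows "\<exists>v a. germ f u v a"
proof -
  obtain F where F: "finite F"
    "\<And>x. circle_proj x \<notin> F \<Longrightarrow> \<exists>y c d. c \<noteq> 0 \<and> d > 0 \<and> (\<forall>t. \<bar>t\<bar> < d \<longrightarrow> f (circle_proj (x + t)) = circle_proj (y + c * t))"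
    by (rule PA_local[OF f], rule that)
  obtain x b where u: "u = (circle_proj x, b)" by (rule half_cases)
  obtain e where e: "e > 0" "\<And>t. 0 < t \<Longrightarrow> t < e \<Longrightarrow> ray u t \<notin> F" using ray_avoids[OF F(1)] by blast
  have "\<forall>t. 0 < t \<and> t < e \<longrightarrow>
    (\<exists>y c d. c \<noteq> 0 \<and> d > 0 \<and> (\<forall>s. \<bar>s\<bar> < d \<longrightarrow> f (ray u (t + s)) = circle_proj (y + c * s)))"
  proof (intro allI impI)
    fix t assume t: "0 < t \<and> t < e"
    have "circle_proj (x + sg b * t) \<notin> F" using e(2)[of t] t by (simp add: u ray_proj)
    from F(2)[OF this] obtain y c d where d: "c \<noteq> 0" "d > 0"
      "\<And>s. \<bar>s\<bar> < d \<Longrightarrow> f (circle_proj (x + sg b * t + s)) = circle_proj (y + c * s)" by blast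
    have "f (ray u (t + s)) = circle_proj (y + (sg b * c) * s)" if "\<bar>s\<bar> < d" for s
      using d(3)[of "sg b * s"] that by (simp add: u ray_proj abs_mult algebra_simps)
    moreover have "sg b * c \<noteq> 0" using d by simp
    ultimately show "\<exists>y c d. c \<noteq> 0 \<and> d > 0 \<and> (\<forall>s. \<bar>s\<bar> < d \<longrightarrow> f (ray u (t + s)) = circle_proj (y + c * s))"
      using d(2) by blast
  qed
  from interval_locally_affine[OF this e(1)] obtain y c
    where c: "c \<noteq> 0" "\<forall>t. 0 < t \<and> t < e \<longrightarrow> f (ray u t) = circle_proj (y + c * t)" by blast
  have "\<forall>t. 0 < t \<and> t < e \<longrightarrow> f (ray u t) = ray (circle_proj y, c > 0) (\<bar>c\<bar> * t)"
    using c(2) proj_path_ray[OF c(1)] by simp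
  moreover have "\<bar>c\<bar> > 0" using c(1) by simp
  ultimately have "germ f u (circle_proj y, c > 0) \<bar>c\<bar>"
    using e(1) unfolding germ_def by blast
  then show ?thesis by blast
qed

text \<open>Affinity across \<open>x\<close>, expressed by germs: the two sides are stretched
  equally and go to the two sides of one point. The value at \<open>x\<close> is included because a
  representative may take any value at finitely many points.\<close>

definition smooth :: "(circle \<Rightarrow> circle) \<Rightarrow> circle \<Rightarrow> bool" where
  "smooth f x \<longleftrightarrow> (\<exists>v a. fst v = f x \<and> germ f (x, True) v a \<and> germ f (x, False) (opp v) a)"

lemma finite_not_smooth:
  assumes f: "PA f" shows "finite {x. \<not> smooth f x}"
proof -
  obtain F where F: "finite F"
    "\<And>x. circle_proj x \<notin> F \<Longrightarrow> \<exists>y c d. c \<noteq> 0 \<and> d > 0 \<and> (\<forall>t. \<bar>t\<bar> < d \<longrightarrow> f (circle_proj (x + t)) = circle_proj (y + c * t))"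
    by (rule PA_local[OF f], rule that)
  have "smooth f x" if "x \<notin> F" for x
  proof -
    obtain x' where x: "x = circle_proj x'" using proj_surj by blast
    have nF: "circle_proj x' \<notin> F" using that x by simp
    from F(2)[OF this] obtain y c d where c: "c \<noteq> 0" "d > 0"
      and d: "\<And>t. \<bar>t\<bar> < d \<Longrightarrow> f (circle_proj (x' + t)) = circle_proj (y + c * t)" by blast
    let ?v = "(circle_proj y, c > 0)"
    have "f (ray (x, True) t) = ray ?v (\<bar>c\<bar> * t)" if "0 < t" "t < d" for t
      using d[of t] that proj_path_ray[OF c(1)] by (simp add: x ray_proj)
    moreover have "f (ray (x, False) t) = ray (opp ?v) (\<bar>c\<bar> * t)" if "0 < t" "t < d" for t
      using d[of "-t"] that proj_path_ray[OF c(1), of _ "-t"] by (simp add: x ray_proj ray_opp del: opp_simps)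
    moreover have "f x = circle_proj y" using d[of 0] c x by simp
    moreover have "\<bar>c\<bar> > 0" using c(1) by simp
    ultimately have "fst ?v = f x" "germ f (x, True) ?v \<bar>c\<bar>" "germ f (x, False) (opp ?v) \<bar>c\<bar>"
      using c(2) unfolding germ_def by auto
    then show ?thesis unfolding smooth_def by blast
  qed
  then have "{x. \<not> smooth f x} \<subseteq> F" by blast
  then show ?thesis using F(1) finite_subset by blast
qed

text \<open>Running the two rays at speeds \<open>1 / a\<close> and \<open>1 / b\<close> makes their
  images coincide at each time; injectivity of \<open>f\<close> off a finite set then makes the rays
  themselves coincide.\<close>

lemma germ_inj:
  assumes f: "PA f" and g: "germ f u w a" "germ f v w b" shows "u = v"
proof -
  obtain F where F: "finite F" "inj_on f (- F)" by (rule PA_local[OF f], rule that)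
  obtain e e' where e: "a > 0" "e > 0" "\<And>t. 0 < t \<Longrightarrow> t < e \<Longrightarrow> f (ray u t) = ray w (a * t)"
    "b > 0" "e' > 0" "\<And>t. 0 < t \<Longrightarrow> t < e' \<Longrightarrow> f (ray v t) = ray w (b * t)"
    using g unfolding germ_def by metis
  obtain d where d: "d > 0" "\<And>t. 0 < t \<Longrightarrow> t < d \<Longrightarrow> ray u t \<notin> F" using ray_avoids[OF F(1)] by blast
  obtain d' where d': "d' > 0" "\<And>t. 0 < t \<Longrightarrow> t < d' \<Longrightarrow> ray v t \<notin> F" using ray_avoids[OF F(1)] by blast
  have "ray u (1 / a * t) = ray v (1 / b * t)" if t: "0 < t" "t < min (min (a * d) (a * e)) (min (b * d') (b * e'))" for t
  proof -
    have s: "0 < t / a" "t / a < min d e" "0 < t / b" "t / b < min d' e'"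
      using t e(1,4) by (simp_all add: pos_divide_less_eq mult.commute)
    then have "f (ray u (t / a)) = f (ray v (t / b))" using e(3)[of "t / a"] e(6)[of "t / b"] e(1,4) by simp
    moreover have "ray u (t / a) \<notin> F" "ray v (t / b) \<notin> F" using s d(2) d'(2) by auto
    ultimately show ?thesis using F(2) by (auto dest: inj_onD)
  qed
  then show ?thesis using ray_germ_unique[of "min (min (a * d) (a * e)) (min (b * d') (b * e'))" "1 / a" "1 / b" u v] e d d' by auto
qed

section \<open>The action on half-points and the cocycle of slopes\<close>

definition half_map :: "(circle \<Rightarrow> circle) \<Rightarrow> half \<Rightarrow> half" where "half_map f u = (SOME v. \<exists>a. germ f u v a)"
definition slope :: "(circle \<Rightarrow> circle) \<Rightarrow> half \<Rightarrow> real" where "slope f u = (SOME a. germ f u (half_map f u) a)"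

lemma germ_half_map_slope:
  assumes "germ f u v a" shows "half_map f u = v" "slope f u = a"
proof -
  have "\<exists>a. germ f u (half_map f u) a" unfolding half_map_def by (rule someI_ex) (use assms in blast)
  then have "germ f u (half_map f u) (slope f u)" unfolding slope_def by (rule someI_ex)
  then show "half_map f u = v" "slope f u = a" using germ_unique assms by blast+
qed

lemma germ_half_map: "PA f \<Longrightarrow> germ f u (half_map f u) (slope f u)"
  using germ_exists germ_half_map_slope by metis

lemma slope_pos: "PA f \<Longrightarrow> slope f u > 0"
  using germ_half_map germ_def by blast

lemma half_map_comp:
  assumes "PA f" "PA g"
  shows "half_map (g \<circ> f) u = half_map g (half_map f u)" "slope (g \<circ> f) u = slope f u * slope g (half_map f u)"
  using germ_half_map_slope[OF germ_comp[OF germ_half_map[OF assms(1)] germ_half_map[OF assms(2)]]] by auto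

lemma half_map_id: "half_map id u = u" "slope id u = 1"
proof -
  have "germ id u u 1" by (auto simp: germ_def intro: exI[of _ 1])
  then show "half_map id u = u" "slope id u = 1" using germ_half_map_slope by blast+
qed

lemma half_map_cong:
  assumes "PA f" "pw_eq std_circle f g"
  shows "half_map g = half_map f" "slope g = slope f"
proof -
  have "germ g u (half_map f u) (slope f u)" for u
    by (rule germ_cong[OF germ_half_map[OF assms(1)]]) (use assms(2) in \<open>simp add: pw_eq_def\<close>)
  then show "half_map g = half_map f" "slope g = slope f" using germ_half_map_slope by blast+
qed

lemma smooth_half_map:
  assumes "smooth f x"
  shows "fst (half_map f (x, b)) = f x" "half_map f (x, \<not> b) = opp (half_map f (x, b))" "slope f (x, \<not> b) = slope f (x, b)"
proof -
  obtain v a where "fst v = f x" "germ f (x, True) v a" "germ f (x, False) (opp v) a"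
    using assms unfolding smooth_def by blast
  then have "fst v = f x" "half_map f (x, True) = v" "half_map f (x, False) = opp v" "slope f (x, True) = a" "slope f (x, False) = a"
    using germ_half_map_slope by blast+
  then show "fst (half_map f (x, b)) = f x" "half_map f (x, \<not> b) = opp (half_map f (x, b))" "slope f (x, \<not> b) = slope f (x, b)"
    by (cases b; simp)+
qed

section \<open>The commensurating action\<close>

text \<open>A triple \<open>(u, v, l)\<close> stands for gluing the half-points \<open>u\<close> and \<open>v\<close> so that \<open>ray u t \<mapsto> -t\<close>,
  \<open>ray v t \<mapsto> l * t\<close> becomes an affine chart at the new point.\<close>

definition gluings :: "(half \<times> half \<times> real) set" where
  "gluings = {y. snd (snd y) > 0}"

text \<open>If a chart sends \<open>ray u t\<close> to \<open>-t\<close> and \<open>ray v t\<close>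
  to \<open>l * t\<close>, then its transport by \<open>f\<close>, multiplied by
  \<open>slope f u\<close> so that the first branch has speed -1 again, has the scale
  \<open>l * slope f u / slope f v\<close>.\<close>

definition move :: "(circle \<Rightarrow> circle) \<Rightarrow> half \<times> half \<times> real \<Rightarrow> half \<times> half \<times> real" where
  "move f = (\<lambda>(u, v, l). (half_map f u, half_map f v, l * slope f u / slope f v))"

text \<open>The same gluing read from the other side: the chart is multiplied by
  \<open>-1 / l\<close>.\<close>

definition swap :: "half \<times> half \<times> real \<Rightarrow> half \<times> half \<times> real" where
  "swap = (\<lambda>(u, v, l). (v, u, 1 / l))"

text \<open>Both orders of the two sides of a point occur, so the set is closed under
  \<open>swap\<close>.\<close>

definition std_gluings :: "(half \<times> half \<times> real) set" where
  "std_gluings = range (\<lambda>u. (u, opp u, 1))"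

lemma fst_move: "fst (move f y) = half_map f (fst y)"
  by (simp add: move_def case_prod_beta)

lemma move_gluings: "PA f \<Longrightarrow> y \<in> gluings \<Longrightarrow> move f y \<in> gluings"
  by (auto simp: move_def gluings_def case_prod_beta slope_pos)

lemma move_swap: "move f (swap y) = swap (move f y)"
  by (simp add: move_def swap_def case_prod_beta)

lemma swap_swap [simp]: "swap (swap y) = y"
  by (simp add: swap_def case_prod_beta)

lemma move_comp:
  assumes "PA f" "PA g" shows "move (g \<circ> f) y = move g (move f y)"
  by (simp add: move_def case_prod_beta half_map_comp[OF assms])

lemma move_cong: "PA f \<Longrightarrow> pw_eq std_circle f g \<Longrightarrow> move g = move f"
  by (simp add: move_def half_map_cong)

lemma move_id: "move id y = y"
  by (simp add: move_def case_prod_beta half_map_id)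

lemma wf_std_circle: "wf_curve std_circle"
  by (rule wfI[OF affine_curve_std_circle])

lemma PA_comp: "PA f \<Longrightarrow> PA g \<Longrightarrow> PA (g \<circ> f)"
  by (rule pw_affine_comp[OF wf_std_circle wf_std_circle])

definition mutual_inverse :: "(circle \<Rightarrow> circle) \<Rightarrow> (circle \<Rightarrow> circle) \<Rightarrow> bool" where
  "mutual_inverse f g \<longleftrightarrow> PA f \<and> PA g \<and> pw_eq std_circle (g \<circ> f) id \<and> pw_eq std_circle (f \<circ> g) id"

lemma mutual_inverse_sym: "mutual_inverse f g \<Longrightarrow> mutual_inverse g f"
  by (simp add: mutual_inverse_def)

lemma mutual_inverseD:
  assumes "mutual_inverse f g"
  shows "half_map g (half_map f u) = u" "move g (move f y) = y"
proof -
  have f: "PA f" "PA g" "pw_eq std_circle (g \<circ> f) id" using assms by (auto simp: mutual_inverse_def)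
  show "half_map g (half_map f u) = u"
    using half_map_cong(1)[OF PA_comp[OF f(1,2)] f(3)] half_map_comp(1)[OF f(1,2), of u] half_map_id(1) by metis
  show "move g (move f y) = y"
    using move_cong[OF PA_comp[OF f(1,2)] f(3)] move_comp[OF f(1,2), of y] move_id by metis
qed

lemma mutual_inverse_exists:
  assumes "PA f" obtains g where "mutual_inverse f g"
proof -
  obtain g where "PA g" "pw_eq std_circle (g \<circ> f) id" "pw_eq std_circle (f \<circ> g) id"
    by (rule pw_affine_inverse[OF wf_std_circle wf_std_circle assms])
  then show thesis using that assms by (simp add: mutual_inverse_def)
qed

abbreviation "PC \<equiv> PC_Aff std_circle"

lemma PC_memD:
  assumes "A \<in> carrier PC" "f \<in> A" shows "PA f" "A = pw_class std_circle f"
proof -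
  obtain g where g: "PA g" "A = pw_class std_circle g"
    using assms(1) by (auto simp: PC_Aff_def pw_iso_def)
  then have e: "pw_eq std_circle g f" using assms(2) by (simp add: pw_class_def)
  show "PA f" by (rule pw_affine_eq[OF wf_std_circle g(1) e])
  show "A = pw_class std_circle f" using e g(2) by (simp add: pw_class_eq)
qed

definition rep_of :: "(circle \<Rightarrow> circle) set \<Rightarrow> circle \<Rightarrow> circle" where "rep_of A = (SOME f. f \<in> A)"

lemma rep_of_mem:
  assumes "A \<in> carrier PC" shows "rep_of A \<in> A"
proof -
  have "\<exists>f. f \<in> A" using assms by (auto simp: PC_Aff_def pw_iso_def pw_class_def intro: pw_eq_refl)
  then show ?thesis unfolding rep_of_def by (rule someI_ex)
qed

lemma move_rep_of:
  assumes "A \<in> carrier PC" "f \<in> A" shows "move (rep_of A) = move f"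
proof -
  have "pw_eq std_circle f (rep_of A)"
    using PC_memD(2)[OF assms] rep_of_mem[OF assms(1)] by (auto simp: pw_class_def)
  then show ?thesis by (rule move_cong[OF PC_memD(1)[OF assms]])
qed

text \<open>Restricted to \<open>gluings\<close> because the elements of \<open>BijGroup\<close> are
  extensional functions.\<close>

definition act :: "(circle \<Rightarrow> circle) set \<Rightarrow> half \<times> half \<times> real \<Rightarrow> half \<times> half \<times> real" where
  "act A = (\<lambda>y\<in>gluings. move (rep_of A) y)"

lemma group_action_act: "group_action PC gluings act"
  unfolding group_action_def group_hom_def group_hom_axioms_def
proof (intro conjI homI)
  show grp: "group PC" by (rule group_PC_Aff[OF affine_curve_std_circle])
  show "group (BijGroup gluings)" by (rule group_BijGroup)
  have Bij: "act A \<in> Bij gluings" if A: "A \<in> carrier PC" for A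
  proof -
    have f: "PA (rep_of A)" using PC_memD(1)[OF A rep_of_mem[OF A]] .
    obtain g where g: "mutual_inverse (rep_of A) g" using mutual_inverse_exists[OF f] .
    have "PA g" using g by (simp add: mutual_inverse_def)
    have "bij_betw (move (rep_of A)) gluings gluings"
      by (rule bij_betw_byWitness[where f' = "move g"])
        (use mutual_inverseD(2)[OF g] mutual_inverseD(2)[OF mutual_inverse_sym[OF g]]
          move_gluings[OF f] move_gluings[OF \<open>PA g\<close>] in auto)
    then have "bij_betw (act A) gluings gluings"
      by (rule bij_betw_cong[THEN iffD1, rotated]) (simp add: act_def)
    then show ?thesis by (simp add: Bij_def act_def)
  qed
  show "act A \<in> carrier (BijGroup gluings)" if "A \<in> carrier PC" for A
    using Bij[OF that] by (simp add: BijGroup_def)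
  show "act (A \<otimes>\<^bsub>PC\<^esub> B) = act A \<otimes>\<^bsub>BijGroup gluings\<^esub> act B"
    if AB: "A \<in> carrier PC" "B \<in> carrier PC" for A B
  proof -
    note fA = PC_memD[OF AB(1) rep_of_mem[OF AB(1)]] and fB = PC_memD[OF AB(2) rep_of_mem[OF AB(2)]]
    have "A \<otimes>\<^bsub>PC\<^esub> B = pw_comp std_circle A B" by (simp add: PC_Aff_def)
    also have "\<dots> = pw_class std_circle (rep_of A \<circ> rep_of B)"
      using pw_comp_class[OF wf_std_circle fB(1), of "rep_of A"] fA(2) fB(2) by metis
    finally have e: "A \<otimes>\<^bsub>PC\<^esub> B = pw_class std_circle (rep_of A \<circ> rep_of B)" .
    have "A \<otimes>\<^bsub>PC\<^esub> B \<in> carrier PC" using AB group.is_monoid[OF grp] monoid.m_closed by metis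
    moreover have "rep_of A \<circ> rep_of B \<in> A \<otimes>\<^bsub>PC\<^esub> B" unfolding e by (simp add: pw_class_def pw_eq_refl)
    ultimately have "move (rep_of (A \<otimes>\<^bsub>PC\<^esub> B)) = move (rep_of A \<circ> rep_of B)" by (rule move_rep_of)
    then have "act (A \<otimes>\<^bsub>PC\<^esub> B) = compose gluings (act A) (act B)"
      by (auto simp: act_def compose_def move_comp[OF fB(1) fA(1)] move_gluings[OF fB(1)])
    then show ?thesis using Bij[OF AB(1)] Bij[OF AB(2)] by (simp add: BijGroup_def)
  qed
qed

lemma move_std_gluings:
  assumes "PA f" "smooth f (fst u)" shows "move f (u, opp u, 1) \<in> std_gluings"
proof -
  have "half_map f (opp u) = opp (half_map f u)" "slope f (opp u) = slope f u"
    using smooth_half_map(2,3)[OF assms(2), of "snd u"] by (simp_all add: opp_def)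
  then have "move f (u, opp u, 1) = (half_map f u, opp (half_map f u), 1)"
    using slope_pos[OF assms(1), of u] by (simp add: move_def)
  then show ?thesis by (auto simp: std_gluings_def)
qed

lemma finite_half: "finite B \<Longrightarrow> finite {u :: half. fst u \<in> B}"
  by (rule finite_subset[of _ "B \<times> UNIV"]) auto

text \<open>A standard gluing can leave the set only at a point where the map is not smooth, and
  there are finitely many of these. Standard gluings outside the image are handled in the same way
  by the inverse map.\<close>

lemma commensurated_std_gluings: "commensurated PC act std_gluings"
  unfolding commensurated_def
proof
  fix A assume A: "A \<in> carrier PC"
  have f: "PA (rep_of A)" using PC_memD(1)[OF A rep_of_mem[OF A]] .
  obtain g where g: "mutual_inverse (rep_of A) g" using mutual_inverse_exists[OF f] .
  have "PA g" using g by (simp add: mutual_inverse_def)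
  have sub: "std_gluings \<subseteq> gluings" by (auto simp: std_gluings_def gluings_def)
  then have im: "act A ` std_gluings = move (rep_of A) ` std_gluings"
    by (intro image_cong) (auto simp: act_def)
  define N where "N h = (\<lambda>u. (u, opp u, 1::real)) ` {u. fst u \<in> {x. \<not> smooth h x}}" for h
  have N: "finite (N h)" if "PA h" for h
    unfolding N_def by (intro finite_imageI finite_half finite_not_smooth that)
  have mem: "move h y \<in> std_gluings" if "PA h" "y \<in> std_gluings" "y \<notin> N h" for h y
    using that move_std_gluings[OF that(1)] by (auto simp: std_gluings_def N_def)
  have "act A ` std_gluings - std_gluings \<subseteq> move (rep_of A) ` N (rep_of A)"
    unfolding im using mem[OF f] by blast
  moreover have "std_gluings - act A ` std_gluings \<subseteq> N g"
  proof
    fix y assume y: "y \<in> std_gluings - act A ` std_gluings"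
    have "move g y \<notin> std_gluings"
    proof
      assume "move g y \<in> std_gluings"
      then have "move (rep_of A) (move g y) \<in> act A ` std_gluings" unfolding im by blast
      then show False using y mutual_inverseD(2)[OF mutual_inverse_sym[OF g]] by simp
    qed
    then show "y \<in> N g" using mem[OF \<open>PA g\<close>] y by blast
  qed
  ultimately show "finite (sym_diff std_gluings (act A ` std_gluings))"
    using N[OF f] N[OF \<open>PA g\<close>] by (meson finite_UnI finite_imageI finite_subset)
qed

section \<open>Partial involutions with scales, extracted from an invariant set of gluings\<close>

definition gluing_data :: "half set \<Rightarrow> (half \<Rightarrow> half) \<Rightarrow> (half \<Rightarrow> real) \<Rightarrow> bool" where
  "gluing_data D p l \<longleftrightarrow>
     (\<forall>u\<in>D. p u \<in> D \<and> p (p u) = u \<and> p u \<noteq> u \<and> l u > 0 \<and> l (p u) = 1 / l u) \<and>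
     finite {u. \<not> (u \<in> D \<and> p u = opp u \<and> l u = 1)}"

text \<open>The last equation is the third component of \<open>move f (u, p u, l u)\<close>: the
  triples \<open>(u, p u, l u)\<close> with \<open>u\<close> in \<open>D\<close> are stable under
  \<open>move f\<close>.\<close>

definition gluing_invariant :: "half set \<Rightarrow> (half \<Rightarrow> half) \<Rightarrow> (half \<Rightarrow> real) \<Rightarrow> (circle \<Rightarrow> circle) \<Rightarrow> bool" where
  "gluing_invariant D p l f \<longleftrightarrow>
     (\<forall>u\<in>D. half_map f u \<in> D \<and> p (half_map f u) = half_map f (p u) \<and> l (half_map f u) = l u * slope f u / slope f (p u))"

text \<open>The discarding rule refers to \<open>M0\<close> and \<open>swap\<close> only, so it
  commutes with every \<open>move\<close> that preserves \<open>M0\<close> together with its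
  inverse. The standard pattern can fail at \<open>u\<close> only if \<open>u\<close> or
  \<open>opp u\<close> is the first component of a gluing in the symmetric difference.\<close>

lemma gluing_data_of_relation:
  assumes R0: "M0 \<subseteq> gluings" "finite (sym_diff std_gluings M0)"
  obtains D p l where "gluing_data D p l"
    "\<And>f g. mutual_inverse f g \<Longrightarrow> move f ` M0 \<subseteq> M0 \<Longrightarrow> move g ` M0 \<subseteq> M0 \<Longrightarrow> gluing_invariant D p l f"
proof -
  \<comment> \<open>Symmetry makes the partner map an involution, distinctness of the ends keeps it
    free of fixed points, and uniqueness at both ends makes it a function.\<close>
  define R where "R = {y \<in> M0. swap y \<in> M0 \<and> fst (swap y) \<noteq> fst y}"
  define Q where "Q y \<longleftrightarrow> (\<forall>z\<in>R. fst z = fst y \<longrightarrow> z = y)" for y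
  define M1 where "M1 = {y \<in> R. Q y \<and> Q (swap y)}"
  define D where "D = fst ` M1"
  define q where "q u = (SOME y. y \<in> M1 \<and> fst y = u)" for u
  define p where "p u = fst (snd (q u))" for u
  define l where "l u = snd (snd (q u))" for u
  have rvR: "swap y \<in> R" if "y \<in> R" for y using that by (auto simp: R_def)
  have rvM: "swap y \<in> M1" if "y \<in> M1" for y using that rvR by (auto simp: M1_def)
  have q: "q (fst y) = y" if "y \<in> M1" for y
  proof -
    have "q (fst y) \<in> M1 \<and> fst (q (fst y)) = fst y" unfolding q_def by (rule someI) (use that in blast)
    then show ?thesis using that by (auto simp: M1_def Q_def)
  qed
  have pl: "u \<in> D \<and> p u = v \<and> l u = m" if "(u, v, m) \<in> M1" for u v m
    using that q[OF that] unfolding p_def l_def D_def by force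
  have plD: "(u, p u, l u) \<in> M1" if "u \<in> D" for u
  proof -
    obtain y where y: "y \<in> M1" "fst y = u" using \<open>u \<in> D\<close> unfolding D_def by blast
    then have "(u, p u, l u) = y" using q[OF y(1)] by (cases y) (simp add: p_def l_def)
    then show ?thesis using y by simp
  qed
  have "gluing_data D p l"
    unfolding gluing_data_def
  proof (intro conjI ballI)
    fix u assume "u \<in> D"
    from plD[OF this] have y: "(u, p u, l u) \<in> M1" .
    then have "(p u, u, 1 / l u) \<in> M1" using rvM[OF y] by (simp add: swap_def)
    from pl[OF this] show "p u \<in> D" "p (p u) = u" "l (p u) = 1 / l u" by auto
    show "p u \<noteq> u" using y by (auto simp: M1_def R_def swap_def)
    show "l u > 0" using y R0(1) by (auto simp: M1_def R_def gluings_def)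
  next
    define B where "B = fst ` (std_gluings - M0) \<union> fst ` (M0 - std_gluings)"
    have "finite B" using R0(2) by (simp add: B_def)
    have in1: "(u, opp u, 1) \<in> M0" if "u \<notin> B" for u
    proof -
      have "(u, opp u, 1) \<in> std_gluings" by (simp add: std_gluings_def)
      then show ?thesis using that by (force simp: B_def)
    qed
    have Q1: "Q (u, opp u, 1)" if "u \<notin> B" for u
      unfolding Q_def
    proof (intro ballI impI)
      fix z assume z: "z \<in> R" "fst z = fst (u, opp u, 1::real)"
      then have "z \<in> std_gluings" using that by (force simp: B_def R_def)
      then show "z = (u, opp u, 1)" using z(2) by (auto simp: std_gluings_def)
    qed
    have "u \<in> D \<and> p u = opp u \<and> l u = 1" if "u \<notin> B" "opp u \<notin> B" for u
      by (rule pl) (use in1[OF that(1)] in1[OF that(2)] Q1[OF that(1)] Q1[OF that(2)] in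
          \<open>simp add: M1_def R_def swap_def\<close>)
    then have "{u. \<not> (u \<in> D \<and> p u = opp u \<and> l u = 1)} \<subseteq> B \<union> opp ` B"
      by (smt (verit) UnCI image_eqI mem_Collect_eq opp_simps(3) subsetI)
    then show "finite {u. \<not> (u \<in> D \<and> p u = opp u \<and> l u = 1)}"
      using \<open>finite B\<close> by (meson finite_UnI finite_imageI finite_subset)
  qed
  moreover have "gluing_invariant D p l f"
    if fg: "mutual_inverse f g" and fM: "move f ` M0 \<subseteq> M0" and gM: "move g ` M0 \<subseteq> M0" for f g
  proof -
    note gf = mutual_inverseD[OF fg] and fg' = mutual_inverseD[OF mutual_inverse_sym[OF fg]]
    have inv_R: "move h y \<in> R" if h: "mutual_inverse h k" "move h ` M0 \<subseteq> M0" and y: "y \<in> R" for h k y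
    proof -
      have "move h y \<in> M0" "move h (swap y) \<in> M0" using h y by (auto simp: R_def)
      moreover have "half_map h (fst (swap y)) \<noteq> half_map h (fst y)"
        using y mutual_inverseD(1)[OF h(1)] by (metis (mono_tags, lifting) R_def mem_Collect_eq)
      ultimately show ?thesis by (simp add: R_def fst_move flip: move_swap)
    qed
    have inv_Q: "Q (move f y)" if "Q y" for y
      unfolding Q_def
    proof (intro ballI impI)
      fix z assume z: "z \<in> R" "fst z = fst (move f y)"
      have "move g z \<in> R" by (rule inv_R[OF mutual_inverse_sym[OF fg] gM z(1)])
      moreover have "fst (move g z) = fst y" using z(2) gf(1) by (simp add: fst_move)
      ultimately have "move g z = y" using that by (simp add: Q_def)
      then show "z = move f y" using fg'(2) by metis
    qed
    have inv_M: "move f y \<in> M1" if "y \<in> M1" for y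
      using that inv_R[OF fg fM] inv_Q by (simp add: M1_def flip: move_swap)
    show ?thesis
      unfolding gluing_invariant_def
    proof
      fix u assume "u \<in> D"
      from inv_M[OF plD[OF this]] have "(half_map f u, half_map f (p u), l u * slope f u / slope f (p u)) \<in> M1"
        by (simp add: move_def)
      from pl[OF this] show "half_map f u \<in> D \<and> p (half_map f u) = half_map f (p u) \<and> l (half_map f u) = l u * slope f u / slope f (p u)"
        by simp
    qed
  qed
  ultimately show thesis using that by blast
qed

text \<open>The inverse is taken inside the classes of \<open>H\<close>, so that whatever is known
  for all members of \<open>\<Union>H\<close> applies to it as well.\<close>

lemma subgroup_mutual_inverse:
  assumes H: "subgroup H PC" and f: "f \<in> \<Union>H"
  obtains g where "g \<in> \<Union>H" "mutual_inverse f g"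
proof -
  obtain A where A: "A \<in> H" "f \<in> A" using f by blast
  have grp: "group PC" by (rule group_PC_Aff[OF affine_curve_std_circle])
  have Ac: "A \<in> carrier PC" using subgroup.subset[OF H] A(1) by blast
  define B where "B = inv\<^bsub>PC\<^esub> A"
  have BH: "B \<in> H" using subgroup.m_inv_closed[OF H A(1)] by (simp add: B_def)
  then have Bc: "B \<in> carrier PC" using subgroup.subset[OF H] by blast
  have "rep_of B \<in> B" by (rule rep_of_mem[OF Bc])
  note fA = PC_memD[OF Ac A(2)] and fB = PC_memD[OF Bc \<open>rep_of B \<in> B\<close>]
  have "pw_class std_circle (rep_of B \<circ> f) = B \<otimes>\<^bsub>PC\<^esub> A"
    using pw_comp_class[OF wf_std_circle fA(1), of "rep_of B"] fA(2) fB(2)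
    unfolding PC_Aff_def by simp
  also have "\<dots> = pw_class std_circle id"
    using group.l_inv[OF grp Ac] by (simp add: B_def PC_Aff_def)
  finally have 1: "pw_eq std_circle (rep_of B \<circ> f) id" by (simp add: pw_class_eq)
  have "pw_class std_circle (f \<circ> rep_of B) = A \<otimes>\<^bsub>PC\<^esub> B"
    using pw_comp_class[OF wf_std_circle fB(1), of f] fA(2) fB(2)
    unfolding PC_Aff_def by simp
  also have "\<dots> = pw_class std_circle id"
    using group.r_inv[OF grp Ac] by (simp add: B_def PC_Aff_def)
  finally have 2: "pw_eq std_circle (f \<circ> rep_of B) id" by (simp add: pw_class_eq)
  have "mutual_inverse f (rep_of B)" using 1 2 fA(1) fB(1) by (simp add: mutual_inverse_def)
  moreover have "rep_of B \<in> \<Union>H" using BH \<open>rep_of B \<in> B\<close> by blast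
  ultimately show thesis using that by blast
qed

lemma invariant_gluing_data:
  assumes H: "subgroup H PC" and FW: "relative_FW PC H"
  obtains D p l where "gluing_data D p l" "\<And>f. f \<in> \<Union>H \<Longrightarrow> gluing_invariant D p l f"
proof -
  have HG: "H \<subseteq> carrier PC" by (rule subgroup.subset[OF H])
  have "std_gluings \<subseteq> gluings" by (auto simp: std_gluings_def gluings_def)
  \<comment> \<open>Triples are not of the point type fixed in \<open>relative_FW\<close>, whence
    the version for arbitrary types.\<close>
  from relative_FW_all_types[OF FW HG group_action_act this commensurated_std_gluings]
  obtain M0 where M0: "M0 \<subseteq> gluings" "\<forall>A\<in>H. act A ` M0 = M0" "finite (sym_diff std_gluings M0)"
    by blast
  have inv: "move f ` M0 \<subseteq> M0" if f: "f \<in> \<Union>H" for f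
  proof -
    obtain A where A: "A \<in> H" "f \<in> A" using f by blast
    then have "move (rep_of A) = move f" using move_rep_of HG by blast
    then have "act A ` M0 = move f ` M0" using M0(1) by (intro image_cong) (auto simp: act_def)
    then show ?thesis using M0(2) A(1) by simp
  qed
  obtain D p l where D: "gluing_data D p l"
    "\<And>f g. mutual_inverse f g \<Longrightarrow> move f ` M0 \<subseteq> M0 \<Longrightarrow> move g ` M0 \<subseteq> M0 \<Longrightarrow> gluing_invariant D p l f"
    by (rule gluing_data_of_relation[OF M0(1,3)], rule that)
  have "gluing_invariant D p l f" if f: "f \<in> \<Union>H" for f
  proof -
    obtain g where "g \<in> \<Union>H" "mutual_inverse f g" using subgroup_mutual_inverse[OF H f] .
    then show ?thesis using D(2) inv f by blast
  qed
  from D(1) this show thesis by (rule that)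
qed

section \<open>The curve of a gluing\<close>

lemma ray_proj_path: obtains x where "\<And>t. ray w t = circle_proj (x + sg (snd w) * t)" "fst w = circle_proj x"
proof -
  obtain x b where "w = (circle_proj x, b)" by (rule half_cases)
  then show thesis using that[of x] by (simp add: ray_proj)
qed

lemma aparam_ray: "aparam std_circle (ray w)"
proof -
  obtain x where "\<And>t. ray w t = circle_proj (x + sg (snd w) * t)" "fst w = circle_proj x"
    by (rule ray_proj_path[of w], rule that)
  then have "ray w = (\<lambda>t. circle_proj (x + sg (snd w) * t))" by blast
  then show ?thesis using proj_path_aparam[of "sg (snd w)" x] by simp
qed

lemma rays_disjoint:
  assumes "w \<noteq> w'"
  shows "\<exists>e>0. \<forall>r s. 0 < r \<and> r < e \<and> 0 < s \<and> s < e \<longrightarrow> ray w r \<noteq> ray w' s"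
proof (cases "fst w = fst w'")
  case True
  then have w': "w' = opp w" using assms by (auto simp: opp_def prod_eq_iff)
  \<comment> \<open>Opposite rays at one point are at parameter distance \<open>r + s\<close>, which
    stays below the length 1 of the circle.\<close>
  have "ray w r \<noteq> ray w' s" if "0 < r" "r < 1/2" "0 < s" "s < 1/2" for r s
    unfolding w' ray_opp by (rule ray_neq) (use that in auto)
  then show ?thesis by (intro exI[of _ "1/2"]) auto
next
  case False
  have "Hausdorff_space (ctop std_circle)" using affine_curve_std_circle by (simp add: affine_curve_def)
  then obtain U V where U: "openin (ctop std_circle) U" "openin (ctop std_circle) V"
    "fst w \<in> U" "fst w' \<in> V" "disjnt U V"
    using False unfolding Hausdorff_space_def by force
  obtain d where d: "d > 0" "\<And>t. \<bar>t\<bar> < d \<Longrightarrow> ray w t \<in> U"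
    by (rule aparam_eventually_in[OF wf_std_circle aparam_ray U(1)]) (use U in auto)
  obtain e where e: "e > 0" "\<And>t. \<bar>t\<bar> < e \<Longrightarrow> ray w' t \<in> V"
    by (rule aparam_eventually_in[OF wf_std_circle aparam_ray U(2)]) (use U in auto)
  have "ray w r \<noteq> ray w' s" if "0 < r" "r < min d e" "0 < s" "s < min d e" for r s
    using d(2)[of r] e(2)[of s] that U(5) by (auto simp: disjnt_iff)
  then show ?thesis using d e by (intro exI[of _ "min d e"]) auto
qed

text \<open>Points of the new curve are the labels \<open>\<kappa> u\<close>, one for each glued
  pair. The labelling is a parameter because it is instantiated both by an arbitrary injective
  choice of labels for the pairs and by \<open>fst\<close>, where the new points are points of the
  circle itself.\<close>

locale gluing =
  fixes D :: "half set" and p :: "half \<Rightarrow> half" and l :: "half \<Rightarrow> real" and \<kappa> :: "half \<Rightarrow> 'a"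
  assumes data: "gluing_data D p l"
    and \<kappa>_eq: "u \<in> D \<Longrightarrow> v \<in> D \<Longrightarrow> \<kappa> u = \<kappa> v \<longleftrightarrow> v = u \<or> v = p u"
begin

lemma p_D: "u \<in> D \<Longrightarrow> p u \<in> D" and p_p: "u \<in> D \<Longrightarrow> p (p u) = u" and p_neq: "u \<in> D \<Longrightarrow> p u \<noteq> u"
  and l_pos: "u \<in> D \<Longrightarrow> l u > 0" and l_p: "u \<in> D \<Longrightarrow> l (p u) = 1 / l u"
  using data by (auto simp: gluing_data_def)

text \<open>At these points the new curve looks exactly like the standard circle.\<close>

definition "good x \<longleftrightarrow> (\<forall>b. (x, b) \<in> D \<and> p (x, b) = (x, \<not> b) \<and> l (x, b) = 1)"

lemma finite_bad: "finite {x. \<not> good x}"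
proof -
  let ?B = "{u. \<not> (u \<in> D \<and> p u = opp u \<and> l u = 1)}"
  have "{x. \<not> good x} \<subseteq> fst ` ?B"
  proof
    fix x assume "x \<in> {x. \<not> good x}"
    then obtain b where "(x, b) \<in> ?B" by (auto simp: good_def)
    then show "x \<in> fst ` ?B" by (rule rev_image_eqI) simp
  qed
  moreover have "finite ?B" using data by (simp add: gluing_data_def)
  ultimately show ?thesis by (meson finite_imageI finite_subset)
qed

lemma goodD: "good (fst u) \<Longrightarrow> u \<in> D \<and> p u = opp u \<and> l u = 1"
  by (cases u) (auto simp: good_def)

definition "\<phi> x = \<kappa> (x, True)"

lemma \<phi>_good: assumes "good (fst u)" shows "\<kappa> u = \<phi> (fst u)"
proof -
  have "(fst u, True) \<in> D" "p (fst u, True) = (fst u, False)" using goodD[of "(fst u, True)"] assms by auto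
  moreover have "u = (fst u, True) \<or> u = (fst u, False)" by (cases u) auto
  moreover have "u \<in> D" using goodD assms by blast
  ultimately show ?thesis using \<kappa>_eq[of "(fst u, True)" u] by (metis \<phi>_def)
qed

lemma \<phi>_fst:
  assumes "good x" "w \<in> D" "\<kappa> w = \<phi> x" shows "fst w = x"
proof -
  have "(x, True) \<in> D" "p (x, True) = (x, False)" using goodD[of "(x, True)"] assms(1) by auto
  then have "w = (x, True) \<or> w = (x, False)" using \<kappa>_eq[of "(x, True)" w] assms by (simp add: \<phi>_def)
  then show ?thesis by auto
qed

lemma \<phi>_inj: "good x \<Longrightarrow> good y \<Longrightarrow> \<phi> x = \<phi> y \<Longrightarrow> x = y"
  using \<phi>_fst[of y "(x, True)"] goodD[of "(x, True)"] by (simp add: \<phi>_def)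

text \<open>At time 0 the label of \<open>w\<close> itself is needed, since the two sides of
  \<open>fst w\<close> may belong to different new points; for short positive times the points are
  good and \<open>\<phi>\<close> applies.\<close>

definition "half_path w r = (if r = 0 then \<kappa> w else \<phi> (ray w r))"

text \<open>The inverse of the chart that belongs to the triple
  \<open>(u, p u, l u)\<close>.\<close>

definition "\<gamma> u t = (if t \<le> 0 then half_path u (- t) else half_path (p u) (t / l u))"

lemma \<gamma>_0 [simp]: "\<gamma> u 0 = \<kappa> u"
  by (simp add: \<gamma>_def half_path_def)

lemma half_path_sep:
  assumes w: "w \<in> D" "w' \<in> D"
  shows "\<exists>e>0. \<forall>r s. 0 \<le> r \<and> r < e \<and> 0 \<le> s \<and> s < e \<and> half_path w r = half_path w' s \<longrightarrow>
    r = s \<and> (if r = 0 then \<kappa> w = \<kappa> w' else w = w')"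
proof -
  \<comment> \<open>The two base points are avoided as well: if one path started on the other at a
    good point, the half-point at its start would lie over that point.\<close>
  let ?B = "{x. \<not> good x} \<union> {fst w, fst w'}"
  have B: "finite ?B" using finite_bad by simp
  obtain d where d: "d > 0" "\<And>t. 0 < t \<Longrightarrow> t < d \<Longrightarrow> ray w t \<notin> ?B" by (rule ray_avoids[OF B], rule that)
  obtain d' where d': "d' > 0" "\<And>t. 0 < t \<Longrightarrow> t < d' \<Longrightarrow> ray w' t \<notin> ?B" by (rule ray_avoids[OF B], rule that)
  obtain d2 where d2: "d2 > 0" "w \<noteq> w' \<Longrightarrow> 0 < r \<Longrightarrow> r < d2 \<Longrightarrow> 0 < s \<Longrightarrow> s < d2 \<Longrightarrow> ray w r \<noteq> ray w' s" for r s
    using rays_disjoint[of w w'] by (cases "w = w'") (auto intro: that[of 1])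
  define e where "e = min (min d d') (min d2 1)"
  have e: "e > 0" "e \<le> d" "e \<le> d'" "e \<le> d2" "e \<le> 1" using d d' d2 by (auto simp: e_def)
  have "r = s \<and> (if r = 0 then \<kappa> w = \<kappa> w' else w = w')"
    if rs: "0 \<le> r" "r < e" "0 \<le> s" "s < e" and eq: "half_path w r = half_path w' s" for r s
  proof (cases "r = 0"; cases "s = 0")
    assume "r = 0" "s = 0" then show ?thesis using eq by (simp add: half_path_def)
  next
    assume "r = 0" "s \<noteq> 0"
    then have s: "ray w' s \<notin> ?B" "\<kappa> w = \<phi> (ray w' s)" using d'(2)[of s] rs e eq by (auto simp: half_path_def)
    then have "fst w = ray w' s" using \<phi>_fst w by blast
    then show ?thesis using s by simp
  next
    assume "r \<noteq> 0" "s = 0"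
    then have s: "ray w r \<notin> ?B" "\<kappa> w' = \<phi> (ray w r)" using d(2)[of r] rs e eq by (auto simp: half_path_def)
    then have "fst w' = ray w r" using \<phi>_fst w by blast
    then show ?thesis using s by simp
  next
    assume n: "r \<noteq> 0" "s \<noteq> 0"
    then have "ray w r \<notin> ?B" "ray w' s \<notin> ?B" "\<phi> (ray w r) = \<phi> (ray w' s)"
      using d(2)[of r] d'(2)[of s] rs e eq by (auto simp: half_path_def)
    then have req: "ray w r = ray w' s" using \<phi>_inj by blast
    then have ww: "w = w'" using d2(2)[of r s] rs n e by auto
    have "\<bar>r - s\<bar> < 1" using rs e(5) by linarith
    then have "r = s" using ray_neq[of r s w] req ww by auto
    then show ?thesis using ww n by simp
  qed
  then show ?thesis using e(1) by blast
qed

lemma \<gamma>_half: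
  assumes u: "u \<in> D"
  obtains w r where "w \<in> D" "\<kappa> w = \<kappa> u" "\<gamma> u t = half_path w r" "r = (if t \<le> 0 then - t else t / l u)"
    "w = (if t \<le> 0 then u else p u)" "0 \<le> r"
proof -
  have "\<kappa> (p u) = \<kappa> u" using \<kappa>_eq[OF u p_D[OF u]] by simp
  then show thesis
    using that[of "if t \<le> 0 then u else p u" "if t \<le> 0 then - t else t / l u"] u p_D[OF u] l_pos[OF u]
    by (auto simp: \<gamma>_def)
qed

text \<open>Serves twice: for \<open>u = v\<close> it makes the chart injective, and for different
  labels it separates the points.\<close>

lemma \<gamma>_sep:
  assumes u: "u \<in> D" "v \<in> D"
  shows "\<exists>e>0. \<forall>s t. \<bar>s\<bar> < e \<and> \<bar>t\<bar> < e \<and> \<gamma> u s = \<gamma> v t \<longrightarrow> \<kappa> u = \<kappa> v \<and> (u = v \<longrightarrow> s = t)"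
proof -
  obtain e where e: "\<And>w w'. w \<in> {u, p u} \<Longrightarrow> w' \<in> {v, p v} \<Longrightarrow> e w w' > 0 \<and>
    (\<forall>r s. 0 \<le> r \<and> r < e w w' \<and> 0 \<le> s \<and> s < e w w' \<and> half_path w r = half_path w' s \<longrightarrow>
    r = s \<and> (if r = 0 then \<kappa> w = \<kappa> w' else w = w'))"
  proof -
    have "\<exists>e>0. \<forall>r s. 0 \<le> r \<and> r < e \<and> 0 \<le> s \<and> s < e \<and> half_path w r = half_path w' s \<longrightarrow>
      r = s \<and> (if r = 0 then \<kappa> w = \<kappa> w' else w = w')" if "w \<in> {u, p u}" "w' \<in> {v, p v}" for w w'
      using half_path_sep[of w w'] that u p_D by blast
    then show thesis using that by metis
  qed
  define e0 where "e0 = min (min (e u v) (e u (p v))) (min (e (p u) v) (e (p u) (p v)))"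
  have e0: "e0 > 0" "\<And>w w'. w \<in> {u, p u} \<Longrightarrow> w' \<in> {v, p v} \<Longrightarrow> e0 \<le> e w w'"
  proof -
    have "e u v > 0" "e u (p v) > 0" "e (p u) v > 0" "e (p u) (p v) > 0" using e by blast+
    then show "e0 > 0" by (simp add: e0_def)
    show "e0 \<le> e w w'" if "w \<in> {u, p u}" "w' \<in> {v, p v}" for w w'
      using that by (auto simp: e0_def)
  qed
  define d where "d = min e0 (min (e0 * l u) (e0 * l v))"
  have lp: "l u > 0" "l v > 0" using l_pos u by auto
  have "d > 0" using e0 lp by (simp add: d_def)
  moreover have "\<kappa> u = \<kappa> v \<and> (u = v \<longrightarrow> s = t)" if st: "\<bar>s\<bar> < d" "\<bar>t\<bar> < d" and eq: "\<gamma> u s = \<gamma> v t" for s t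
  proof -
    obtain w r where w: "w \<in> D" "\<kappa> w = \<kappa> u" "\<gamma> u s = half_path w r" "r = (if s \<le> 0 then - s else s / l u)"
      "w = (if s \<le> 0 then u else p u)" "0 \<le> r" by (rule \<gamma>_half[OF u(1), of s], rule that)
    obtain w' r' where w': "w' \<in> D" "\<kappa> w' = \<kappa> v" "\<gamma> v t = half_path w' r'" "r' = (if t \<le> 0 then - t else t / l v)"
      "w' = (if t \<le> 0 then v else p v)" "0 \<le> r'" by (rule \<gamma>_half[OF u(2), of t], rule that)
    have W: "w \<in> {u, p u}" "w' \<in> {v, p v}" using w w' by auto
    have "r < e0" "r' < e0" using w(4) w'(4) st lp by (auto simp: d_def pos_divide_less_eq)
    then have "r < e w w'" "r' < e w w'" using e0(2)[OF W] by auto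
    then have "0 \<le> r \<and> r < e w w' \<and> 0 \<le> r' \<and> r' < e w w' \<and> half_path w r = half_path w' r'"
      using w(3,6) w'(3,6) eq by simp
    then have *: "r = r'" "if r = 0 then \<kappa> w = \<kappa> w' else w = w'"
      using conjunct2[OF e[OF W], THEN spec, THEN spec, THEN mp] by blast+
    then have "\<kappa> w = \<kappa> w'" by (cases "r = 0") auto
    then have "\<kappa> u = \<kappa> v" using w(2) w'(2) by simp
    moreover have "s = t" if "u = v"
    proof (cases "r = 0")
      case True
      then have "s = 0" "t = 0" using w(4) w'(4) *(1) lp by (auto split: if_splits)
      then show ?thesis by simp
    next
      case False
      then have "w = w'" using * by simp
      then have "(s \<le> 0) = (t \<le> 0)" using w(5) w'(5) that p_neq[OF u(1)] by (metis)
      then show ?thesis using w(4) w'(4) *(1) lp that by (auto split: if_splits)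
    qed
    ultimately show ?thesis by blast
  qed
  ultimately show ?thesis by blast
qed

text \<open>Goodness of all points other than the centre ensures that the paths centred at them are
  rays of the standard circle.\<close>

definition "eps u = (SOME e. e > 0 \<and> inj_on (\<gamma> u) {-e<..<e} \<and>
  (\<forall>t. 0 < t \<and> t < e \<longrightarrow> good (ray u t) \<and> good (ray (p u) (t / l u))))"

lemma eps:
  assumes u: "u \<in> D"
  shows "eps u > 0" "inj_on (\<gamma> u) {-eps u<..<eps u}"
    "\<And>t. 0 < t \<Longrightarrow> t < eps u \<Longrightarrow> good (ray u t)"
    "\<And>t. 0 < t \<Longrightarrow> t < eps u \<Longrightarrow> good (ray (p u) (t / l u))"
proof -
  obtain e where e: "e > 0" "\<And>s t. \<bar>s\<bar> < e \<Longrightarrow> \<bar>t\<bar> < e \<Longrightarrow> \<gamma> u s = \<gamma> u t \<Longrightarrow> s = t"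
    using \<gamma>_sep[OF u u] by blast
  obtain d where d: "d > 0" "\<And>t. 0 < t \<Longrightarrow> t < d \<Longrightarrow> ray u t \<notin> {x. \<not> good x}"
    by (rule ray_avoids[OF finite_bad], rule that)
  obtain d' where d': "d' > 0" "\<And>t. 0 < t \<Longrightarrow> t < d' \<Longrightarrow> ray (p u) t \<notin> {x. \<not> good x}"
    by (rule ray_avoids[OF finite_bad], rule that)
  define m where "m = min e (min d (d' * l u))"
  have lp: "l u > 0" using l_pos u by auto
  have m: "m > 0" "m \<le> e" "m \<le> d" "m \<le> d' * l u" using e d d' lp by (auto simp: m_def)
  have "inj_on (\<gamma> u) {-m<..<m}" using e(2) m(2) by (intro inj_onI) auto
  moreover have "good (ray u t) \<and> good (ray (p u) (t / l u))" if "0 < t" "t < m" for t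
    using d(2)[of t] d'(2)[of "t / l u"] that m lp by (auto simp: pos_divide_less_eq)
  ultimately have "\<exists>e. e > 0 \<and> inj_on (\<gamma> u) {-e<..<e} \<and>
    (\<forall>t. 0 < t \<and> t < e \<longrightarrow> good (ray u t) \<and> good (ray (p u) (t / l u)))" using m(1) by blast
  from someI_ex[OF this, folded eps_def]
  show "eps u > 0" "inj_on (\<gamma> u) {-eps u<..<eps u}"
    "\<And>t. 0 < t \<Longrightarrow> t < eps u \<Longrightarrow> good (ray u t)"
    "\<And>t. 0 < t \<Longrightarrow> t < eps u \<Longrightarrow> good (ray (p u) (t / l u))" by auto
qed

lemma \<gamma>_good:
  assumes "good (fst u)" shows "\<gamma> u t = \<phi> (ray (opp u) t)"
proof -
  have u: "p u = opp u" "l u = 1" "\<kappa> u = \<phi> (fst u)" using goodD \<phi>_good assms by auto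
  show ?thesis using u by (auto simp: \<gamma>_def half_path_def ray_opp)
qed

lemma ray_turn: "ray (x, b) t = ray (x, c) ((if b = c then 1 else -1) * t)"
  using ray_opp[of "(x, c)" t] by (cases "b = c") (auto simp: opp_def)

lemma \<gamma>_p:
  assumes u: "u \<in> D" shows "\<gamma> (p u) t = \<gamma> u (- l u * t)"
proof -
  have lp: "l u > 0" "l (p u) = 1 / l u" "p (p u) = u" using l_pos l_p p_p u by auto
  have k: "\<kappa> (p u) = \<kappa> u" using \<kappa>_eq[OF u p_D[OF u]] by simp
  consider "t < 0" | "t = 0" | "t > 0" by linarith
  then show ?thesis
  proof cases
    case 1
    then have "\<not> - l u * t \<le> 0" using lp(1) by (simp add: mult_less_0_iff not_le)
    then show ?thesis using 1 lp by (simp add: \<gamma>_def)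
  next
    case 2
    then show ?thesis using k by simp
  next
    case 3
    then have "- l u * t \<le> 0" using lp(1) by simp
    then show ?thesis using 3 lp by (simp add: \<gamma>_def mult.commute)
  qed
qed

text \<open>At the centre only \<open>u\<close> and \<open>p u\<close> are possible, and their paths
  differ by the factor \<open>- l u\<close>. Elsewhere the point is good, so the path centred there
  is an ordinary ray through it; the sign \<open>a\<close> records whether it runs with or against
  the given path.\<close>

lemma \<gamma>_shift:
  assumes u: "u \<in> D" and v: "v \<in> D" and s: "\<bar>s\<bar> < eps u" and eq: "\<gamma> v 0 = \<gamma> u s"
  shows "\<exists>a \<delta>. a \<noteq> 0 \<and> \<delta> > 0 \<and> (\<forall>t. \<bar>t\<bar> < \<delta> \<longrightarrow> \<gamma> v t = \<gamma> u (s + a * t))"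
proof -
  note e = eps[OF u]
  have lp: "l u > 0" using l_pos u by auto
  consider "s = 0" | "s < 0" | "s > 0" by linarith
  then show ?thesis
  proof cases
    case 1
    then have "v = u \<or> v = p u" using eq \<kappa>_eq[OF u v] by simp
    then show ?thesis
    proof
      assume "v = u" then show ?thesis using 1 by (intro exI[of _ 1]) auto
    next
      assume "v = p u" then show ?thesis using 1 \<gamma>_p[OF u] lp by (intro exI[of _ "- l u"] exI[of _ 1]) auto
    qed
  next
    case 2
    define y where "y = ray u (- s)"
    have y: "good y" using e(3)[of "-s"] 2 s by (simp add: y_def)
    have "\<kappa> v = \<phi> y" using eq 2 by (simp add: \<gamma>_def half_path_def y_def)
    then have v: "v = (y, snd v)" using \<phi>_fst[OF y assms(2)] by (simp add: prod_eq_iff)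
    define a :: real where "a = (if (\<not> snd v) = (\<not> snd u) then 1 else -1)"
    have "\<gamma> v t = \<gamma> u (s + a * t)" if "\<bar>t\<bar> < - s" for t
    proof -
      have "\<bar>a * t\<bar> < - s" using that by (simp add: a_def)
      then have neg: "s + a * t < 0" by linarith
      have "\<gamma> v t = \<phi> (ray (y, \<not> snd v) t)" using \<gamma>_good[of v t] v y by (metis fst_conv opp_def)
      also have "ray (y, \<not> snd v) t = ray (y, \<not> snd u) (a * t)" unfolding a_def by (rule ray_turn)
      also have "\<dots> = ray u (- s - a * t)" unfolding y_def by (rule ray_back)
      also have "\<phi> \<dots> = \<gamma> u (s + a * t)" using neg by (simp add: \<gamma>_def half_path_def)
      finally show ?thesis .
    qed
    moreover have "a \<noteq> 0" by (simp add: a_def)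
    moreover have "- s > 0" using 2 by simp
    ultimately show ?thesis by blast
  next
    case 3
    define y where "y = ray (p u) (s / l u)"
    have y: "good y" using e(4)[of s] 3 s by (simp add: y_def)
    have "\<kappa> v = \<phi> y" using eq 3 lp by (simp add: \<gamma>_def half_path_def y_def)
    then have v: "v = (y, snd v)" using \<phi>_fst[OF y assms(2)] by (simp add: prod_eq_iff)
    define a :: real where "a = (if (\<not> snd v) = snd (p u) then 1 else -1)"
    have "\<gamma> v t = \<gamma> u (s + a * l u * t)" if "\<bar>t\<bar> < s / l u" for t
    proof -
      have "\<bar>a * l u * t\<bar> < s" using that lp by (simp add: a_def abs_mult pos_less_divide_eq mult.commute)
      then have pos: "s + a * l u * t > 0" by linarith
      have "\<gamma> v t = \<phi> (ray (y, \<not> snd v) t)" using \<gamma>_good[of v t] v y by (metis fst_conv opp_def)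
      also have "ray (y, \<not> snd v) t = ray (y, snd (p u)) (a * t)" unfolding a_def by (rule ray_turn)
      also have "\<dots> = ray (p u) (s / l u + a * t)" unfolding y_def by (rule ray_ray)
      also have "s / l u + a * t = (s + a * l u * t) / l u" using lp by (simp add: field_simps)
      also have "\<phi> (ray (p u) ((s + a * l u * t) / l u)) = \<gamma> u (s + a * l u * t)" using pos lp by (simp add: \<gamma>_def half_path_def)
      finally show ?thesis .
    qed
    moreover have "a * l u \<noteq> 0" using lp by (simp add: a_def)
    moreover have "s / l u > 0" using 3 lp by simp
    ultimately show ?thesis by blast
  qed
qed

sublocale param_curve D \<gamma> eps
proof
  fix u assume u: "u \<in> D"
  show "eps u > 0" "inj_on (\<gamma> u) {-eps u<..<eps u}" using eps[OF u] by auto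
  show "\<exists>v\<in>D. \<gamma> v 0 = \<gamma> u s" if s: "\<bar>s\<bar> < eps u" for s
  proof -
    have "\<exists>y. good y \<and> \<gamma> u s = \<phi> y" if "s \<noteq> 0"
      using that s eps(3)[OF u, of "-s"] eps(4)[OF u, of s] l_pos[OF u]
      by (cases "s < 0") (auto simp: \<gamma>_def half_path_def)
    moreover have "\<exists>v\<in>D. \<gamma> v 0 = \<phi> y" if "good y" for y
      using goodD[of "(y, True)"] that by (intro bexI[of _ "(y, True)"]) (auto simp: \<phi>_def)
    ultimately show ?thesis using u by (cases "s = 0") auto
  qed
  fix v assume v: "v \<in> D"
  show "\<exists>a \<delta>. a \<noteq> 0 \<and> \<delta> > 0 \<and> (\<forall>t. \<bar>t\<bar> < \<delta> \<longrightarrow> \<gamma> v t = \<gamma> u (s + a * t))"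
    if "\<bar>s\<bar> < eps u" "\<gamma> v 0 = \<gamma> u s" for s
    by (rule \<gamma>_shift[OF u v that])
  show "\<exists>\<delta>>0. \<forall>s t. \<bar>s\<bar> < \<delta> \<longrightarrow> \<bar>t\<bar> < \<delta> \<longrightarrow> \<gamma> u s \<noteq> \<gamma> v t" if "\<gamma> u 0 \<noteq> \<gamma> v 0"
    using \<gamma>_sep[OF u v] that by (simp; blast)
qed

lemma P_eq: "P = \<kappa> ` D"
  by (simp add: P_def)

text \<open>At good points the paths \<open>\<gamma>\<close> are images of rays. The labels missed
  by good points belong to the finitely many half-points over bad ones.\<close>

lemma pw_affine_\<phi>: "pw_affine std_circle X \<phi>"
proof -
  let ?F = "{x. \<not> good x}" and ?F' = "points X - \<phi> ` {x. good x}"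
  have sub: "\<phi> ` {x. good x} \<subseteq> points X"
    unfolding points_X P_eq using goodD by (auto simp: \<phi>_def)
  have "?F' \<subseteq> \<kappa> ` {u. fst u \<in> ?F}"
    unfolding points_X P_eq using \<phi>_good by auto
  then have F': "finite ?F'" using finite_half[OF finite_bad] by (meson finite_imageI finite_subset)
  have "affine_iso (remove ?F std_circle) (remove ?F' X) \<phi>"
  proof (rule affine_iso_aparamI[OF affine_curve_std_circle affine_curve_X finite_bad F'])
    have "points X - ?F' = \<phi> ` {x. good x}" using sub by blast
    moreover have "inj_on \<phi> {x. good x}" using \<phi>_inj by (auto intro: inj_onI)
    moreover have "points std_circle - ?F = {x. good x}" by auto
    ultimately show "bij_betw \<phi> (points std_circle - ?F) (points X - ?F')"
      by (simp add: bij_betw_def)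
    fix x assume "x \<in> points std_circle - ?F"
    then have x: "good x" by simp
    have "\<phi> \<circ> ray (opp (x, True)) = \<gamma> (x, True)" using \<gamma>_good[of "(x, True)"] x by (simp add: fun_eq_iff)
    moreover have "(x, True) \<in> D" using goodD[of "(x, True)"] x by simp
    ultimately have "aparam X (\<phi> \<circ> ray (opp (x, True)))" using aparam_X by simp
    then show "\<exists>g. aparam std_circle g \<and> g 0 = x \<and> aparam X (\<phi> \<circ> g)"
      using aparam_ray[of "opp (x, True)"] by (intro exI[of _ "ray (opp (x, True))"]) simp
  qed
  then show ?thesis unfolding pw_affine_def using finite_bad F'
    by (intro exI[of _ ?F] exI[of _ ?F']) auto
qed

section \<open>The automorphism of the glued curve induced by an invariant map\<close>

definition "lift f z = \<kappa> (half_map f (SOME u. u \<in> D \<and> \<kappa> u = z))"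

text \<open>The choice in \<open>lift\<close> does not matter: by invariance the images of
  \<open>u\<close> and \<open>p u\<close> form a pair again.\<close>

lemma lift_\<kappa>:
  assumes inv: "gluing_invariant D p l f" and u: "u \<in> D"
  shows "lift f (\<kappa> u) = \<kappa> (half_map f u)"
proof -
  define w where "w = (SOME v. v \<in> D \<and> \<kappa> v = \<kappa> u)"
  have w: "w \<in> D \<and> \<kappa> w = \<kappa> u" unfolding w_def by (rule someI[of _ u]) (use u in simp)
  then have "w = u \<or> w = p u" using \<kappa>_eq[OF u, of w] by auto
  moreover have "\<kappa> (half_map f (p u)) = \<kappa> (half_map f u)"
    using inv u \<kappa>_eq[of "half_map f u" "half_map f (p u)"] p_D[OF u] by (auto simp: gluing_invariant_def)
  ultimately show ?thesis by (auto simp: lift_def simp flip: w_def)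
qed

lemma lift_\<phi>:
  assumes inv: "gluing_invariant D p l f" and x: "good x" "smooth f x" "good (f x)"
  shows "lift f (\<phi> x) = \<phi> (f x)"
proof -
  have "lift f (\<phi> x) = \<kappa> (half_map f (x, True))"
    unfolding \<phi>_def by (rule lift_\<kappa>[OF inv]) (use goodD[of "(x, True)"] x in simp)
  also have "\<dots> = \<phi> (f x)"
    using \<phi>_good[of "half_map f (x, True)"] smooth_half_map(1)[OF x(2)] x(3) by simp
  finally show ?thesis .
qed

lemma lift_half_path:
  assumes f: "PA f" and inv: "gluing_invariant D p l f" and w: "w \<in> D"
  shows "\<exists>e>0. \<forall>r. 0 \<le> r \<and> r < e \<longrightarrow> lift f (half_path w r) = half_path (half_map f w) (slope f w * r)"
proof -
  let ?B = "{x. \<not> good x} \<union> {x. \<not> smooth f x}"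
  have B: "finite ?B" using finite_bad finite_not_smooth[OF f] by simp
  obtain d where d: "d > 0" "\<And>t. 0 < t \<Longrightarrow> t < d \<Longrightarrow> ray w t \<notin> ?B" by (rule ray_avoids[OF B], rule that)
  obtain d' where d': "d' > 0" "\<And>t. 0 < t \<Longrightarrow> t < d' \<Longrightarrow> ray (half_map f w) t \<notin> {x. \<not> good x}"
    by (rule ray_avoids[OF finite_bad], rule that)
  obtain c where c: "c > 0" "\<forall>t. 0 < t \<and> t < c \<longrightarrow> f (ray w t) = ray (half_map f w) (slope f w * t)"
    using germ_half_map[OF f, of w] unfolding germ_def by blast
  have a: "slope f w > 0" by (rule slope_pos[OF f])
  define e where "e = min (min c d) (d' / slope f w)"
  have e: "e > 0" using c d d' a by (simp add: e_def)
  have "lift f (half_path w r) = half_path (half_map f w) (slope f w * r)" if r: "0 \<le> r" "r < e" for r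
  proof (cases "r = 0")
    case True
    then show ?thesis using lift_\<kappa>[OF inv w] by (simp add: half_path_def)
  next
    case False
    then have r0: "0 < r" "r < c" "r < d" "slope f w * r < d'" "0 < slope f w * r"
      using r a by (auto simp: e_def pos_less_divide_eq mult.commute)
    have fr: "f (ray w r) = ray (half_map f w) (slope f w * r)" using c(2) r0 by blast
    have "lift f (\<phi> (ray w r)) = \<phi> (f (ray w r))"
      by (rule lift_\<phi>[OF inv]) (use d(2)[of r] d'(2)[of "slope f w * r"] r0 fr in auto)
    then show ?thesis using False a fr by (simp add: half_path_def)
  qed
  then show ?thesis using e by blast
qed

lemma lift_\<gamma>:
  assumes f: "PA f" and inv: "gluing_invariant D p l f" and u: "u \<in> D"
  shows "\<exists>e>0. \<forall>t. \<bar>t\<bar> < e \<longrightarrow> lift f (\<gamma> u t) = \<gamma> (half_map f u) (slope f u * t)"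
proof -
  obtain d where d: "d > 0" "\<forall>r. 0 \<le> r \<and> r < d \<longrightarrow> lift f (half_path u r) = half_path (half_map f u) (slope f u * r)"
    using lift_half_path[OF f inv u] by blast
  obtain d' where d': "d' > 0" "\<forall>r. 0 \<le> r \<and> r < d' \<longrightarrow> lift f (half_path (p u) r) = half_path (half_map f (p u)) (slope f (p u) * r)"
    using lift_half_path[OF f inv p_D[OF u]] by blast
  have lp: "l u > 0" "slope f u > 0" "slope f (p u) > 0" using l_pos u slope_pos[OF f] by auto
  have i: "p (half_map f u) = half_map f (p u)" "l (half_map f u) = l u * slope f u / slope f (p u)"
    using inv u by (auto simp: gluing_invariant_def)
  have "lift f (\<gamma> u t) = \<gamma> (half_map f u) (slope f u * t)" if t: "\<bar>t\<bar> < min d (d' * l u)" for t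
  proof (cases "t \<le> 0")
    case True
    moreover have "slope f u * t \<le> 0" using True lp by (simp add: mult_nonneg_nonpos)
    ultimately show ?thesis using d(2)[rule_format, of "-t"] t by (simp add: \<gamma>_def)
  next
    case False
    then have "0 \<le> t / l u" "t / l u < d'" using t lp by (auto simp: pos_divide_less_eq)
    moreover have "\<not> slope f u * t \<le> 0" using False lp by (simp add: not_le)
    \<comment> \<open>The transformation rule for scales is exactly what gives the branch along
      \<open>p u\<close> the same speed \<open>slope f u\<close> as the branch along
      \<open>u\<close>.\<close>
    moreover have "slope f u * t / l (half_map f u) = slope f (p u) * (t / l u)" unfolding i using lp by (simp add: field_simps)
    ultimately show ?thesis using d'(2) False i(1) by (simp add: \<gamma>_def)
  qed
  moreover have "min d (d' * l u) > 0" using d d' lp by simp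
  ultimately show ?thesis by blast
qed

lemma affine_iso_lift:
  assumes fg: "mutual_inverse f g" and inv: "gluing_invariant D p l f" "gluing_invariant D p l g"
  shows "affine_iso X X (lift f)"
proof -
  have f: "PA f" using fg by (simp add: mutual_inverse_def)
  have lift_inv: "lift h z \<in> points X \<and> lift k (lift h z) = z"
    if hk: "mutual_inverse h k" "gluing_invariant D p l h" "gluing_invariant D p l k" and z: "z \<in> points X" for h k z
  proof -
    obtain u where u: "u \<in> D" "z = \<kappa> u" using z by (auto simp: points_X P_eq)
    have "half_map h u \<in> D" using hk(2) u by (simp add: gluing_invariant_def)
    then show ?thesis
      using lift_\<kappa>[OF hk(2) u(1)] lift_\<kappa>[OF hk(3)] mutual_inverseD(1)[OF hk(1)] u(2)
      by (simp add: points_X P_eq)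
  qed
  have gf: "mutual_inverse g f" using mutual_inverse_sym[OF fg] .
  have "affine_iso (remove {} X) (remove {} X) (lift f)"
  proof (rule affine_iso_aparamI[OF affine_curve_X affine_curve_X finite.emptyI finite.emptyI])
    show "bij_betw (lift f) (points X - {}) (points X - {})"
      by (rule bij_betw_byWitness[where f' = "lift g"])
        (use lift_inv[OF fg inv] lift_inv[OF gf inv(2,1)] in auto)
    fix z assume "z \<in> points X - {}"
    then obtain u where u: "u \<in> D" "z = \<kappa> u" by (auto simp: points_X P_eq)
    obtain e where e: "e > 0" "\<forall>t. \<bar>t\<bar> < e \<longrightarrow> lift f (\<gamma> u t) = \<gamma> (half_map f u) (slope f u * t)"
      using lift_\<gamma>[OF f inv(1) u(1)] by blast
    have "half_map f u \<in> D" using inv(1) u by (simp add: gluing_invariant_def)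
    then have "aparam X (lift f \<circ> \<gamma> u)"
      by (intro aparam_rescale[OF aparam_X _ e(1)]) (use e(2) slope_pos[OF f, of u] in auto)
    then show "\<exists>g. aparam X g \<and> g 0 = z \<and> aparam X (lift f \<circ> g)"
      using aparam_X[OF u(1)] u(2) by (intro exI[of _ "\<gamma> u"]) simp
  qed
  then show ?thesis by (simp add: remove_empty)
qed

text \<open>\<open>\<phi> \<circ> f\<close> and \<open>lift f \<circ> \<phi>\<close> agree at good
  smooth points with good image; composing with an inverse of \<open>\<phi>\<close> turns this into
  an equality of classes.\<close>

lemma pw_conj_lift:
  assumes fg: "mutual_inverse f g" and inv: "gluing_invariant D p l f"
  shows "pw_conj std_circle X (pw_class std_circle \<phi>) (pw_class std_circle f) = pw_class X (lift f)"
proof -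
  have f: "PA f" using fg by (simp add: mutual_inverse_def)
  note wX = wfI[OF affine_curve_X]
  obtain \<psi> where \<psi>: "pw_affine X std_circle \<psi>" "pw_eq std_circle (\<psi> \<circ> \<phi>) id" "pw_eq X (\<phi> \<circ> \<psi>) id"
    by (rule pw_affine_inverse[OF wf_std_circle wX pw_affine_\<phi>])
  obtain F where F: "finite F" "inj_on f (- F)" by (rule PA_local[OF f], rule that)
  let ?B = "{x. \<not> good x} \<union> {x. \<not> smooth f x}"
  have "finite {x \<in> - F. f x \<in> {x. \<not> good x}}"
    using finite_vimage_IntI[OF finite_bad F(2)] by (simp add: vimage_def Int_def conj_commute)
  moreover have "{x. (\<phi> \<circ> f) x \<noteq> (lift f \<circ> \<phi>) x} \<subseteq> ?B \<union> F \<union> {x \<in> - F. f x \<in> {x. \<not> good x}}"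
    using lift_\<phi>[OF inv] by auto
  ultimately have "finite {x. (\<phi> \<circ> f) x \<noteq> (lift f \<circ> \<phi>) x}"
    using finite_bad finite_not_smooth[OF f] F(1) by (meson finite_UnI finite_subset)
  then have "pw_eq std_circle (\<phi> \<circ> f) (lift f \<circ> \<phi>)" by (simp add: pw_eq_def)
  then have 1: "pw_eq X ((\<phi> \<circ> f) \<circ> \<psi>) ((lift f \<circ> \<phi>) \<circ> \<psi>)" by (rule pw_eq_comp[OF \<psi>(1) pw_eq_refl])
  have "{x \<in> points X. ((lift f \<circ> \<phi>) \<circ> \<psi>) x \<noteq> lift f x} \<subseteq> {x \<in> points X. (\<phi> \<circ> \<psi>) x \<noteq> id x}" by auto
  then have "pw_eq X ((lift f \<circ> \<phi>) \<circ> \<psi>) (lift f)"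
    using \<psi>(3) unfolding pw_eq_def by (meson finite_subset)
  then have "pw_class X ((\<phi> \<circ> f) \<circ> \<psi>) = pw_class X (lift f)"
    using 1 pw_eq_trans by (simp add: pw_class_eq) blast
  moreover have "pw_conj std_circle X (pw_class std_circle \<phi>) (pw_class std_circle f) = pw_class X ((\<phi> \<circ> f) \<circ> \<psi>)"
    unfolding pw_conj_def pw_comp_class[OF wf_std_circle f]
      pw_inv_class[OF wf_std_circle wX pw_affine_\<phi> \<psi>] pw_comp_class[OF wX \<psi>(1)] ..
  ultimately show ?thesis by simp
qed

lemma pw_conj_Aut:
  assumes H: "subgroup H PC" and inv: "\<And>f. f \<in> \<Union>H \<Longrightarrow> gluing_invariant D p l f"
  shows "pw_conj std_circle X (pw_class std_circle \<phi>) ` H \<subseteq> Aut_Aff X"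
proof
  fix B assume "B \<in> pw_conj std_circle X (pw_class std_circle \<phi>) ` H"
  then obtain A where A: "A \<in> H" "B = pw_conj std_circle X (pw_class std_circle \<phi>) A" by blast
  have Ac: "A \<in> carrier PC" using subgroup.subset[OF H] A(1) by blast
  have f: "rep_of A \<in> \<Union>H" "A = pw_class std_circle (rep_of A)"
    using rep_of_mem[OF Ac] A(1) PC_memD(2)[OF Ac rep_of_mem[OF Ac]] by auto
  obtain g where g: "g \<in> \<Union>H" "mutual_inverse (rep_of A) g" by (rule subgroup_mutual_inverse[OF H f(1)])
  have "B = pw_class X (lift (rep_of A))" using pw_conj_lift[OF g(2) inv[OF f(1)]] A(2) f(2) by simp
  then show "B \<in> Aut_Aff X"
    using affine_iso_lift[OF g(2) inv[OF f(1)] inv[OF g(1)]] by (auto simp: Aut_Aff_def)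
qed

lemma \<phi>_in_pw_iso: "pw_class std_circle \<phi> \<in> pw_iso std_circle X"
  using pw_affine_\<phi> by (auto simp: pw_iso_def)

end

text \<open>The circle is cut into two half-circles to make room for both sides of each point.\<close>

lemma half_inj_circle: obtains i :: "half \<Rightarrow> circle" where "inj i"
proof -
  define i :: "half \<Rightarrow> circle" where
    "i u = circle_proj (frac (circle_rep (fst u)) / 2 + (if snd u then 1 / 2 else 0))" for u
  have "u = v" if "i u = i v" for u v
  proof -
    define a b where ab: "a = frac (circle_rep (fst u))" "b = frac (circle_rep (fst v))"
    let ?x = "a / 2 + (if snd u then 1 / 2 else 0)" and ?y = "b / 2 + (if snd v then 1 / 2 else 0)"
    have r: "0 \<le> a" "a < 1" "0 \<le> b" "b < 1" by (simp_all add: ab frac_lt_1)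
    have "?x - ?y \<in> \<int>" using that by (simp add: i_def proj_eq ab)
    moreover have "\<bar>?x - ?y\<bar> < 1" using r by (cases "snd u"; cases "snd v") (simp_all add: abs_less_iff)
    ultimately have "?x - ?y = 0" by (rule Ints_nonzero_abs_less1)
    then have eq: "snd u = snd v" "a = b" using r by (auto split: if_splits)
    have "circle_rep (fst u) - circle_rep (fst v) \<in> \<int>"
    proof -
      have "circle_rep (fst u) - circle_rep (fst v) = of_int (\<lfloor>circle_rep (fst u)\<rfloor> - \<lfloor>circle_rep (fst v)\<rfloor>)"
        using eq(2) by (simp add: ab frac_def)
      then show ?thesis by (metis Ints_of_int)
    qed
    then have "fst u = fst v" using proj_eq proj_rep by metis
    then show ?thesis using eq(1) by (simp add: prod_eq_iff)
  qed
  then have "inj i" by (rule injI)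
  then show thesis by (rule that)
qed

lemma gluing_labels:
  assumes D: "gluing_data D p l"
  obtains \<kappa> :: "half \<Rightarrow> circle" where "gluing D p l \<kappa>"
proof -
  obtain i :: "half \<Rightarrow> circle" where i: "inj i" by (rule half_inj_circle)
  \<comment> \<open>The choice depends only on the set \<open>{u, p u}\<close>, so both members of a
    pair receive the same label.\<close>
  define c where "c u = (SOME w. w \<in> {u, p u})" for u
  have c: "c u \<in> {u, p u}" for u unfolding c_def by (rule someI[of _ u]) simp
  have "gluing D p l (\<lambda>u. i (c u))"
  proof (unfold_locales)
    show "gluing_data D p l" by (rule D)
    fix u v assume uv: "u \<in> D" "v \<in> D"
    then have pp: "p (p u) = u" "p (p v) = v" using D by (auto simp: gluing_data_def)
    have "c u = c v \<longleftrightarrow> v = u \<or> v = p u"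
    proof
      assume e: "c u = c v"
      have "c u = u \<or> c u = p u" "c v = v \<or> c v = p v" using c[of u] c[of v] by simp_all
      then show "v = u \<or> v = p u" using pp e by metis
    next
      assume "v = u \<or> v = p u"
      then have "{u, p u} = {v, p v}" using pp by auto
      then show "c u = c v" by (simp add: c_def)
    qed
    then show "i (c u) = i (c v) \<longleftrightarrow> v = u \<or> v = p u" using i by (simp add: inj_eq)
  qed
  then show thesis using that by blast
qed

section \<open>Homeomorphisms\<close>

instance circle :: t2_space
proof
  fix x y :: circle assume "x \<noteq> y"
  moreover have "Hausdorff_space (euclidean :: circle topology)"
    using affine_curve_std_circle by (simp add: affine_curve_def std_circle_def)
  ultimately obtain U V where "open U" "open V" "x \<in> U" "y \<in> V" "disjnt U V"
    unfolding Hausdorff_space_def by (metis UNIV_I open_openin topspace_euclidean)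
  then show "\<exists>U V. open U \<and> open V \<and> x \<in> U \<and> y \<in> V \<and> U \<inter> V = {}" by (auto simp: disjnt_def)
qed

lemma continuous_on_ray: "continuous_on S (ray u)"
proof -
  have "continuous_on UNIV circle_proj"
    by (simp add: continuous_on_open_vimage open_circle_def[symmetric])
  then have "continuous_on UNIV (circle_proj \<circ> (\<lambda>t. circle_rep (fst u) + sg (snd u) * t))"
    by (intro continuous_on_compose continuous_intros) (auto intro: continuous_on_subset)
  then show ?thesis by (auto simp: o_def ray_def[abs_def] intro: continuous_on_subset)
qed

abbreviation homeo :: "(circle \<Rightarrow> circle) \<Rightarrow> bool" where
  "homeo f \<equiv> homeomorphic_map (ctop std_circle) (ctop std_circle) f"

lemma homeo_continuous: "homeo f \<Longrightarrow> continuous_on S f"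
proof -
  assume "homeo f"
  then have "continuous_map (ctop std_circle) (ctop std_circle) f" by (rule homeomorphic_imp_continuous_map)
  then have "continuous_on UNIV f" by (simp add: std_circle_def)
  then show ?thesis by (rule continuous_on_subset) simp
qed

text \<open>By continuity both sides of the germ equation have a limit as \<open>t\<close> decreases
  to 0, and limits in the circle are unique.\<close>

lemma homeo_fst_half_map:
  assumes f: "PA f" "homeo f" shows "fst (half_map f u) = f (fst u)"
proof -
  obtain e where e: "e > 0" "\<forall>t. 0 < t \<and> t < e \<longrightarrow> f (ray u t) = ray (half_map f u) (slope f u * t)"
    using germ_half_map[OF f(1), of u] unfolding germ_def by blast
  have lim1: "((\<lambda>t. f (ray u t)) \<longlongrightarrow> f (ray u 0)) (at_right 0)"
  proof -
    have "continuous_on UNIV (\<lambda>t. f (ray u t))"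
      using continuous_on_compose[OF continuous_on_ray homeo_continuous[OF f(2)]] by (simp add: o_def)
    then show ?thesis by (meson UNIV_I continuous_on_def filterlim_at_split filterlim_mono tendsto_within_subset top_greatest)
  qed
  have lim2: "((\<lambda>t. ray (half_map f u) (slope f u * t)) \<longlongrightarrow> ray (half_map f u) (slope f u * 0)) (at_right 0)"
  proof -
    have "continuous_on UNIV (ray (half_map f u) \<circ> (\<lambda>t. slope f u * t))"
      by (intro continuous_on_compose continuous_on_ray continuous_intros)
    then show ?thesis unfolding o_def by (meson UNIV_I continuous_on_def tendsto_within_subset top_greatest)
  qed
  have "eventually (\<lambda>t. f (ray u t) = ray (half_map f u) (slope f u * t)) (at_right 0)"
    using e eventually_at_right[of 0 e] by (auto simp: eventually_at_right_field)
  then have "((\<lambda>t. ray (half_map f u) (slope f u * t)) \<longlongrightarrow> f (ray u 0)) (at_right 0)"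
    using lim1 by (simp cong: tendsto_cong)
  from tendsto_unique[OF _ this lim2] show ?thesis by simp
qed

text \<open>The two sides of a point go to half-points over one point, and these differ because
  germs act injectively.\<close>

lemma homeo_half_map_opp:
  assumes f: "PA f" "homeo f" shows "half_map f (opp u) = opp (half_map f u)"
proof -
  have "fst (half_map f (opp u)) = fst (half_map f u)" using homeo_fst_half_map[OF f] by simp
  moreover have "half_map f (opp u) \<noteq> half_map f u"
    using germ_inj[OF f(1)] germ_half_map[OF f(1), of u] germ_half_map[OF f(1), of "opp u"] by (metis opp_simps(4))
  ultimately show ?thesis by (auto simp: opp_def prod_eq_iff)
qed

text \<open>The infimum of the counterexamples is positive by \<open>start\<close>, all smaller
  positive parameters satisfy \<open>A\<close>, and \<open>step\<close> then passes beyond it.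
  Passage to the limit is left to \<open>step\<close>, which has to reach \<open>s\<close>
  itself.\<close>

lemma continuation_induct:
  fixes r :: real
  assumes start: "\<exists>d>0. \<forall>s. 0 < s \<and> s < d \<longrightarrow> A s"
    and step: "\<And>s. 0 < s \<Longrightarrow> s < r \<Longrightarrow> (\<forall>t. 0 < t \<and> t < s \<longrightarrow> A t) \<Longrightarrow>
      \<exists>d>0. \<forall>t. s \<le> t \<and> t < s + d \<longrightarrow> A t"
    and s: "0 < s" "s < r"
  shows "A s"
proof (rule ccontr)
  assume nA: "\<not> A s"
  define B where "B = {t. 0 < t \<and> t < r \<and> \<not> A t}"
  obtain d where d: "d > 0" "\<And>t. 0 < t \<Longrightarrow> t < d \<Longrightarrow> A t" using start by blast
  have B: "s \<in> B" "bdd_below B" using nA s by (auto simp: B_def intro!: bdd_belowI[of _ 0])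
  have lb: "d \<le> Inf B"
  proof (rule cInf_greatest)
    show "B \<noteq> {}" using B by blast
    fix b assume "b \<in> B"
    then have "\<not> b < d" using d(2)[of b] by (auto simp: B_def)
    then show "d \<le> b" by simp
  qed
  have ub: "Inf B \<le> s" by (rule cInf_lower[OF B])
  have "\<forall>t. 0 < t \<and> t < Inf B \<longrightarrow> A t"
  proof (intro allI impI)
    fix t assume t: "0 < t \<and> t < Inf B"
    then have "t \<notin> B" using cInf_lower[OF _ B(2), of t] by auto
    moreover have "t < r" using t ub s by simp
    ultimately show "A t" using t by (simp add: B_def)
  qed
  then obtain e where e: "e > 0" "\<And>t. Inf B \<le> t \<Longrightarrow> t < Inf B + e \<Longrightarrow> A t"
    using step[of "Inf B"] lb ub d s by auto
  have "Inf B + e \<le> Inf B"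
  proof (rule cInf_greatest)
    show "B \<noteq> {}" using B by blast
    fix b assume b: "b \<in> B"
    then have "Inf B \<le> b" by (rule cInf_lower[OF _ B(2)])
    moreover have "\<not> A b" using b by (simp add: B_def)
    ultimately show "Inf B + e \<le> b" using e(2)[of b] by (intro leI) blast
  qed
  then show False using e(1) by simp
qed

section \<open>Piecewise affine reparametrisation with prescribed slope ratios\<close>

text \<open>Precomposing with a map of two slopes adds one kink. Since ratios are prescribed at
  values \<open>E s\<close> and not at arguments \<open>s\<close>, this keeps the ratios already
  arranged at other values, and the points of \<open>B\<close> can be treated one at a time. A kink
  at a positive value leaves \<open>E 0 = 0\<close>.\<close>

lemma piecewise_affine_ratios:
  fixes \<mu> :: "real \<Rightarrow> real"
  assumes "finite B" "B \<subseteq> {0<..}" "\<And>x. \<mu> x > 0" "\<And>x. x \<notin> B \<Longrightarrow> \<mu> x = 1"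
  shows "\<exists>E. continuous_on UNIV E \<and> strict_mono E \<and> surj E \<and> E 0 = 0 \<and>
    (\<forall>s. \<exists>a>0. \<exists>\<delta>>0. \<forall>t. 0 \<le> t \<and> t < \<delta> \<longrightarrow> E (s - t) = E s - a * t \<and> E (s + t) = E s + a * \<mu> (E s) * t)"
  using assms
proof (induction B arbitrary: \<mu> rule: finite_induct)
  case empty
  have m: "\<mu> x = 1" for x using empty.prems(3) by simp
  have "strict_mono (\<lambda>x::real. x)" by (simp add: strict_mono_def)
  moreover have "surj (\<lambda>x::real. x)" by auto
  ultimately show ?case using m
    by (intro exI[of _ "\<lambda>x. x"]) (auto intro!: exI[of _ 1])
next
  case (insert b B)
  define \<nu> where "\<nu> = \<mu>(b := 1)"
  have "\<exists>E. continuous_on UNIV E \<and> strict_mono E \<and> surj E \<and> E 0 = 0 \<and>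
    (\<forall>s. \<exists>a>0. \<exists>\<delta>>0. \<forall>t. 0 \<le> t \<and> t < \<delta> \<longrightarrow> E (s - t) = E s - a * t \<and> E (s + t) = E s + a * \<nu> (E s) * t)"
    by (rule insert.IH) (use insert.prems in \<open>auto simp: \<nu>_def\<close>)
  then obtain E where E: "continuous_on UNIV E" "strict_mono E" "surj E" "E 0 = 0"
    and loc: "\<And>s. \<exists>a>0. \<exists>\<delta>>0. \<forall>t. 0 \<le> t \<and> t < \<delta> \<longrightarrow> E (s - t) = E s - a * t \<and> E (s + t) = E s + a * \<nu> (E s) * t"
    by blast
  define r where "r = \<mu> b"
  have r: "r > 0" using insert.prems by (simp add: r_def)
  obtain s0 where s0: "E s0 = b" using E(3) by (metis surjD)
  have "E 0 < E s0" using insert.prems(1) s0 E(4) by simp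
  then have s0_pos: "s0 > 0" using strict_mono_less[OF E(2)] by blast
  define \<psi> where "\<psi> s = s + (r - 1) * max 0 (s - s0)" for s
  have psi: "\<psi> s = (if s \<le> s0 then s else s0 + r * (s - s0))" for s
    by (simp add: \<psi>_def max_def algebra_simps)
  have mono: "strict_mono \<psi>"
  proof (rule strict_monoI)
    fix x y :: real assume xy: "x < y"
    show "\<psi> x < \<psi> y"
    proof (cases "y \<le> s0")
      case True then show ?thesis using xy by (simp add: psi)
    next
      case False
      have "0 < r * (y - s0)" using False r by simp
      moreover have "r * (x - s0) < r * (y - s0)" using xy r by simp
      ultimately show ?thesis using False by (simp add: psi)
    qed
  qed
  have surj: "surj \<psi>"
  proof (rule surjI)
    fix y show "\<psi> (if y \<le> s0 then y else s0 + (y - s0) / r) = y" using r by (auto simp: psi field_simps)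
  qed
  have cont: "continuous_on UNIV \<psi>" unfolding \<psi>_def by (intro continuous_intros)
  have "\<exists>a>0. \<exists>\<delta>>0. \<forall>t. 0 \<le> t \<and> t < \<delta> \<longrightarrow>
      (E \<circ> \<psi>) (s - t) = (E \<circ> \<psi>) s - a * t \<and> (E \<circ> \<psi>) (s + t) = (E \<circ> \<psi>) s + a * \<mu> ((E \<circ> \<psi>) s) * t" for s
  proof -
    obtain a d where a: "a > 0" "d > 0"
      "\<And>t. 0 \<le> t \<Longrightarrow> t < d \<Longrightarrow> E (\<psi> s - t) = E (\<psi> s) - a * t \<and> E (\<psi> s + t) = E (\<psi> s) + a * \<nu> (E (\<psi> s)) * t"
      using loc[of "\<psi> s"] by blast
    define \<alpha> where "\<alpha> = (if s \<le> s0 then 1 else r)"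
    define \<beta> where "\<beta> = (if s < s0 then 1 else r)"
    have \<alpha>\<beta>: "\<alpha> > 0" "\<beta> > 0" using r by (auto simp: \<alpha>_def \<beta>_def)
    define d1 where "d1 = (if s = s0 then 1 else \<bar>s - s0\<bar>)"
    have d1: "d1 > 0" by (simp add: d1_def)
    have ps: "\<psi> (s - t) = \<psi> s - \<alpha> * t \<and> \<psi> (s + t) = \<psi> s + \<beta> * t" if "0 \<le> t" "t < d1" for t
    proof -
      consider "s < s0" | "s = s0" | "s > s0" by linarith
      then show ?thesis
        using that by cases (auto simp: psi \<alpha>_def \<beta>_def d1_def algebra_simps)
    qed
    \<comment> \<open>At \<open>s0\<close> the new kink supplies the whole ratio \<open>r\<close>;
      elsewhere \<open>\<psi>\<close> has equal slopes on both sides and \<open>\<nu>\<close> agrees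
      with \<open>\<mu>\<close> at the value in question.\<close>
    have ratio: "\<nu> (E (\<psi> s)) * \<beta> = \<mu> (E (\<psi> s)) * \<alpha>"
    proof (cases "s = s0")
      case True
      then have "E (\<psi> s) = b" using s0 by (simp add: psi)
      then show ?thesis using True by (simp add: \<nu>_def \<alpha>_def \<beta>_def r_def)
    next
      case False
      have "\<psi> s \<noteq> s0" using strict_mono_eq[OF mono, of s s0] False psi[of s0] by auto
      then have "E (\<psi> s) \<noteq> b" using strict_mono_eq[OF E(2), of "\<psi> s" s0] s0 by auto
      then show ?thesis using False by (simp add: \<nu>_def \<alpha>_def \<beta>_def)
    qed
    define m where "m = min d1 (min (d / \<alpha>) (d / \<beta>))"
    have "(E \<circ> \<psi>) (s - t) = (E \<circ> \<psi>) s - (a * \<alpha>) * t \<and>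
      (E \<circ> \<psi>) (s + t) = (E \<circ> \<psi>) s + (a * \<alpha>) * \<mu> ((E \<circ> \<psi>) s) * t" if t: "0 \<le> t \<and> t < m" for t
    proof -
      have "0 \<le> \<alpha> * t" "\<alpha> * t < d" "0 \<le> \<beta> * t" "\<beta> * t < d" "t < d1"
        using t \<alpha>\<beta> by (auto simp: m_def pos_less_divide_eq mult.commute)
      then have "E (\<psi> (s - t)) = E (\<psi> s) - a * (\<alpha> * t)" "E (\<psi> (s + t)) = E (\<psi> s) + a * \<nu> (E (\<psi> s)) * (\<beta> * t)"
        using ps[of t] a(3)[of "\<alpha> * t"] a(3)[of "\<beta> * t"] t by auto
      moreover have "a * \<nu> (E (\<psi> s)) * (\<beta> * t) = a * (\<nu> (E (\<psi> s)) * \<beta>) * t" by simp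
      ultimately show ?thesis unfolding ratio by (simp add: mult_ac)
    qed
    moreover have "a * \<alpha> > 0" "m > 0" using a \<alpha>\<beta> d1 by (auto simp: m_def)
    ultimately show ?thesis by blast
  qed
  moreover have "continuous_on UNIV (E \<circ> \<psi>)"
    by (intro continuous_on_compose cont continuous_on_subset[OF E(1)]) simp
  moreover have "strict_mono (E \<circ> \<psi>)" using mono E(2) by (simp add: strict_mono_def)
  moreover have "surj (E \<circ> \<psi>)" using surj E(3) by (rule comp_surj)
  moreover have "(E \<circ> \<psi>) 0 = 0" using E(4) s0_pos by (simp add: psi)
  ultimately show ?case by blast
qed

section \<open>Gluing back at the missing points\<close>

text \<open>With \<open>fst\<close> as labelling \<open>\<phi>\<close> is the identity, so that
  \<open>lift f\<close> can be compared with \<open>f\<close> pointwise.\<close>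

locale point_gluing = gluing D p l fst for D p l +
  assumes p_opp: "u \<in> D \<Longrightarrow> p u = opp u"
begin

lemma opp_D: "opp u \<in> D \<longleftrightarrow> u \<in> D"
  using p_D p_opp opp_simps(3) by metis

lemma D_fst: "u \<in> D \<longleftrightarrow> fst u \<in> fst ` D"
proof
  assume "fst u \<in> fst ` D"
  then obtain w where w: "w \<in> D" "fst w = fst u" by force
  then have "u = w \<or> u = opp w" by (auto simp: opp_def prod_eq_iff)
  then show "u \<in> D" using w opp_D by blast
qed simp

lemma half_path_ray: "half_path w r = ray w r"
  by (simp add: half_path_def \<phi>_def)

text \<open>On points of the glued curve \<open>lift f\<close> is \<open>f\<close> itself, since for
  a homeomorphism the half-point \<open>half_map f v\<close> lies over
  \<open>f (fst v)\<close>.\<close>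

lemma homeo_\<gamma>:
  assumes f: "PA f" "homeo f" and inv: "gluing_invariant D p l f" and w: "w \<in> D"
  shows "\<exists>e>0. \<forall>t. \<bar>t\<bar> < e \<longrightarrow> f (\<gamma> w t) = \<gamma> (half_map f w) (slope f w * t)"
proof -
  obtain e where e: "e > 0" "\<forall>t. \<bar>t\<bar> < e \<longrightarrow> lift f (\<gamma> w t) = \<gamma> (half_map f w) (slope f w * t)"
    using lift_\<gamma>[OF f(1) inv w] by blast
  have "lift f (\<gamma> w t) = f (\<gamma> w t)" if t: "\<bar>t\<bar> < eps w" for t
  proof -
    obtain v where v: "v \<in> D" "\<gamma> v 0 = \<gamma> w t" using cover[OF w t] by blast
    then show ?thesis using lift_\<kappa>[OF inv v(1)] homeo_fst_half_map[OF f, of v] by simp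
  qed
  then show ?thesis using e eps(1)[OF w] by (intro exI[of _ "min e (eps w)"]) auto
qed

section \<open>Arcs between consecutive missing points\<close>

definition "missing = - fst ` D"

text \<open>An arc of the glued curve leaving the missing point \<open>fst u\<close> on the side of \<open>u\<close> and ending at
  the next missing point, with affine parameter running from 0 to 1; its initial speed is \<open>1 / W\<close>.\<close>

definition unit_arc :: "half \<Rightarrow> (real \<Rightarrow> circle) \<Rightarrow> real \<Rightarrow> bool" where
  "unit_arc u \<Gamma> W \<longleftrightarrow> W > 0 \<and> continuous_on UNIV \<Gamma> \<and> \<Gamma> 1 \<in> missing \<and>
     (\<forall>s. 0 < s \<and> s < 1 \<longrightarrow> \<Gamma> s \<notin> missing) \<and>
     (\<exists>d>0. \<forall>t. 0 < t \<and> t < d \<longrightarrow> \<Gamma> t = ray u (t / W)) \<and>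
     (\<forall>s. 0 < s \<and> s < 1 \<longrightarrow>
       (\<exists>w\<in>D. \<exists>a>0. \<exists>d>0. fst w = \<Gamma> s \<and> (\<forall>t. \<bar>t\<bar> < d \<longrightarrow> \<Gamma> (s + t) = \<gamma> w (a * t))))"

lemma missing_iff: "fst u \<in> missing \<longleftrightarrow> u \<notin> D"
  using D_fst[of u] unfolding missing_def Compl_iff by metis

lemma homeo_missing:
  assumes fg: "mutual_inverse f g" and f: "homeo f"
    and inv: "gluing_invariant D p l f" "gluing_invariant D p l g"
  shows "f x \<in> missing \<longleftrightarrow> x \<in> missing"
proof -
  have PA: "PA f" using fg by (simp add: mutual_inverse_def)
  have "f x = fst (half_map f (x, True))" using homeo_fst_half_map[OF PA f] by simp
  then have "f x \<in> missing \<longleftrightarrow> half_map f (x, True) \<notin> D" using missing_iff by metis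
  also have "\<dots> \<longleftrightarrow> (x, True) \<notin> D"
    using inv mutual_inverseD(1)[OF fg, of "(x, True)"] unfolding gluing_invariant_def by metis
  also have "\<dots> \<longleftrightarrow> x \<in> missing" using missing_iff[of "(x, True)"] by simp
  finally show ?thesis .
qed

lemma left_limit_eq:
  fixes g h :: "real \<Rightarrow> circle"
  assumes "continuous_on UNIV g" "continuous_on UNIV h" "0 < s" "\<forall>t. 0 < t \<and> t < s \<longrightarrow> g t = h t"
  shows "g s = h s"
proof -
  have lim: "(k \<longlongrightarrow> k s) (at_left s)" if "continuous_on UNIV k" for k :: "real \<Rightarrow> circle"
    using that by (meson UNIV_I continuous_on_def tendsto_within_subset top_greatest)
  have "eventually (\<lambda>t. g t = h t) (at_left s)"
    using assms(3,4) by (auto simp: eventually_at_left_field intro!: exI[of _ 0])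
  then have "(h \<longlongrightarrow> g s) (at_left s)" using lim[OF assms(1)] by (simp cong: tendsto_cong)
  from tendsto_unique[OF _ this lim[OF assms(2)]] show ?thesis by simp
qed

text \<open>For \<open>c = slope f u * W' / W\<close> the paths \<open>f (\<Gamma> t)\<close> and
  \<open>\<Gamma>' (c * t)\<close> have the same initial germ, and affinity propagates their
  equality until one arc ends. If \<open>c\<close> were not 1, one of the arcs would meet a missing
  point in its interior.\<close>

lemma unit_arc_speed:
  assumes fg: "mutual_inverse f g" and f: "homeo f"
    and inv: "gluing_invariant D p l f" "gluing_invariant D p l g"
    and arc: "unit_arc u \<Gamma> W" and arc': "unit_arc (half_map f u) \<Gamma>' W'"
  shows "slope f u * W' = W"
proof -
  have PA: "PA f" using fg by (simp add: mutual_inverse_def)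
  note arc = arc[unfolded unit_arc_def] and arc' = arc'[unfolded unit_arc_def]
  have W: "W > 0" "W' > 0" "slope f u > 0" using arc arc' slope_pos[OF PA] by auto
  define c where "c = slope f u * W' / W"
  have c: "c > 0" using W by (simp add: c_def)
  have contf: "continuous_on UNIV (\<lambda>t. f (\<Gamma> t))"
    using continuous_on_compose[OF _ homeo_continuous[OF f]] arc by (auto simp: o_def)
  have contc: "continuous_on UNIV (\<lambda>t. \<Gamma>' (c * t))"
  proof -
    have "continuous_on UNIV (\<Gamma>' \<circ> (\<lambda>t. c * t))"
      by (intro continuous_on_compose continuous_intros) (use arc' in \<open>auto intro: continuous_on_subset\<close>)
    then show ?thesis by (simp add: o_def)
  qed
  \<comment> \<open>The time at which the first of the two arcs reaches its end.\<close>
  define r where "r = min 1 (1 / c)"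
  have agree: "f (\<Gamma> s) = \<Gamma>' (c * s)" if s: "0 < s" "s < r" for s
  proof (rule continuation_induct[of "\<lambda>s. f (\<Gamma> s) = \<Gamma>' (c * s)", OF _ _ s])
    obtain d where d: "d > 0" "\<forall>t. 0 < t \<and> t < d \<longrightarrow> \<Gamma> t = ray u (t / W)" using arc by blast
    obtain d' where d': "d' > 0" "\<forall>t. 0 < t \<and> t < d' \<longrightarrow> \<Gamma>' t = ray (half_map f u) (t / W')" using arc' by blast
    obtain e where e: "e > 0" "\<forall>t. 0 < t \<and> t < e \<longrightarrow> f (ray u t) = ray (half_map f u) (slope f u * t)"
      using germ_half_map[OF PA, of u] unfolding germ_def by blast
    have "f (\<Gamma> t) = \<Gamma>' (c * t)" if t: "0 < t \<and> t < min d (min (d' / c) (e * W))" for t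
    proof -
      have "0 < t / W" "t / W < e" "0 < c * t" "c * t < d'"
        using t W c by (auto simp: pos_divide_less_eq pos_less_divide_eq mult.commute)
      then have "f (\<Gamma> t) = ray (half_map f u) (slope f u * (t / W))" "\<Gamma>' (c * t) = ray (half_map f u) (c * t / W')"
        using d(2) e(2) d'(2) t by auto
      moreover have "slope f u * (t / W) = c * t / W'" using W by (simp add: c_def)
      ultimately show ?thesis by simp
    qed
    moreover have "min d (min (d' / c) (e * W)) > 0" using d d' e W c by simp
    ultimately show "\<exists>d>0. \<forall>s. 0 < s \<and> s < d \<longrightarrow> f (\<Gamma> s) = \<Gamma>' (c * s)" by blast
  next
    fix s assume s: "0 < s" "s < r" and before: "\<forall>t. 0 < t \<and> t < s \<longrightarrow> f (\<Gamma> t) = \<Gamma>' (c * t)"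
    have at_s: "f (\<Gamma> s) = \<Gamma>' (c * s)" by (rule left_limit_eq[OF contf contc s(1) before])
    have s1: "s < 1" "0 < c * s" "c * s < 1"
      using s c by (auto simp: r_def pos_less_divide_eq mult.commute)
    obtain w a d where w: "w \<in> D" "a > 0" "d > 0" "fst w = \<Gamma> s" "\<forall>t. \<bar>t\<bar> < d \<longrightarrow> \<Gamma> (s + t) = \<gamma> w (a * t)"
      using arc s s1 by blast
    obtain w' a' d' where w': "w' \<in> D" "a' > 0" "d' > 0" "fst w' = \<Gamma>' (c * s)"
      "\<forall>t. \<bar>t\<bar> < d' \<longrightarrow> \<Gamma>' (c * s + t) = \<gamma> w' (a' * t)"
      using arc' s1 by blast
    define v where "v = half_map f w"
    have v: "v \<in> D" using inv(1) w(1) by (simp add: v_def gluing_invariant_def)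
    obtain e where e: "e > 0" "\<forall>t. \<bar>t\<bar> < e \<longrightarrow> f (\<gamma> w t) = \<gamma> v (slope f w * t)"
      using homeo_\<gamma>[OF PA f inv(1) w(1)] unfolding v_def by blast
    have "\<gamma> w' 0 = \<gamma> v 0" using w(4) w'(4) at_s homeo_fst_half_map[OF PA f, of w] by (simp add: v_def)
    then obtain b e' where b: "b \<noteq> 0" "e' > 0" "\<forall>t. \<bar>t\<bar> < e' \<longrightarrow> \<gamma> w' t = \<gamma> v (0 + b * t)"
      using \<gamma>_shift[OF v w'(1), of 0] eps(1)[OF v] by auto
    define \<alpha> where "\<alpha> = slope f w * a"
    define \<beta> where "\<beta> = b * a' * c"
    define m where "m = min (min d (e / a)) (min (d' / c) (e' / (a' * c)))"
    have m: "m > 0" using w w' e b c by (simp add: m_def)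
    have near: "f (\<Gamma> (s + t)) = \<gamma> v (\<alpha> * t)" "\<Gamma>' (c * (s + t)) = \<gamma> v (\<beta> * t)" if t: "\<bar>t\<bar> < m" for t
    proof -
      have "\<bar>t\<bar> < d" "\<bar>a * t\<bar> < e" "\<bar>c * t\<bar> < d'" "\<bar>a' * (c * t)\<bar> < e'"
        using t w(2) w'(2) c by (auto simp: m_def abs_mult pos_less_divide_eq mult_ac)
      then have "f (\<Gamma> (s + t)) = \<gamma> v (slope f w * (a * t))" "\<Gamma>' (c * s + c * t) = \<gamma> v (0 + b * (a' * (c * t)))"
        using w(5) e(2) w'(5) b(3) by metis+
      then show "f (\<Gamma> (s + t)) = \<gamma> v (\<alpha> * t)" "\<Gamma>' (c * (s + t)) = \<gamma> v (\<beta> * t)"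
        by (simp_all add: \<alpha>_def \<beta>_def mult.assoc distrib_left)
    qed
    have "\<alpha> = \<beta>"
    proof -
      define q where "q = eps v / (2 * (1 + \<bar>\<alpha>\<bar> + \<bar>\<beta>\<bar>))"
      \<comment> \<open>Negative, because equality is known only before \<open>s\<close>, and so
        small that \<open>\<alpha> * t\<close> and \<open>\<beta> * t\<close> both lie where
        \<open>\<gamma> v\<close> is injective.\<close>
      define t where "t = - min (min (m / 2) (s / 2)) q"
      have pos: "1 + \<bar>\<alpha>\<bar> + \<bar>\<beta>\<bar> > 0" by linarith
      have ev: "eps v > 0" using eps(1)[OF v] .
      have "q > 0" using ev pos by (simp add: q_def)
      then have t: "t < 0" "- t \<le> m / 2" "- t \<le> s / 2" "- t \<le> q"
        using m s(1) by (simp_all add: t_def min_def)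
      have "\<bar>t\<bar> * (1 + \<bar>\<alpha>\<bar> + \<bar>\<beta>\<bar>) \<le> eps v / 2" using t(1,4) pos by (simp add: q_def pos_le_divide_eq mult_ac)
      then have "\<bar>t\<bar> + \<bar>\<alpha> * t\<bar> + \<bar>\<beta> * t\<bar> \<le> eps v / 2" by (simp add: distrib_left abs_mult mult.commute)
      then have ab: "\<bar>\<alpha> * t\<bar> < eps v" "\<bar>\<beta> * t\<bar> < eps v" using ev by linarith+
      have "\<bar>t\<bar> < m" "0 < s + t" "s + t < s" using t m s(1) by linarith+
      then have "\<gamma> v (\<alpha> * t) = \<gamma> v (\<beta> * t)" using near[of t] before by metis
      moreover have "\<alpha> * t \<in> {- eps v<..<eps v}" "\<beta> * t \<in> {- eps v<..<eps v}"
        using ab by (auto simp: abs_less_iff)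
      ultimately have "\<alpha> * t = \<beta> * t" by (rule inj_onD[OF eps(2)[OF v]])
      then show ?thesis using t(1) by simp
    qed
    then have "f (\<Gamma> t) = \<Gamma>' (c * t)" if "s \<le> t \<and> t < s + m" for t
      using near[of "t - s"] that by simp
    then show "\<exists>d>0. \<forall>t. s \<le> t \<and> t < s + d \<longrightarrow> f (\<Gamma> t) = \<Gamma>' (c * t)" using m by blast
  qed
  have miss: "f x \<in> missing \<longleftrightarrow> x \<in> missing" for x by (rule homeo_missing[OF fg f inv])
  have r0: "r > 0" using c by (simp add: r_def)
  have at_r: "f (\<Gamma> r) = \<Gamma>' (c * r)"
    by (rule left_limit_eq[OF contf contc r0]) (use agree in blast)
  have "c = 1"
  proof (rule ccontr)
    assume "c \<noteq> 1"
    then consider "c < 1" | "c > 1" by linarith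
    then show False
    proof cases
      case 1
      then have "r = 1" using c by (simp add: r_def)
      then have "\<Gamma>' c \<in> missing" using at_r miss[of "\<Gamma> 1"] arc by simp
      then show False using arc' 1 c by blast
    next
      case 2
      then have r: "r = 1 / c" "r < 1" by (auto simp: r_def)
      then have "f (\<Gamma> r) = \<Gamma>' 1" using at_r c by simp
      then have "\<Gamma> r \<in> missing" using miss[of "\<Gamma> r"] arc' by simp
      then show False using arc r r0 by blast
    qed
  qed
  then show ?thesis using W by (simp add: c_def)
qed

lemma finite_missing: "finite missing"
proof -
  have "missing \<subseteq> {x. \<not> good x}" using goodD[of "(x, True)" for x] by (force simp: missing_def)
  then show ?thesis using finite_bad finite_subset by blast
qed

text \<open>The ray from \<open>u\<close> is followed up to the first missing point, with its speed
  changed at each glued point by the factor that the gluing regards as affine; finally the parameter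
  is scaled so that the arc takes time 1.\<close>

lemma unit_arc_exists:
  assumes u: "fst u \<in> missing" shows "\<exists>\<Gamma> W. unit_arc u \<Gamma> W"
proof -
  have inj: "inj_on (ray u) {0<..1}"
  proof (rule inj_onI)
    fix s t assume st: "s \<in> {0<..1}" "t \<in> {0<..1}" "ray u s = ray u t"
    then have "\<bar>s - t\<bar> < 1" by (auto simp: abs_less_iff)
    then show "s = t" using ray_neq st(3) by blast
  qed
  define R where "R = {t. 0 < t \<and> t \<le> 1 \<and> ray u t \<in> missing}"
  have "R = {0<..1} \<inter> ray u -` missing" by (auto simp: R_def)
  then have finR: "finite R" using finite_vimage_IntI[OF finite_missing inj] by (simp add: Int_commute)
  have R1: "1 \<in> R" using u by (simp add: R_def)
  define T where "T = Min R"
  have "T \<in> R" unfolding T_def using finR R1 by (intro Min_in) auto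
  then have T: "0 < T" "T \<le> 1" "ray u T \<in> missing" by (auto simp: R_def)
  have before: "ray u t \<notin> missing" if "0 < t" "t < T" for t
  proof
    assume "ray u t \<in> missing"
    then have "t \<in> R" using that T by (simp add: R_def)
    then show False using Min_le[OF finR] that by (force simp: T_def)
  qed
  \<comment> \<open>The half-point facing back towards \<open>u\<close>. The path
    \<open>\<gamma>\<close> centred there reaches the part before it at speed 1 and the part beyond
    it at speed \<open>1 / l (bk t)\<close>; this is the ratio \<open>\<mu>\<close>.\<close>
  define bk where "bk t = (ray u t, \<not> snd u)" for t
  have bkD: "bk t \<in> D" if "0 < t" "t < T" for t
    using missing_iff[of "bk t"] before[OF that] by (simp add: bk_def)
  define \<mu> where "\<mu> t = (if 0 < t \<and> t < T then 1 / l (bk t) else 1)" for t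
  define B where "B = {t. 0 < t \<and> t < T \<and> \<mu> t \<noteq> 1}"
  have "finite B"
  proof (rule finite_imageD)
    have "ray u ` B \<subseteq> {x. \<not> good x}"
    proof
      fix x assume "x \<in> ray u ` B"
      then obtain t where t: "x = ray u t" "0 < t" "t < T" "l (bk t) \<noteq> 1" by (auto simp: B_def \<mu>_def)
      then show "x \<in> {x. \<not> good x}" using goodD[of "bk t"] by (auto simp: bk_def)
    qed
    then show "finite (ray u ` B)" using finite_bad finite_subset by blast
    show "inj_on (ray u) B" by (rule inj_on_subset[OF inj]) (use T in \<open>auto simp: B_def\<close>)
  qed
  moreover have "B \<subseteq> {0<..}" by (auto simp: B_def)
  moreover have "\<mu> x > 0" for x using l_pos bkD by (simp add: \<mu>_def)
  moreover have "x \<notin> B \<Longrightarrow> \<mu> x = 1" for x by (auto simp: B_def \<mu>_def)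
  ultimately have "\<exists>E. continuous_on UNIV E \<and> strict_mono E \<and> surj E \<and> E 0 = 0 \<and>
    (\<forall>s. \<exists>a>0. \<exists>\<delta>>0. \<forall>t. 0 \<le> t \<and> t < \<delta> \<longrightarrow> E (s - t) = E s - a * t \<and> E (s + t) = E s + a * \<mu> (E s) * t)"
    by (rule piecewise_affine_ratios)
  then obtain E where E: "continuous_on UNIV E" "strict_mono E" "surj E" "E 0 = 0"
    and loc: "\<And>s. \<exists>a>0. \<exists>\<delta>>0. \<forall>t. 0 \<le> t \<and> t < \<delta> \<longrightarrow> E (s - t) = E s - a * t \<and> E (s + t) = E s + a * \<mu> (E s) * t"
    by blast
  obtain S where S: "E S = T" using E(3) by (metis surjD)
  have "E 0 < E S" using S T E(4) by simp
  then have S0: "S > 0" using strict_mono_less[OF E(2)] by blast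
  define \<Gamma> where "\<Gamma> s = ray u (E (S * s))" for s
  obtain a0 d0 where a0: "a0 > 0" "d0 > 0"
    "\<forall>t. 0 \<le> t \<and> t < d0 \<longrightarrow> E (0 - t) = E 0 - a0 * t \<and> E (0 + t) = E 0 + a0 * \<mu> (E 0) * t"
    using loc[of 0] by blast
  have inside: "0 < E (S * s)" "E (S * s) < T" if "0 < s" "s < 1" for s
  proof -
    have "0 < S * s" "S * s < S" using that S0 by auto
    then show "0 < E (S * s)" "E (S * s) < T"
      using strict_mono_less[OF E(2), of 0 "S * s"] strict_mono_less[OF E(2), of "S * s" S] S E(4) by auto
  qed
  have "unit_arc u \<Gamma> (1 / (a0 * S))"
    unfolding unit_arc_def
  proof (intro conjI allI impI)
    show "0 < 1 / (a0 * S)" using a0 S0 by simp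
    have "continuous_on UNIV (ray u \<circ> (E \<circ> (\<lambda>s. S * s)))"
      by (intro continuous_on_compose continuous_on_ray continuous_intros) (use E(1) in \<open>auto intro: continuous_on_subset\<close>)
    then show "continuous_on UNIV \<Gamma>" by (simp add: \<Gamma>_def[abs_def] o_def)
    show "\<Gamma> 1 \<in> missing" using S T by (simp add: \<Gamma>_def)
    show "\<Gamma> s \<notin> missing" if "0 < s \<and> s < 1" for s
      using before inside that by (simp add: \<Gamma>_def)
    have "\<Gamma> t = ray u (t / (1 / (a0 * S)))" if "0 < t \<and> t < d0 / S" for t
    proof -
      have "0 \<le> S * t" "S * t < d0" using that S0 by (auto simp: pos_less_divide_eq mult.commute)
      then have "E (S * t) = a0 * (S * t)" using a0(3)[rule_format, of "S * t"] E(4) by (simp add: \<mu>_def)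
      then show ?thesis by (simp add: \<Gamma>_def mult_ac)
    qed
    moreover have "d0 / S > 0" using a0 S0 by simp
    ultimately show "\<exists>d>0. \<forall>t. 0 < t \<and> t < d \<longrightarrow> \<Gamma> t = ray u (t / (1 / (a0 * S)))" by blast
    fix s :: real assume s: "0 < s \<and> s < 1"
    define e where "e = E (S * s)"
    have e: "0 < e" "e < T" using inside s by (auto simp: e_def)
    define w where "w = bk e"
    have w: "w \<in> D" "fst w = ray u e" "snd w = (\<not> snd u)" using bkD e by (auto simp: w_def bk_def)
    have lw: "l w > 0" using l_pos w by blast
    have mu: "\<mu> e = 1 / l w" using e by (simp add: \<mu>_def w_def)
    obtain a d where a: "a > 0" "d > 0"
      "\<forall>t. 0 \<le> t \<and> t < d \<longrightarrow> E (S * s - t) = e - a * t \<and> E (S * s + t) = e + a * \<mu> e * t"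
      using loc[of "S * s"] unfolding e_def by blast
    have "\<Gamma> (s + t) = \<gamma> w (a * S * t)" if t: "\<bar>t\<bar> < d / S" for t
    proof -
      have St: "\<bar>S * t\<bar> < d" using t S0 by (simp add: abs_mult pos_less_divide_eq mult.commute)
      have wr: "ray w x = ray u (e - x)" "ray (opp w) x = ray u (e + x)" for x
        using ray_back[of u e x] ray_ray[of u e x] by (simp_all add: w_def bk_def)
      show ?thesis
      proof (cases "t \<le> 0")
        case True
        then have "S * t \<le> 0" "a * S * t \<le> 0" using S0 a(1) by (simp_all add: mult_nonneg_nonpos)
        moreover have "E (S * s - (- (S * t))) = e - a * (- (S * t))"
          using a(3)[rule_format, of "- (S * t)"] St \<open>S * t \<le> 0\<close> by simp
        ultimately show ?thesis by (simp add: \<gamma>_def half_path_ray wr \<Gamma>_def distrib_left mult.assoc)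
      next
        case False
        then have "0 < S * t" "0 < a * S * t" using S0 a(1) by simp_all
        moreover have "E (S * s + S * t) = e + a * \<mu> e * (S * t)"
          using a(3)[rule_format, of "S * t"] St \<open>0 < S * t\<close> by simp
        ultimately show ?thesis using p_opp[OF w(1)] by (simp add: \<gamma>_def half_path_ray wr \<Gamma>_def distrib_left mu mult_ac)
      qed
    qed
    moreover have "a * S > 0" "d / S > 0" using a S0 by auto
    moreover have "fst w = \<Gamma> s" using w by (simp add: \<Gamma>_def e_def)
    ultimately show "\<exists>w\<in>D. \<exists>a>0. \<exists>d>0. fst w = \<Gamma> s \<and> (\<forall>t. \<bar>t\<bar> < d \<longrightarrow> \<Gamma> (s + t) = \<gamma> w (a * t))"
      using w(1) by blast
  qed
  then show ?thesis by blast
qed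

lemma complete_gluing:
  obtains l' where "gluing_data UNIV opp l'"
    "\<And>f g. mutual_inverse f g \<Longrightarrow> homeo f \<Longrightarrow> gluing_invariant D p l f \<Longrightarrow> gluing_invariant D p l g \<Longrightarrow>
      gluing_invariant UNIV opp l' f"
proof -
  have "\<forall>u. \<exists>W. u \<notin> D \<longrightarrow> (\<exists>\<Gamma>. unit_arc u \<Gamma> W)"
    using unit_arc_exists missing_iff by blast
  then obtain W where W: "\<And>u. u \<notin> D \<Longrightarrow> \<exists>\<Gamma>. unit_arc u \<Gamma> (W u)" by metis
  then have Wpos: "W u > 0" if "u \<notin> D" for u using that by (auto simp: unit_arc_def)
  \<comment> \<open>On the side of \<open>u\<close>, the point \<open>ray u t\<close> has arc
    parameter \<open>W u * t\<close>. The chart given by minus this parameter on that side and by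
    the arc parameter on the other side, divided by \<open>W u\<close>, has the scale chosen
    here.\<close>
  define l' where "l' u = (if u \<in> D then l u else W (opp u) / W u)" for u
  have "gluing_data UNIV opp l'"
    unfolding gluing_data_def
  proof (intro conjI ballI)
    fix u
    show "l' u > 0" using l_pos Wpos opp_D by (simp add: l'_def)
    show "l' (opp u) = 1 / l' u" using l_p[of u] p_opp[of u] opp_D[of u] by (auto simp: l'_def)
  next
    have "{u. \<not> (u \<in> UNIV \<and> opp u = opp u \<and> l' u = 1)} \<subseteq> {u. \<not> (u \<in> D \<and> p u = opp u \<and> l u = 1)}"
      by (auto simp: l'_def)
    then show "finite {u. \<not> (u \<in> UNIV \<and> opp u = opp u \<and> l' u = 1)}"
      using data finite_subset unfolding gluing_data_def by blast
  qed auto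
  moreover have "gluing_invariant UNIV opp l' f"
    if fg: "mutual_inverse f g" and f: "homeo f"
      and inv: "gluing_invariant D p l f" "gluing_invariant D p l g" for f g
  proof -
    have PA: "PA f" using fg by (simp add: mutual_inverse_def)
    have iff: "half_map f u \<in> D \<longleftrightarrow> u \<in> D" for u
      using inv mutual_inverseD(1)[OF fg, of u] unfolding gluing_invariant_def by metis
    have "l' (half_map f u) = l' u * slope f u / slope f (opp u)" for u
    proof (cases "u \<in> D")
      case True
      then show ?thesis using inv(1) p_opp iff by (simp add: l'_def gluing_invariant_def)
    next
      case False
      have *: "slope f v * W (half_map f v) = W v" if v: "v \<notin> D" for v
      proof -
        obtain \<Gamma> where "unit_arc v \<Gamma> (W v)" using W[OF v] by blast
        moreover obtain \<Gamma>' where "unit_arc (half_map f v) \<Gamma>' (W (half_map f v))" using W iff v by blast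
        ultimately show ?thesis by (rule unit_arc_speed[OF fg f inv])
      qed
      have o: "opp u \<notin> D" using False opp_D by simp
      have "W u = slope f u * W (half_map f u)" "W (opp u) = slope f (opp u) * W (opp (half_map f u))"
        using *[OF False] *[OF o] homeo_half_map_opp[OF PA f] by simp_all
      moreover have "slope f u > 0" "slope f (opp u) > 0" using slope_pos[OF PA] by auto
      ultimately show ?thesis using False iff by (simp add: l'_def)
    qed
    then show ?thesis using homeo_half_map_opp[OF PA f] by (simp add: gluing_invariant_def)
  qed
  ultimately show thesis by (rule that)
qed

end

lemma gluing_invariant_cong:
  assumes "PA f" "pw_eq std_circle f g" "gluing_invariant D p l f"
  shows "gluing_invariant D p l g"
  using assms(3) unfolding gluing_invariant_def half_map_cong[OF assms(1,2)] .

lemma point_gluing_restrict: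
  assumes "gluing_data D p l" shows "point_gluing {u \<in> D. p u = opp u} p l"
proof unfold_locales
  show "gluing_data {u \<in> D. p u = opp u} p l"
    using assms unfolding gluing_data_def by (auto elim: rev_finite_subset)
  show "fst u = fst v \<longleftrightarrow> v = u \<or> v = p u"
    if "u \<in> {u \<in> D. p u = opp u}" "v \<in> {u \<in> D. p u = opp u}" for u v
    using that by (auto simp: opp_def prod_eq_iff)
qed simp

text \<open>Half-point maps of homeomorphisms commute with \<open>opp\<close>, hence preserve the
  condition \<open>p u = opp u\<close>.\<close>

lemma gluing_invariant_restrict:
  assumes f: "PA f" "homeo f" and D: "gluing_data D p l" and inv: "gluing_invariant D p l f"
  shows "gluing_invariant {u \<in> D. p u = opp u} p l f"
  using inv homeo_half_map_opp[OF f] unfolding gluing_invariant_def by auto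

section \<open>A new atlas on the unchanged topological circle\<close>

locale gluing_in_place = gluing UNIV opp l fst for l
begin

lemma \<phi>_id: "\<phi> x = x"
  by (simp add: \<phi>_def)

lemma \<gamma>_in_place: "\<gamma> u t = (if t \<le> 0 then ray u (- t) else ray (opp u) (t / l u))"
  by (simp add: \<gamma>_def half_path_def \<phi>_id)

lemma points_in_place: "P = UNIV"
  by (simp add: P_eq)

lemma open_imp_is_open:
  assumes U: "open U" shows "is_open U"
  unfolding is_open_def points_in_place
proof (intro conjI ballI impI)
  fix u assume u: "\<gamma> u 0 \<in> U"
  have lp: "l u > 0" using l_pos by simp
  have oU: "openin (ctop std_circle) U" using U unfolding std_circle_def by simp
  have u0: "ray u 0 \<in> U" "ray (opp u) 0 \<in> U" using u by simp_all
  obtain d where d: "d > 0" "\<And>t. \<bar>t\<bar> < d \<Longrightarrow> ray u t \<in> U"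
    by (rule aparam_eventually_in[OF wf_std_circle aparam_ray oU u0(1)], rule that)
  obtain e where e: "e > 0" "\<And>t. \<bar>t\<bar> < e \<Longrightarrow> ray (opp u) t \<in> U"
    by (rule aparam_eventually_in[OF wf_std_circle aparam_ray oU u0(2)], rule that)
  have "\<gamma> u t \<in> U" if t: "\<bar>t\<bar> < min d (e * l u)" for t
  proof (cases "t \<le> 0")
    case True
    then show ?thesis using d(2)[of "- t"] t by (simp add: \<gamma>_in_place)
  next
    case False
    then have "\<bar>t / l u\<bar> < e" using t lp by (simp add: pos_divide_less_eq)
    then show ?thesis using e(2)[of "t / l u"] False by (simp add: \<gamma>_in_place)
  qed
  moreover have "min d (e * l u) > 0" using d(1) e(1) lp by simp
  ultimately show "\<exists>\<delta>>0. \<forall>t. \<bar>t\<bar> < \<delta> \<longrightarrow> \<gamma> u t \<in> U" by blast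
qed simp

lemma is_open_imp_open:
  assumes U: "is_open U" shows "open U"
proof -
  have "open (circle_proj -` U)"
    unfolding open_dist
  proof
    fix x assume x: "x \<in> circle_proj -` U"
    \<comment> \<open>With the left side as the first half-point, \<open>\<gamma> u\<close> runs in
      the increasing direction of the line.\<close>
    define u where "u = (circle_proj x, False)"
    have lp: "l u > 0" using l_pos by simp
    have "\<gamma> u 0 \<in> U" using x by (simp add: u_def)
    then obtain d where d: "d > 0" "\<forall>t. \<bar>t\<bar> < d \<longrightarrow> \<gamma> u t \<in> U"
      using U unfolding is_open_def by blast
    have "y \<in> circle_proj -` U" if y: "dist y x < min d (d / l u)" for y
    proof (cases "y \<le> x")
      case True
      then have "\<gamma> u (y - x) = circle_proj y" by (simp add: \<gamma>_in_place u_def ray_proj)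
      moreover have "\<bar>y - x\<bar> < d" using y by (simp add: dist_real_def)
      ultimately show ?thesis using d(2) by (metis vimage_eq)
    next
      case False
      then have "(y - x) * l u > 0" using lp by simp
      then have "\<gamma> u ((y - x) * l u) = ray (opp u) (y - x)" using lp by (simp add: \<gamma>_in_place)
      also have "\<dots> = circle_proj y" by (simp add: u_def ray_proj)
      finally have "\<gamma> u ((y - x) * l u) = circle_proj y" .
      moreover have "\<bar>(y - x) * l u\<bar> < d"
        using y lp by (simp add: dist_real_def abs_mult pos_less_divide_eq)
      ultimately show ?thesis using d(2) by (metis vimage_eq)
    qed
    moreover have "min d (d / l u) > 0" using d(1) lp by simp
    ultimately show "\<exists>e>0. \<forall>y. dist y x < e \<longrightarrow> y \<in> circle_proj -` U" by blast
  qed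
  then show ?thesis by (simp add: open_circle_def)
qed

lemma ctop_in_place: "ctop X = ctop std_circle"
proof -
  have "openin (ctop std_circle) U \<longleftrightarrow> open U" for U
    by (simp add: std_circle_def)
  then have "openin (ctop X) U \<longleftrightarrow> openin (ctop std_circle) U" for U
    using open_imp_is_open[of U] is_open_imp_open[of U] openin_X[of U] by metis
  then show ?thesis by (simp add: topology_eq)
qed

end

lemma gluing_in_placeI:
  assumes "gluing_data UNIV opp l" shows "gluing_in_place l"
proof unfold_locales
  show "gluing_data UNIV opp l" by (rule assms)
  show "fst u = fst v \<longleftrightarrow> v = u \<or> v = opp u" for u v :: half
    by (auto simp: opp_def prod_eq_iff)
qed

theorem theorem1p4:
  fixes H :: "(circle \<Rightarrow> circle) set set"
  assumes "subgroup H (PC_Aff std_circle)"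
    and "relative_FW (PC_Aff std_circle) H"
  shows "(\<exists>(X' :: circle curve) \<phi>.
            affine_curve X' \<and> \<phi> \<in> pw_iso std_circle X' \<and>
            pw_conj std_circle X' \<phi> ` H \<subseteq> Aut_Aff X') \<and>
         (infinite H \<and> H \<subseteq> PC0_Aff std_circle \<longrightarrow>
           (\<exists>(X' :: circle curve) \<phi>.
              affine_curve X' \<and> \<phi> \<in> pw_iso std_circle X' \<and>
              pw_conj std_circle X' \<phi> ` H \<subseteq> Aut_Aff X' \<and>
              (\<exists>f\<in>\<phi>. pw_affine_homeo std_circle X' f) \<and>
              ctop X' homeomorphic_space ctop std_circle))"
proof (intro conjI impI)
  obtain D p l where D: "gluing_data D p l" and inv: "\<And>f. f \<in> \<Union>H \<Longrightarrow> gluing_invariant D p l f"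
    by (rule invariant_gluing_data[OF assms], rule that)
  show "\<exists>(X' :: circle curve) \<phi>. affine_curve X' \<and> \<phi> \<in> pw_iso std_circle X' \<and>
      pw_conj std_circle X' \<phi> ` H \<subseteq> Aut_Aff X'"
  proof -
    obtain \<kappa> :: "half \<Rightarrow> circle" where \<kappa>: "gluing D p l \<kappa>" by (rule gluing_labels[OF D])
    interpret gluing D p l \<kappa> by (rule \<kappa>)
    show ?thesis using affine_curve_X \<phi>_in_pw_iso pw_conj_Aut[OF assms(1) inv] by blast
  qed
  assume H0: "infinite H \<and> H \<subseteq> PC0_Aff std_circle"
  \<comment> \<open>A class in \<open>PC0_Aff\<close> contains a homeomorphism, but not each of its
    members is one; invariance depends only on the class and is transferred from that
    representative.\<close>
  have rep: "\<exists>h\<in>\<Union>H. PA h \<and> homeo h \<and> pw_eq std_circle h f" if f: "f \<in> \<Union>H" for f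
  proof -
    obtain A where A: "A \<in> H" "f \<in> A" using f by blast
    then obtain h where h: "h \<in> A" "homeo h" using H0 by (auto simp: PC0_Aff_def)
    have Ac: "A \<in> carrier PC" using A(1) subgroup.subset[OF assms(1)] by blast
    have "pw_eq std_circle h f" using PC_memD(2)[OF Ac h(1)] A(2) by (auto simp: pw_class_def)
    then show ?thesis using A h PC_memD(1)[OF Ac h(1)] by blast
  qed
  let ?D = "{u \<in> D. p u = opp u}"
  have invD: "gluing_invariant ?D p l f" if f: "f \<in> \<Union>H" for f
  proof -
    obtain h where h: "h \<in> \<Union>H" "PA h" "homeo h" "pw_eq std_circle h f" using rep[OF f] by blast
    show ?thesis
      by (rule gluing_invariant_cong[OF h(2,4) gluing_invariant_restrict[OF h(2,3) D inv[OF h(1)]]])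
  qed
  obtain l' where l': "gluing_data UNIV opp l'"
    "\<And>f g. mutual_inverse f g \<Longrightarrow> homeo f \<Longrightarrow> gluing_invariant ?D p l f \<Longrightarrow> gluing_invariant ?D p l g \<Longrightarrow>
      gluing_invariant UNIV opp l' f"
    by (rule point_gluing.complete_gluing[OF point_gluing_restrict[OF D]], rule that)
  have inv': "gluing_invariant UNIV opp l' f" if f: "f \<in> \<Union>H" for f
  proof -
    obtain h where h: "h \<in> \<Union>H" "PA h" "homeo h" "pw_eq std_circle h f" using rep[OF f] by blast
    obtain g where g: "g \<in> \<Union>H" "mutual_inverse h g" by (rule subgroup_mutual_inverse[OF assms(1) h(1)])
    show ?thesis
      by (rule gluing_invariant_cong[OF h(2,4) l'(2)[OF g(2) h(3) invD[OF h(1)] invD[OF g(1)]]])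
  qed
  interpret gluing_in_place l' by (rule gluing_in_placeI[OF l'(1)])
  \<comment> \<open>Old and new curve share points and topology, so the identity is the required
    homeomorphism; only the atlas has changed.\<close>
  have "\<phi> = id" using \<phi>_id by (simp add: fun_eq_iff)
  then have homeo: "homeomorphic_map (ctop std_circle) (ctop X) \<phi>"
    unfolding ctop_in_place by simp
  then have "pw_affine_homeo std_circle X \<phi>" using pw_affine_\<phi> by (simp add: pw_affine_homeo_def)
  moreover have "\<phi> \<in> pw_class std_circle \<phi>" by (simp add: pw_class_def pw_eq_refl)
  moreover have "ctop X homeomorphic_space ctop std_circle"
    unfolding ctop_in_place by (rule homeomorphic_space_refl)
  ultimately show "\<exists>(X' :: circle curve) \<phi>. affine_curve X' \<and> \<phi> \<in> pw_iso std_circle X' \<and>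
      pw_conj std_circle X' \<phi> ` H \<subseteq> Aut_Aff X' \<and> (\<exists>f\<in>\<phi>. pw_affine_homeo std_circle X' f) \<and>
      ctop X' homeomorphic_space ctop std_circle"
    using affine_curve_X \<phi>_in_pw_iso pw_conj_Aut[OF assms(1) inv'] by blast
qed

end
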